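(* Let $d=1$, $\alpha\in(0,\infty)$, $J_n=|n|^{-(1+\alpha)}$ for $n\in\mathbb{Z}\setminus\{0\}$, $J_0=0$. Suppose $p\ge5$ if $\alpha\in(0,1]$ and $p\ge7$ if $\alpha\in(1,\infty)$. Then there exists $\delta>0$ such that whenever $\|\phi\|_{l^2}<\delta$, there exist unique asymptotic states $u_\pm\in l^2(\mathbb{Z})$ with $\|u_\pm\|_{l^2}=\|\phi\|_{l^2}$ such that the solution $u$ of $i\dot u=Lu-|u|^{p-1}u$ with $u(0)=\phi$ satisfies $$u(t)-U(t)u_\pm\to0\ \text{ in } l^2(\mathbb{Z})\quad\text{as } t\to\pm\infty.$$ Furthermore, each of the maps $\phi\mapsto u_\pm$ defines a homeomorphism on the $\delta$-neighborhood of the origin in $l^2(\mathbb{Z})$.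
   Context: $(Lu)_n=\sum_{m\ne n}J_{n-m}(u_n-u_m)$ on $l^2(\mathbb{Z})$, $(|u|^{p-1}u)_n=|u_n|^{p-1}u_n$, and $U(t)=e^{-itL}$ is the linear flow of $i\dot u=Lu$. *)

theory Defs
  imports "HOL-Analysis.Analysis"
begin

section \<open>The Hilbert space of square-summable complex families\<close>

definition square_summable :: "('a \<Rightarrow> complex) \<Rightarrow> bool" where
  "square_summable f \<longleftrightarrow> (\<lambda>x. (cmod (f x))\<^sup>2) summable_on UNIV"

lemma square_summable_0: "square_summable (\<lambda>_. 0)"
  by (simp add: square_summable_def)

typedef 'a ell2 = "{f :: 'a \<Rightarrow> complex. square_summable f}"
  morphisms coord Abs_ell2
  using square_summable_0 by auto

setup_lifting type_definition_ell2

lemma square_summable_L2_set_le: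
  assumes "square_summable f" "finite F"
  shows "L2_set (\<lambda>x. cmod (f x)) F \<le> sqrt (\<Sum>\<^sub>\<infinity>x. (cmod (f x))\<^sup>2)"
  unfolding L2_set_def
  by (rule real_sqrt_le_mono, rule finite_sum_le_infsum)
    (use assms in \<open>auto simp: square_summable_def\<close>)

lemma square_summableI:
  assumes "\<And>F. finite F \<Longrightarrow> L2_set (\<lambda>x. cmod (f x)) F \<le> B"
  shows "square_summable f" "sqrt (\<Sum>\<^sub>\<infinity>x. (cmod (f x))\<^sup>2) \<le> B"
proof -
  have B: "0 \<le> B" using assms[of "{}"] by simp
  have le: "(\<Sum>x\<in>F. (cmod (f x))\<^sup>2) \<le> B\<^sup>2" if "finite F" for F
    using assms[OF that] B unfolding L2_set_def
    by (metis real_sqrt_le_iff real_sqrt_unique)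
  show *: "square_summable f"
    unfolding square_summable_def
    by (rule nonneg_bdd_above_summable_on) (auto intro!: bdd_aboveI2 le)
  have "(\<Sum>\<^sub>\<infinity>x. (cmod (f x))\<^sup>2) \<le> B\<^sup>2"
    by (rule infsum_le_finite_sums) (use * le in \<open>auto simp: square_summable_def\<close>)
  thus "sqrt (\<Sum>\<^sub>\<infinity>x. (cmod (f x))\<^sup>2) \<le> B"
    by (simp add: real_le_lsqrt B)
qed

lemma square_summable_add_aux:
  assumes "square_summable f" "square_summable g" "finite F"
  shows "L2_set (\<lambda>x. cmod (f x + g x)) F
    \<le> sqrt (\<Sum>\<^sub>\<infinity>x. (cmod (f x))\<^sup>2) + sqrt (\<Sum>\<^sub>\<infinity>x. (cmod (g x))\<^sup>2)"
proof -
  have "L2_set (\<lambda>x. cmod (f x + g x)) F \<le> L2_set (\<lambda>x. cmod (f x) + cmod (g x)) F"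
    by (intro L2_set_mono norm_triangle_ineq) auto
  also have "\<dots> \<le> L2_set (\<lambda>x. cmod (f x)) F + L2_set (\<lambda>x. cmod (g x)) F"
    by (rule L2_set_triangle_ineq)
  also have "\<dots> \<le> sqrt (\<Sum>\<^sub>\<infinity>x. (cmod (f x))\<^sup>2) + sqrt (\<Sum>\<^sub>\<infinity>x. (cmod (g x))\<^sup>2)"
    by (intro add_mono square_summable_L2_set_le assms)
  finally show ?thesis .
qed

lemma square_summable_add:
  "square_summable f \<Longrightarrow> square_summable g \<Longrightarrow> square_summable (\<lambda>x. f x + g x)"
  by (rule square_summableI) (rule square_summable_add_aux)

lemma square_summable_cmult: "square_summable f \<Longrightarrow> square_summable (\<lambda>x. c * f x)"
  by (simp add: square_summable_def norm_mult power_mult_distrib summable_on_cmult_right)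

instantiation ell2 :: (type) real_normed_vector
begin

lift_definition zero_ell2 :: "'a ell2" is "\<lambda>_. 0"
  by (rule square_summable_0)
lift_definition plus_ell2 :: "'a ell2 \<Rightarrow> 'a ell2 \<Rightarrow> 'a ell2" is "\<lambda>f g x. f x + g x"
  by (rule square_summable_add)
lift_definition uminus_ell2 :: "'a ell2 \<Rightarrow> 'a ell2" is "\<lambda>f x. - f x"
  by (simp add: square_summable_def)
lift_definition minus_ell2 :: "'a ell2 \<Rightarrow> 'a ell2 \<Rightarrow> 'a ell2" is "\<lambda>f g x. f x - g x"
  subgoal for f g
    using square_summable_add[of f "\<lambda>x. - g x"] by (simp add: square_summable_def)
  done
lift_definition scaleR_ell2 :: "real \<Rightarrow> 'a ell2 \<Rightarrow> 'a ell2" is "\<lambda>r f x. r *\<^sub>R f x"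
  unfolding scaleR_conv_of_real by (rule square_summable_cmult)
lift_definition norm_ell2 :: "'a ell2 \<Rightarrow> real" is "\<lambda>f. sqrt (\<Sum>\<^sub>\<infinity>x. (cmod (f x))\<^sup>2)" .

definition dist_ell2 :: "'a ell2 \<Rightarrow> 'a ell2 \<Rightarrow> real" where
  "dist_ell2 u v = norm (u - v)"
definition sgn_ell2 :: "'a ell2 \<Rightarrow> 'a ell2" where
  "sgn_ell2 u = inverse (norm u) *\<^sub>R u"
definition uniformity_ell2 :: "('a ell2 \<times> 'a ell2) filter" where
  "uniformity_ell2 = (INF e\<in>{0 <..}. principal {(x, y). dist x y < e})"
definition open_ell2 :: "'a ell2 set \<Rightarrow> bool" where
  "open_ell2 S = (\<forall>x\<in>S. \<forall>\<^sub>F (x', y) in uniformity. x' = x \<longrightarrow> y \<in> S)"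

instance
proof
  fix u v w :: "'a ell2" and a b :: real
  show "u + v + w = u + (v + w)" "u + v = v + u" "0 + u = u" "- u + u = 0" "u - v = u + - v"
    by (transfer; simp add: add_ac)+
  show "a *\<^sub>R (u + v) = a *\<^sub>R u + a *\<^sub>R v" "(a + b) *\<^sub>R u = a *\<^sub>R u + b *\<^sub>R u"
    "a *\<^sub>R b *\<^sub>R u = (a * b) *\<^sub>R u" "1 *\<^sub>R u = u"
    by (transfer; simp add: scaleR_add_right scaleR_add_left)+
  show "norm u = 0 \<longleftrightarrow> u = 0"
  proof transfer
    fix f :: "'a \<Rightarrow> complex" assume f: "square_summable f"
    show "sqrt (\<Sum>\<^sub>\<infinity>x. (cmod (f x))\<^sup>2) = 0 \<longleftrightarrow> f = (\<lambda>_. 0)"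
    proof
      assume 0: "sqrt (\<Sum>\<^sub>\<infinity>x. (cmod (f x))\<^sup>2) = 0"
      have "f x = 0" for x
        using square_summable_L2_set_le[OF f, of "{x}"] 0 by simp
      thus "f = (\<lambda>_. 0)" by auto
    qed simp
  qed
  show "norm (u + v) \<le> norm u + norm v"
    by transfer (rule square_summableI(2), rule square_summable_add_aux)
  show "norm (a *\<^sub>R u) = \<bar>a\<bar> * norm u"
    by transfer (simp add: power_mult_distrib infsum_cmult_right' real_sqrt_mult)
qed (simp_all add: dist_ell2_def sgn_ell2_def uniformity_ell2_def open_ell2_def)

end

lift_definition scaleC :: "complex \<Rightarrow> 'a ell2 \<Rightarrow> 'a ell2" (infixr "*\<^sub>C" 75)
  is "\<lambda>c f x. c * f x"
  by (rule square_summable_cmult)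

lemma coord_0 [simp]: "coord 0 x = 0"
  by transfer simp
lemma coord_add [simp]: "coord (u + v) x = coord u x + coord v x"
  by transfer simp
lemma coord_minus [simp]: "coord (- u) x = - coord u x"
  by transfer simp
lemma coord_diff [simp]: "coord (u - v) x = coord u x - coord v x"
  by transfer simp
lemma coord_scaleR [simp]: "coord (r *\<^sub>R u) x = r *\<^sub>R coord u x"
  by transfer simp
lemma coord_scaleC [simp]: "coord (c *\<^sub>C u) x = c * coord u x"
  by transfer simp

lemma ell2_eqI: "(\<And>x. coord u x = coord v x) \<Longrightarrow> u = v"
  by (simp add: coord_inject[symmetric] fun_eq_iff)

lemma norm_scaleC: "norm (c *\<^sub>C u) = cmod c * norm u"
  by transfer (simp add: norm_mult power_mult_distrib infsum_cmult_right' real_sqrt_mult)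

lemma L2_set_coord_le: "finite F \<Longrightarrow> L2_set (\<lambda>x. cmod (coord u x)) F \<le> norm u"
  by transfer (rule square_summable_L2_set_le)

lemma cmod_coord_le: "cmod (coord u x) \<le> norm u"
  using L2_set_coord_le[of "{x}" u] by simp

lemma bounded_linear_coord: "bounded_linear (\<lambda>u. coord u x)"
  by (rule bounded_linear_intro[where K = 1]) (simp_all add: cmod_coord_le)

instance ell2 :: (type) banach
proof
  fix X :: "nat \<Rightarrow> 'a ell2" assume X: "Cauchy X"
  have "Cauchy (\<lambda>n. coord (X n) x)" for x
    by (rule bounded_linear.Cauchy[OF bounded_linear_coord X])
  hence lim: "(\<lambda>n. coord (X n) x) \<longlonglongrightarrow> lim (\<lambda>n. coord (X n) x)" for x
    by (simp add: Cauchy_convergent_iff convergent_LIMSEQ_iff)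
  define f where "f = (\<lambda>x. lim (\<lambda>n. coord (X n) x))"
  have f: "(\<lambda>n. coord (X n) x) \<longlonglongrightarrow> f x" for x
    unfolding f_def by (rule lim)
  have key: "\<exists>N. \<forall>m\<ge>N. \<forall>F. finite F \<longrightarrow> L2_set (\<lambda>x. cmod (coord (X m) x - f x)) F \<le> e"
    if "e > 0" for e
  proof -
    obtain N where N: "\<And>m n. m \<ge> N \<Longrightarrow> n \<ge> N \<Longrightarrow> norm (X m - X n) < e"
      using CauchyD[OF X \<open>e > 0\<close>] by blast
    have "L2_set (\<lambda>x. cmod (coord (X m) x - f x)) F \<le> e" if "m \<ge> N" "finite F" for m F
    proof (rule tendsto_upperbound)
      show "(\<lambda>n. L2_set (\<lambda>x. cmod (coord (X m) x - coord (X n) x)) F)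
          \<longlonglongrightarrow> L2_set (\<lambda>x. cmod (coord (X m) x - f x)) F"
        unfolding L2_set_def by (intro tendsto_intros f)
      have "L2_set (\<lambda>x. cmod (coord (X m) x - coord (X n) x)) F \<le> e" if "n \<ge> N" for n
        using L2_set_coord_le[OF \<open>finite F\<close>, of "X m - X n"] N[OF \<open>m \<ge> N\<close> that] by simp
      thus "\<forall>\<^sub>F n in sequentially. L2_set (\<lambda>x. cmod (coord (X m) x - coord (X n) x)) F \<le> e"
        by (auto simp: eventually_sequentially)
    qed simp
    thus ?thesis by blast
  qed
  obtain N where N: "\<And>F. finite F \<Longrightarrow> L2_set (\<lambda>x. cmod (coord (X N) x - f x)) F \<le> 1"
    using key[of 1] by auto
  have "square_summable (\<lambda>x. coord (X N) x - f x)"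
    by (rule square_summableI(1)[OF N])
  from square_summable_add[OF _ square_summable_cmult[OF this, of "-1"], of "coord (X N)"]
  have sf: "square_summable f"
    using coord[of "X N"] by simp
  have "X \<longlonglongrightarrow> Abs_ell2 f"
  proof (rule LIMSEQ_I)
    fix r :: real assume "r > 0"
    then obtain N where N: "\<And>m F. m \<ge> N \<Longrightarrow> finite F \<Longrightarrow>
        L2_set (\<lambda>x. cmod (coord (X m) x - f x)) F \<le> r / 2"
      using key[of "r / 2"] by auto
    have "norm (X m - Abs_ell2 f) \<le> r / 2" if "m \<ge> N" for m
      unfolding norm_ell2.rep_eq
      by (rule square_summableI(2)) (use N[OF that] sf in \<open>simp add: Abs_ell2_inverse\<close>)
    moreover have "r / 2 < r" using \<open>r > 0\<close> by simp
    ultimately show "\<exists>N. \<forall>m\<ge>N. norm (X m - Abs_ell2 f) < r"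
      using le_less_trans by blast
  qed
  thus "convergent X" by (auto simp: convergent_def)
qed

section \<open>The long-range operator and its linear flow\<close>

definition power_kernel :: "real \<Rightarrow> int \<Rightarrow> real" where
  "power_kernel \<alpha> n = (if n = 0 then 0 else \<bar>real_of_int n\<bar> powr (- (1 + \<alpha>)))"

definition lap_seq :: "(int \<Rightarrow> real) \<Rightarrow> (int \<Rightarrow> complex) \<Rightarrow> int \<Rightarrow> complex" where
  "lap_seq J u n = (\<Sum>\<^sub>\<infinity>m\<in>{m. m \<noteq> n}. of_real (J (n - m)) * (u n - u m))"

(* By coord_lap below, the result of lap_seq is square summable whenever the kernel is absolutely
   summable, so Abs_ell2 is then applied inside its domain. *)
definition lap :: "(int \<Rightarrow> real) \<Rightarrow> int ell2 \<Rightarrow> int ell2" where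
  "lap J u = Abs_ell2 (lap_seq J (coord u))"

(* exp(-itL) as the exponential series of the bounded operator L; the series converges in norm by
   linear_flow_sums. *)
definition linear_flow :: "(int \<Rightarrow> real) \<Rightarrow> real \<Rightarrow> int ell2 \<Rightarrow> int ell2" where
  "linear_flow J t u = (\<Sum>k. ((- \<i> * of_real t) ^ k / fact k) *\<^sub>C (lap J ^^ k) u)"

lemma power_kernel_abs_summable:
  assumes "\<alpha> > 0"
  shows "(\<lambda>k. \<bar>power_kernel \<alpha> k\<bar>) summable_on UNIV"
proof -
  have "summable (\<lambda>n. real n powr (- (1 + \<alpha>)))"
    using assms by (simp add: summable_real_powr_iff)
  hence nat: "(\<lambda>n. real n powr (- (1 + \<alpha>))) summable_on UNIV"
    by (rule summable_nonneg_imp_summable_on) simp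
  have k: "(\<lambda>k. \<bar>power_kernel \<alpha> k\<bar>) \<circ> int = (\<lambda>n. real n powr (- (1 + \<alpha>)))"
    "(\<lambda>k. \<bar>power_kernel \<alpha> k\<bar>) \<circ> (\<lambda>n. - int n) = (\<lambda>n. real n powr (- (1 + \<alpha>)))"
    by (auto simp: fun_eq_iff power_kernel_def)
  have pos: "(\<lambda>k. \<bar>power_kernel \<alpha> k\<bar>) summable_on range int"
    using nat by (subst summable_on_reindex) (simp_all only: k inj_of_nat)
  have "inj (\<lambda>n. - int n)" by (simp add: inj_def)
  hence neg: "(\<lambda>k. \<bar>power_kernel \<alpha> k\<bar>) summable_on range (\<lambda>n. - int n)"
    using nat by (subst summable_on_reindex) (simp_all only: k)
  have "(\<lambda>k. \<bar>power_kernel \<alpha> k\<bar>) summable_on (range int \<union> (range (\<lambda>n. - int n) - range int))"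
    by (intro summable_on_Un_disjoint pos summable_on_subset_banach[OF neg]) auto
  moreover have "range int \<union> (range (\<lambda>n. - int n) - range int) = UNIV"
    by (auto simp: image_iff) (metis int_cases2)
  ultimately show ?thesis by simp
qed

lift_definition shift :: "int \<Rightarrow> int ell2 \<Rightarrow> int ell2" is "\<lambda>k f n. f (n - k)"
  subgoal for k f
    unfolding square_summable_def
    by (subst summable_on_reindex_bij_betw[where g = "\<lambda>n. n - k" and B = UNIV])
      (auto intro!: bij_betwI[where g = "\<lambda>n. n + k"])
  done

lemma norm_shift [simp]: "norm (shift k u) = norm u"
proof -
  have "bij_betw (\<lambda>n. n - k) UNIV UNIV"
    by (rule bij_betwI[where g = "\<lambda>n. n + k"]) auto
  from infsum_reindex_bij_betw[OF this, of "\<lambda>n. (cmod (coord u n))\<^sup>2"] show ?thesis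
    by (simp add: norm_ell2.rep_eq shift.rep_eq)
qed

lemma lap_aux:
  assumes "(\<lambda>k. \<bar>J k\<bar>) summable_on UNIV"
  shows "coord (lap J u) = lap_seq J (coord u)"
    and "norm (lap J u) \<le> 2 * (\<Sum>\<^sub>\<infinity>k. \<bar>J k\<bar>) * norm u"
proof -
  define T where "T = (\<lambda>k. J k *\<^sub>R (u - shift k u))"
  have T: "norm (T k) \<le> \<bar>J k\<bar> * (2 * norm u)" for k
    unfolding T_def norm_scaleR
    by (intro mult_left_mono order_trans[OF norm_triangle_ineq4]) auto
  have sJ: "(\<lambda>k. \<bar>J k\<bar> * (2 * norm u)) summable_on UNIV"
    by (intro summable_on_cmult_left assms)
  have absT: "(\<lambda>k. norm (T k)) summable_on UNIV"
    by (rule Infinite_Sum.abs_summable_on_comparison_test'[OF sJ]) (rule T)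
  hence sT: "T summable_on UNIV"
    by (rule abs_summable_summable)
  have "norm (infsum T UNIV) \<le> (\<Sum>\<^sub>\<infinity>k. \<bar>J k\<bar> * (2 * norm u))"
    using Infinite_Sum.norm_infsum_bound[OF absT] infsum_mono[OF absT sJ T] by linarith
  hence bd: "norm (infsum T UNIV) \<le> 2 * (\<Sum>\<^sub>\<infinity>k. \<bar>J k\<bar>) * norm u"
    unfolding infsum_cmult_left' by (simp add: mult_ac)
  have "coord (infsum T UNIV) n = lap_seq J (coord u) n" for n
  proof -
    have "((\<lambda>k. coord (T k) n) has_sum coord (infsum T UNIV) n) UNIV"
      by (rule has_sum_bounded_linear[OF bounded_linear_coord has_sum_infsum[OF sT]])
    hence "coord (infsum T UNIV) n = (\<Sum>\<^sub>\<infinity>k. coord (T k) n)"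
      by (simp add: infsumI)
    also have "\<dots> = (\<Sum>\<^sub>\<infinity>k\<in>{k. k \<noteq> 0}. coord (T k) n)"
      by (rule infsum_cong_neutral) (auto simp: T_def shift.rep_eq)
    also have "\<dots> = lap_seq J (coord u) n"
      unfolding lap_seq_def
      by (rule infsum_reindex_bij_witness[where i = "\<lambda>m. n - m" and j = "\<lambda>k. n - k"])
        (auto simp: T_def shift.rep_eq scaleR_conv_of_real)
    finally show ?thesis .
  qed
  hence eq: "coord (infsum T UNIV) = lap_seq J (coord u)" by auto
  hence "lap J u = infsum T UNIV"
    by (metis lap_def coord_inverse)
  thus "coord (lap J u) = lap_seq J (coord u)" "norm (lap J u) \<le> 2 * (\<Sum>\<^sub>\<infinity>k. \<bar>J k\<bar>) * norm u"
    using eq bd by auto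
qed

lemma coord_lap:
  assumes "(\<lambda>k. \<bar>J k\<bar>) summable_on UNIV"
  shows "coord (lap J u) n = (\<Sum>\<^sub>\<infinity>m\<in>{m. m \<noteq> n}. of_real (J (n - m)) * (coord u n - coord u m))"
  by (simp add: lap_aux(1)[OF assms] lap_seq_def)

lemma linear_flow_sums:
  assumes "(\<lambda>k. \<bar>J k\<bar>) summable_on UNIV"
  shows "(\<lambda>k. ((- \<i> * of_real t) ^ k / fact k) *\<^sub>C (lap J ^^ k) u) sums linear_flow J t u"
proof -
  define C where "C = 2 * (\<Sum>\<^sub>\<infinity>k. \<bar>J k\<bar>)"
  have C: "0 \<le> C" by (simp add: C_def infsum_nonneg)
  have pow: "norm ((lap J ^^ k) u) \<le> C ^ k * norm u" for k
  proof (induction k)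
    case (Suc k)
    have "norm ((lap J ^^ Suc k) u) \<le> C * norm ((lap J ^^ k) u)"
      using lap_aux(2)[OF assms, of "(lap J ^^ k) u"] by (simp add: C_def)
    also have "\<dots> \<le> C * (C ^ k * norm u)"
      by (rule mult_left_mono[OF Suc C])
    finally show ?case by (simp add: mult_ac)
  qed simp
  have le: "norm (((- \<i> * of_real t) ^ k / fact k) *\<^sub>C (lap J ^^ k) u)
      \<le> (inverse (fact k) * (\<bar>t\<bar> * C) ^ k) * norm u" for k
  proof -
    have "norm (((- \<i> * of_real t) ^ k / fact k) *\<^sub>C (lap J ^^ k) u)
        = \<bar>t\<bar> ^ k / fact k * norm ((lap J ^^ k) u)"
      by (simp add: norm_scaleC norm_divide norm_power norm_mult)
    also have "\<dots> \<le> \<bar>t\<bar> ^ k / fact k * (C ^ k * norm u)"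
      by (rule mult_left_mono[OF pow]) simp
    finally show ?thesis by (simp add: power_mult_distrib field_simps)
  qed
  have "summable (\<lambda>k. (inverse (fact k) * (\<bar>t\<bar> * C) ^ k) * norm u)"
    by (intro summable_mult2 summable_exp)
  hence "summable (\<lambda>k. ((- \<i> * of_real t) ^ k / fact k) *\<^sub>C (lap J ^^ k) u)"
    by (rule summable_comparison_test'[where N = 0]) (rule le)
  thus ?thesis unfolding linear_flow_def by (rule summable_sums)
qed

section \<open>The focusing power nonlinearity and the nonlinear equation\<close>

(* coord_nonlin below: the family is square summable for all exponents p >= 1.  Real powers satisfy
   0 powr a = 0, and the second factor vanishes at zeros of u in any case. *)
definition nonlin :: "real \<Rightarrow> 'a ell2 \<Rightarrow> 'a ell2" where
  "nonlin p u = Abs_ell2 (\<lambda>x. of_real (cmod (coord u x) powr (p - 1)) * coord u x)"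

lemma coord_nonlin:
  assumes "p \<ge> 1"
  shows "coord (nonlin p u) x = of_real (cmod (coord u x) powr (p - 1)) * coord u x"
proof -
  let ?f = "\<lambda>x. of_real (cmod (coord u x) powr (p - 1)) * coord u x"
  have "square_summable ?f"
  proof (rule square_summableI(1))
    fix F :: "'a set" assume F: "finite F"
    let ?c = "norm u powr (p - 1)"
    have "L2_set (\<lambda>x. cmod (?f x)) F \<le> L2_set (\<lambda>x. ?c * cmod (coord u x)) F"
      by (intro L2_set_mono)
        (auto simp: norm_mult intro!: mult_right_mono powr_mono2 cmod_coord_le assms)
    also have "\<dots> = ?c * L2_set (\<lambda>x. cmod (coord u x)) F"
      by (simp add: L2_set_right_distrib)
    also have "\<dots> \<le> ?c * norm u"
      by (intro mult_left_mono L2_set_coord_le F) simp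
    finally show "L2_set (\<lambda>x. cmod (?f x)) F \<le> ?c * norm u" .
  qed
  thus ?thesis by (simp add: nonlin_def Abs_ell2_inverse)
qed

definition nls_solution :: "(int \<Rightarrow> real) \<Rightarrow> real \<Rightarrow> int ell2 \<Rightarrow> (real \<Rightarrow> int ell2) \<Rightarrow> bool" where
  "nls_solution J p \<phi> u \<longleftrightarrow> u 0 = \<phi> \<and>
    (\<forall>t. \<exists>u'. (u has_vector_derivative u') (at t) \<and> \<i> *\<^sub>C u' = lap J (u t) - nonlin p (u t))"

end

theory Submission
  imports Defs
begin

text \<open>
  The dispersion relation of \<open>L\<close> is \<open>\<omega>(x) = 2 \<Sum>\<^sub>n n\<^sup>-\<^sup>1\<^sup>-\<^sup>\<alpha> (1 - cos nx)\<close>. For \<open>\<alpha> \<le> 1\<close> it is uniformly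
  concave on \<open>[0, 2\<pi>]\<close>; for \<open>\<alpha> > 1\<close> its derivative is uniformly concave on compact subintervals
  of \<open>(0, \<pi>)\<close>. Van der Corput's lemma then gives \<open>\<parallel>U(t)\<parallel>\<^bsub>\<ell>\<^sup>1\<rightarrow>\<ell>\<^sup>\<infinity>\<^esub> \<lesssim> \<bar>t\<bar>\<^sup>-\<^sup>\<sigma>\<close> with \<open>\<sigma> = 1/2\<close> and
  \<open>\<sigma> = 1/3\<close> respectively.

  With \<open>q = 2/\<sigma> \<in> {4, 6}\<close> and \<open>p - 1 \<ge> q\<close>, the Strichartz norm \<open>L\<^sup>q\<^sub>t \<ell>\<^sup>\<infinity>\<close> suffices, because
  \<open>\<parallel>|u|\<^sup>p\<^sup>-\<^sup>1 v\<parallel> \<le> \<parallel>u\<parallel>\<^sub>\<infinity>\<^sup>q \<parallel>v\<parallel>\<close> for \<open>\<parallel>u\<parallel> \<le> 1\<close>. Its dual form only involves point masses, so no interpolation is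
  needed. The profile \<open>U(-t) u(t)\<close> has derivative of norm \<open>\<parallel>|u|\<^sup>p\<^sup>-\<^sup>1 u\<parallel>\<close>, hence finite variation for small
  data, and converges. The map \<open>\<phi> \<mapsto> u\<^sub>\<plusminus>\<close> preserves the norm and differs from the identity
  by a map with Lipschitz constant \<open>1/2\<close>, so it is a homeomorphism of small balls.
\<close>

section \<open>Oscillatory integrals\<close>

text \<open>The symbol may lack a second derivative at multiples of 2 pi, so the phase hypotheses
  are inequalities between differences of the first derivative. The weights n^(-1-\<alpha>) are
  split into positive combinations of sequences whose trigonometric series have explicit signed
  derivatives: min(n, m)/n^2, leading to Fejer kernels, for \<alpha> \<le> 1, and r^n/n, leading to
  Poisson kernels, for \<alpha> > 1. The Strichartz estimate samples time at k + \<tau> with integer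
  k and averages over \<tau> in [0, 1] afterwards. Distinct samples are at least one apart, so the
  singularity of the kernel at equal times disappears and a discrete Hardy--Littlewood--Sobolev
  inequality suffices. No retarded inhomogeneous estimate appears. The nonlinear solution is read as
  the linear flow applied to slowly varying data, and summation by parts lets the total variation of
  these data take the place of the norm of a fixed datum. A sign s with |s| = 1 treats both time
  directions at once.\<close>

text \<open>Since cos(h) is 1/F times the derivative of sin(h), only the two boundary values of 1/F
  survive, each at most 1/l, multiplied by differences of sines, each at most 2. Hence 4/l, whatever
  the length of the interval.\<close>

lemma van_der_corput_first_cos:
  fixes h F :: "real \<Rightarrow> real"
  assumes "a \<le> b" "0 < l"
    and h: "\<And>x. x \<in> {a..b} \<Longrightarrow> (h has_real_derivative F x) (at x within {a..b})"
    and mono: "mono_on {a..b} F"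
    and F: "(\<forall>x\<in>{a..b}. l \<le> F x) \<or> (\<forall>x\<in>{a..b}. F x \<le> - l)"
  shows "\<bar>integral {a..b} (\<lambda>x. cos (h x))\<bar> \<le> 4 / l"
proof -
  let ?f = "\<lambda>x. F x * cos (h x)"
  have int: "(?f has_integral (sin (h v) - sin (h u))) {u..v}" if "a \<le> u" "u \<le> v" "v \<le> b" for u v
  proof (rule fundamental_theorem_of_calculus[OF \<open>u \<le> v\<close>])
    fix x assume x: "x \<in> {u..v}"
    with that have "(h has_real_derivative F x) (at x within {u..v})"
      by (intro DERIV_subset[OF h]) auto
    thus "((\<lambda>x. sin (h x)) has_vector_derivative ?f x) (at x within {u..v})"
      by (auto intro!: derivative_eq_intros simp flip: has_real_derivative_iff_has_vector_derivative)
  qed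
  have ne: "F x \<noteq> 0" if "x \<in> {a..b}" for x
    using F \<open>0 < l\<close> that by force
  \<comment> \<open>The sign makes \<open>g\<close> increasing, because \<open>F\<close> keeps one
    sign and 1/F therefore decreases. Monotonicity is all that the second mean value theorem asks of
    \<open>g\<close>.\<close>
  define g where "g = (\<lambda>x. - 1 / F x)"
  have "g x \<le> g y" if "a \<le> x" "x \<le> y" "y \<le> b" for x y
  proof -
    have "F x \<le> F y" using mono_onD[OF mono] that by auto
    moreover have "0 < F x * F y"
      using F \<open>0 < l\<close> that by (smt (verit) atLeastAtMost_iff mult_pos_pos mult_neg_neg)
    ultimately show ?thesis
      unfolding g_def by (simp add: divide_simps zero_less_mult_iff) (smt (verit))
  qed
  then obtain c where c: "c \<in> {a..b}"
    and eq: "integral {a..b} (\<lambda>x. g x * ?f x) = g a * integral {a..c} ?f + g b * integral {c..b} ?f"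
    by (rule second_mean_value_theorem[where g = g,
        OF has_integral_integrable[OF int[OF order_refl \<open>a \<le> b\<close> order_refl]] \<open>a \<le> b\<close>])
  have "integral {a..b} (\<lambda>x. g x * ?f x) = integral {a..b} (\<lambda>x. - cos (h x))"
    by (rule integral_cong) (simp add: g_def ne)
  hence "integral {a..b} (\<lambda>x. cos (h x))
      = - (g a * (sin (h c) - sin (h a)) + g b * (sin (h b) - sin (h c)))"
    using eq c int[of a c] int[of c b] by (simp add: integral_unique)
  also have "\<bar>\<dots>\<bar> \<le> \<bar>g a\<bar> * \<bar>sin (h c) - sin (h a)\<bar> + \<bar>g b\<bar> * \<bar>sin (h b) - sin (h c)\<bar>"
    unfolding abs_mult[symmetric] by linarith
  also have "\<dots> \<le> 1 / l * 2 + 1 / l * 2"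
  proof -
    have "\<bar>g x\<bar> \<le> 1 / l" if "x \<in> {a..b}" for x
    proof -
      have "l \<le> \<bar>F x\<bar>" using F that by fastforce
      thus ?thesis using \<open>0 < l\<close> by (simp add: g_def frac_le)
    qed
    moreover have "\<bar>sin x - sin y\<bar> \<le> 2" for x y :: real
      using sin_le_one[of x] sin_ge_minus_one[of x] sin_le_one[of y] sin_ge_minus_one[of y] by linarith
    ultimately show ?thesis using \<open>a \<le> b\<close> \<open>0 < l\<close> by (intro add_mono mult_mono) auto
  qed
  finally show ?thesis by simp
qed

text \<open>The imaginary part is the cosine of the phase shifted by pi/2, which has the same
  derivative; the two real bounds add up to 8/l.\<close>

lemma van_der_corput_first:
  fixes h F :: "real \<Rightarrow> real"
  assumes "a \<le> b" "0 < l"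
    and h: "\<And>x. x \<in> {a..b} \<Longrightarrow> (h has_real_derivative F x) (at x within {a..b})"
    and mono: "mono_on {a..b} F"
    and F: "(\<forall>x\<in>{a..b}. l \<le> F x) \<or> (\<forall>x\<in>{a..b}. F x \<le> - l)"
  shows "cmod (integral {a..b} (\<lambda>x. cis (h x))) \<le> 8 / l"
proof -
  have cont: "continuous_on {a..b} h"
    using h by (meson DERIV_continuous_on)
  have int: "(\<lambda>x. cis (h x)) integrable_on {a..b}"
    by (intro integrable_continuous_interval continuous_on_cis cont)
  have Re: "Re (integral {a..b} (\<lambda>x. cis (h x))) = integral {a..b} (\<lambda>x. cos (h x))"
    using integral_linear[OF int bounded_linear_Re] by (simp add: o_def)
  have Im: "Im (integral {a..b} (\<lambda>x. cis (h x))) = integral {a..b} (\<lambda>x. cos (h x + - pi / 2))"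
    using integral_linear[OF int bounded_linear_Im] by (simp add: o_def cos_add cos_diff)
  have "\<bar>integral {a..b} (\<lambda>x. cos (h x + - pi / 2))\<bar> \<le> 4 / l"
    by (rule van_der_corput_first_cos[OF assms(1,2) _ mono F])
      (auto intro!: derivative_eq_intros h)
  moreover have "\<bar>integral {a..b} (\<lambda>x. cos (h x))\<bar> \<le> 4 / l"
    by (rule van_der_corput_first_cos[OF assms])
  ultimately show ?thesis
    using cmod_le[of "integral {a..b} (\<lambda>x. cis (h x))"] Re Im by linarith
qed

lemma cmod_integral_cis_le:
  assumes "a \<le> b"
  shows "cmod (integral {a..b} (\<lambda>x. cis (h x))) \<le> b - a"
proof (cases "(\<lambda>x. cis (h x)) integrable_on {a..b}")
  case True
  have "cmod (integral {a..b} (\<lambda>x. cis (h x))) \<le> integral {a..b} (\<lambda>x. 1 :: real)"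
    by (rule integral_norm_bound_integral[OF True]) auto
  thus ?thesis using assms by simp
qed (use assms in \<open>simp add: not_integrable_integral\<close>)

text \<open>Away from the point where the increasing function \<open>F\<close> changes sign, the gap condition makes
  \<open>\<bar>F\<bar> \<ge> l\<close>.\<close>
lemma van_der_corput_gap:
  fixes h F :: "real \<Rightarrow> real"
  assumes "a \<le> b" "0 < l" "0 < d"
    and h: "\<And>x. x \<in> {a..b} \<Longrightarrow> (h has_real_derivative F x) (at x within {a..b})"
    and mono: "mono_on {a..b} F"
    and gap: "\<And>u v. a \<le> u \<Longrightarrow> v \<le> b \<Longrightarrow> d \<le> v - u \<Longrightarrow> l \<le> F v - F u"
  shows "cmod (integral {a..b} (\<lambda>x. cis (h x))) \<le> 4 * d + 16 / l"
proof -
  have cont: "continuous_on {a..b} h"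
    using h by (meson DERIV_continuous_on)
  \<comment> \<open>The point of sign change is taken as a supremum, so the argument works without
    continuity of \<open>F\<close>; it is \<open>a\<close> if \<open>F\<close> is positive
    throughout.\<close>
  have "\<exists>z\<in>{a..b}. (\<forall>x\<in>{a..b}. z < x \<longrightarrow> 0 < F x) \<and> (\<forall>x\<in>{a..b}. x < z \<longrightarrow> F x \<le> 0)"
  proof (cases "{u\<in>{a..b}. F u \<le> 0} = {}")
    case True
    hence "0 < F x" if "x \<in> {a..b}" for x using that by (auto simp: not_le[symmetric])
    thus ?thesis using \<open>a \<le> b\<close> by (intro bexI[of _ a]) auto
  next
    case False
    let ?A = "{u\<in>{a..b}. F u \<le> 0}"
    have bdd: "bdd_above ?A" by (auto intro!: bdd_aboveI[of _ b])
    obtain u where u: "u \<in> ?A" using False by blast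
    have "a \<le> Sup ?A" using cSup_upper[OF u bdd] u by simp
    moreover have "Sup ?A \<le> b" using False by (intro cSup_least) auto
    ultimately have "Sup ?A \<in> {a..b}" by simp
    moreover have "0 < F x" if "x \<in> {a..b}" "Sup ?A < x" for x
      using cSup_upper[OF _ bdd, of x] that by (force simp: not_le[symmetric])
    moreover have "F x \<le> 0" if x: "x \<in> {a..b}" "x < Sup ?A" for x
    proof -
      obtain u where "u \<in> ?A" "x < u" using less_cSupD[OF False x(2)] by blast
      thus ?thesis using mono_onD[OF mono, of x u] x by auto
    qed
    ultimately show ?thesis by blast
  qed
  then obtain z where z: "z \<in> {a..b}" and pos: "\<And>x. x \<in> {a..b} \<Longrightarrow> z < x \<Longrightarrow> 0 < F x"
    and neg: "\<And>x. x \<in> {a..b} \<Longrightarrow> x < z \<Longrightarrow> F x \<le> 0" by blast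
  \<comment> \<open>Outside radius 2d one step of length d reaches a point of known sign and a
    second one gains \<open>l\<close> by the gap condition. The window of length at most 4d is
    bounded by its length, each outer piece by 8/l.\<close>
  define x1 where "x1 = max a (z - 2 * d)"
  define x2 where "x2 = min b (z + 2 * d)"
  have o: "a \<le> x1" "x1 \<le> x2" "x2 \<le> b" using z \<open>0 < d\<close> by (auto simp: x1_def x2_def)
  let ?I = "\<lambda>u v. integral {u..v} (\<lambda>x. cis (h x))"
  have 1: "cmod (?I a x1) \<le> 8 / l"
  proof (cases "x1 = a")
    case False
    hence x1: "x1 = z - 2 * d" "a < z - 2 * d" by (auto simp: x1_def max_def split: if_splits)
    have "F x \<le> - l" if "x \<in> {a..x1}" for x
      using gap[of x "z - d"] neg[of "z - d"] that x1 z \<open>0 < d\<close> by auto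
    thus ?thesis using o
      by (intro van_der_corput_first[where F = F] \<open>0 < l\<close> mono_on_subset[OF mono])
        (auto intro!: DERIV_subset[OF h])
  qed (use \<open>0 < l\<close> in simp)
  have 2: "cmod (?I x2 b) \<le> 8 / l"
  proof (cases "x2 = b")
    case False
    hence x2: "x2 = z + 2 * d" "z + 2 * d < b" by (auto simp: x2_def min_def split: if_splits)
    have "l \<le> F x" if "x \<in> {x2..b}" for x
      using gap[of "z + d" x] pos[of "z + d"] that x2 z \<open>0 < d\<close> by auto
    thus ?thesis using o
      by (intro van_der_corput_first[where F = F] \<open>0 < l\<close> mono_on_subset[OF mono])
        (auto intro!: DERIV_subset[OF h])
  qed (use \<open>0 < l\<close> in simp)
  have 3: "cmod (?I x1 x2) \<le> 4 * d"
    using cmod_integral_cis_le[OF o(2), of h] by (simp add: x1_def x2_def)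
  have int: "(\<lambda>x. cis (h x)) integrable_on {u..v}" if "a \<le> u" "v \<le> b" for u v
    by (intro integrable_continuous_interval continuous_on_cis continuous_on_subset[OF cont]) (use that in auto)
  have "?I a b = ?I a x1 + ?I x1 x2 + ?I x2 b"
    using o by (simp add: Henstock_Kurzweil_Integration.integral_combine[OF _ _ int])
  thus ?thesis
    using norm_triangle_ineq[of "?I a x1 + ?I x1 x2" "?I x2 b"] norm_triangle_ineq[of "?I a x1" "?I x1 x2"] 1 2 3
    by simp
qed

section \<open>A discrete Hardy--Littlewood--Sobolev inequality\<close>

text \<open>A binary-tree model of the energy with kernel |j - k|^(-g): each dyadic block I of the
  first 2^M indices contributes |I|^(-g) times the square of its sum. Recursion on halves suits the
  induction; \<open>dyadic_energy_levels\<close> regroups by scale.\<close>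

fun dyadic_energy :: "real \<Rightarrow> nat \<Rightarrow> (nat \<Rightarrow> real) \<Rightarrow> real" where
  "dyadic_energy g 0 c = (c 0)\<^sup>2"
| "dyadic_energy g (Suc M) c = 2 powr (- g * Suc M) * (\<Sum>j<2 ^ Suc M. c j)\<^sup>2
     + dyadic_energy g M c + dyadic_energy g M (\<lambda>j. c (j + 2 ^ M))"

lemma sum_lessThan_add:
  fixes f :: "nat \<Rightarrow> 'a::comm_monoid_add"
  shows "sum f {..<m + n} = sum f {..<m} + (\<Sum>j<n. f (j + m))"
  by (induction n) (simp_all add: add_ac)

lemma powr_mean_le:
  fixes a b q :: real
  assumes "0 \<le> a" "0 \<le> b" "1 \<le> q"
  shows "((a + b) / 2) powr q \<le> (a powr q + b powr q) / 2"
proof -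
  have half: "(x / 2) powr q \<le> x powr q / 2" if "0 \<le> x" for x
  proof -
    have "(2::real) powr 1 \<le> 2 powr q" using assms by (intro powr_mono) auto
    hence "x powr q / 2 powr q \<le> x powr q / 2" by (intro divide_left_mono) auto
    thus ?thesis using that by (simp add: powr_divide)
  qed
  consider "a = 0" | "b = 0" | "0 < a" "0 < b" using assms by linarith
  thus ?thesis
  proof cases
    case 3
    thus ?thesis
      using convex_onD[OF powr_convex[OF assms(3)], of "1/2" a b] by (simp add: add_divide_distrib)
  qed (use half assms in auto)
qed

lemma powr_mean_ge:
  fixes a b q :: real
  assumes "0 \<le> a" "0 \<le> b" "0 < q" "q \<le> 1"
  shows "(a powr q + b powr q) / 2 \<le> ((a + b) / 2) powr q"
proof -
  have "((a powr q + b powr q) / 2) powr (1 / q) \<le> ((a powr q) powr (1 / q) + (b powr q) powr (1 / q)) / 2"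
    by (rule powr_mean_le) (use assms in auto)
  also have "\<dots> = (a + b) / 2" using assms by (simp add: powr_powr)
  finally have "(((a powr q + b powr q) / 2) powr (1 / q)) powr q \<le> ((a + b) / 2) powr q"
    using assms by (intro powr_mono2) auto
  thus ?thesis using assms by (simp add: powr_powr)
qed

text \<open>Both x and 2y are convex combinations of y and x + y, with complementary weights. Adding
  the two convexity inequalities gives x^s + (2y)^s \<le> y^s + (x + y)^s.\<close>

lemma powr_add_ge:
  fixes x y s :: real
  assumes "0 \<le> y" "y \<le> x" "1 \<le> s"
  shows "x powr s + (2 powr s - 1) * y powr s \<le> (x + y) powr s"
proof (cases "y = 0")
  case False
  hence p: "0 < y" "0 < x" using assms by auto
  let ?f = "\<lambda>x. x powr s"
  have t: "(x - y) / x = 1 - y / x" using p by (simp add: field_simps)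
  have "?f ((1 - (1 - y / x)) *\<^sub>R y + (1 - y / x) *\<^sub>R (x + y))
      \<le> (1 - (1 - y / x)) * ?f y + (1 - y / x) * ?f (x + y)"
    by (rule convex_onD[OF powr_convex[OF assms(3)]]) (use p assms in auto)
  moreover have "(1 - (1 - y / x)) *\<^sub>R y + (1 - y / x) *\<^sub>R (x + y) = x"
    using p by (simp add: field_simps)
  moreover have "?f ((1 - y / x) *\<^sub>R y + (y / x) *\<^sub>R (x + y)) \<le> (1 - y / x) * ?f y + (y / x) * ?f (x + y)"
    by (rule convex_onD[OF powr_convex[OF assms(3)]]) (use p assms in auto)
  moreover have "(1 - y / x) *\<^sub>R y + (y / x) *\<^sub>R (x + y) = 2 * y"
    using p by (simp add: field_simps)
  moreover have "(1 - (1 - t)) * ?f y + (1 - t) * ?f (x + y) + ((1 - t) * ?f y + t * ?f (x + y)) = ?f y + ?f (x + y)"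
    for t by (simp add: algebra_simps)
  ultimately have "?f x + ?f (2 * y) \<le> ?f y + ?f (x + y)"
    by (smt (verit))
  thus ?thesis using p by (simp add: powr_mult algebra_simps)
qed simp

text \<open>\<open>y1\<close>, \<open>y2\<close> stand for the normalized sums of two halves of a
  block and \<open>X1\<close>, \<open>X2\<close> for their masses. \<open>D\<close> solves (D + 1)
  \<kappa> = D - 1 = P, which turns the quadratic part into P^2 y2^2 - (y1 - P y2)^2 - y2^2, so only
  the half with smaller mass has to be paid for. \<open>powr_add_ge\<close> provides (2^(2-g) - 2)
  X2^(2-g) for this, whence the first entry of \<open>C\<close>; the entry 1 + D serves the base
  case of the later induction.\<close>

lemma dyadic_energy_step:
  fixes y1 y2 X1 X2 g :: real
  defines "\<kappa> \<equiv> 2 powr (- g)"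
  defines "D \<equiv> (1 + \<kappa>) / (1 - \<kappa>)" and "P \<equiv> 2 * \<kappa> / (1 - \<kappa>)"
  defines "C \<equiv> max (P\<^sup>2 / (2 powr (2 - g) - 2)) (1 + D)"
  assumes g: "0 < g" "g < 1"
    and y: "0 \<le> y1" "0 \<le> y2" and X: "0 \<le> X1" "0 \<le> X2"
    and b: "y1\<^sup>2 \<le> X1 powr (2 - g)" "y2\<^sup>2 \<le> X2 powr (2 - g)"
  shows "(D + 1) * (\<kappa> * (y1 + y2)\<^sup>2) - D * (y1\<^sup>2 + y2\<^sup>2) + C * (X1 powr (2 - g) + X2 powr (2 - g))
    \<le> C * (X1 + X2) powr (2 - g)"
  using y X b
proof (induction X2 X1 arbitrary: y1 y2 rule: linorder_wlog)
  case (le X2 X1)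
  have k: "0 < \<kappa>" "\<kappa> < 1" using g powr_less_mono[of "- g" 0 2] by (auto simp: \<kappa>_def)
  have D: "(D + 1) * \<kappa> = P" "D = P + 1" using k by (auto simp: D_def P_def field_simps)
  have "2 powr 1 < 2 powr (2 - g)" using g by (intro powr_less_mono) auto
  hence s: "0 < 2 powr (2 - g) - 2" by simp
  have "(D + 1) * (\<kappa> * (y1 + y2)\<^sup>2) - D * (y1\<^sup>2 + y2\<^sup>2) = P * (y1 + y2)\<^sup>2 - (P + 1) * (y1\<^sup>2 + y2\<^sup>2)"
    using D by (simp flip: mult.assoc)
  also have "\<dots> = P\<^sup>2 * y2\<^sup>2 - (y1 - P * y2)\<^sup>2 - y2\<^sup>2"
    by (simp add: power2_eq_square algebra_simps)
  also have "\<dots> \<le> P\<^sup>2 * y2\<^sup>2" by simp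
  also have "\<dots> \<le> P\<^sup>2 * X2 powr (2 - g)" using le by (intro mult_left_mono) auto
  also have "\<dots> = P\<^sup>2 / (2 powr (2 - g) - 2) * ((2 powr (2 - g) - 2) * X2 powr (2 - g))"
    using s by simp
  also have "\<dots> \<le> C * ((2 powr (2 - g) - 2) * X2 powr (2 - g))"
    using s by (intro mult_right_mono) (auto simp: C_def)
  also have "\<dots> \<le> C * ((X1 + X2) powr (2 - g) - X1 powr (2 - g) - X2 powr (2 - g))"
  proof (rule mult_left_mono)
    show "(2 powr (2 - g) - 2) * X2 powr (2 - g) \<le> (X1 + X2) powr (2 - g) - X1 powr (2 - g) - X2 powr (2 - g)"
      using powr_add_ge[of X2 X1 "2 - g"] le g by (simp add: algebra_simps)
    show "0 \<le> C" using k by (auto simp: C_def D_def le_max_iff_disj)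
  qed
  finally show ?case by (simp add: algebra_simps)
next
  case (sym X1 X2)
  show ?case using sym.IH[of y2 y1] sym.prems by (simp add: add.commute)
qed

text \<open>By induction, the energy of a dyadic interval \<open>I\<close> is at most \<open>C X\<^sup>2\<^sup>-\<^sup>g - D |I|\<^sup>-\<^sup>g (\<Sum>\<^sub>I c)\<^sup>2\<close>. If one half of \<open>I\<close>
  dominates, the negative term grows by more than the new energy term because \<open>2\<^sup>-\<^sup>g < 1\<close>; otherwise
  the strict superadditivity of \<open>X \<mapsto> X\<^sup>2\<^sup>-\<^sup>g\<close> pays for it.\<close>
lemma dyadic_energy_bound:
  assumes g: "0 < (g::real)" "g < 1"
  shows "\<exists>C\<ge>0. \<forall>M c. (\<forall>j. 0 \<le> c j) \<longrightarrow>
    dyadic_energy g M c \<le> C * (\<Sum>j<2 ^ M. c j powr (1 / (1 - g / 2))) powr (2 - g)"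
proof -
  define \<kappa> where "\<kappa> = 2 powr (- g)"
  define D where "D = (1 + \<kappa>) / (1 - \<kappa>)"
  define C where "C = max ((2 * \<kappa> / (1 - \<kappa>))\<^sup>2 / (2 powr (2 - g) - 2)) (1 + D)"
  define p where "p = 1 - g / 2"
  have p: "0 < p" "p < 1" using g by (auto simp: p_def)
  have k: "0 < \<kappa>" "\<kappa> < 1" using g powr_less_mono[of "- g" 0 2] by (auto simp: \<kappa>_def)
  have C: "1 + D \<le> C" "0 \<le> D" using k by (auto simp: C_def D_def)
  define X where "X = (\<lambda>M (c :: nat \<Rightarrow> real). \<Sum>j<2 ^ M. c j powr (1 / p) :: real)"
  define y where "y = (\<lambda>M (c :: nat \<Rightarrow> real). 2 powr (- g / 2 * real M) * (\<Sum>j<2 ^ M. c j) :: real)"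
  have split: "sum f {..<2 ^ Suc M} = sum f {..<2 ^ M} + (\<Sum>j<2 ^ M. f (j + 2 ^ M))"
    for f :: "nat \<Rightarrow> real" and M
    unfolding power_Suc mult_2 by (rule sum_lessThan_add)
  have sq: "2 powr (- g * Suc M) * (\<Sum>j<2 ^ Suc M. c j)\<^sup>2 = \<kappa> * (y M c + y M (\<lambda>j. c (j + 2 ^ M)))\<^sup>2"
    "(y (Suc M) c)\<^sup>2 = \<kappa> * (y M c + y M (\<lambda>j. c (j + 2 ^ M)))\<^sup>2"
    for M and c :: "nat \<Rightarrow> real"
  proof -
    have e: "\<kappa> * (2 powr (- g / 2 * real M))\<^sup>2 = 2 powr (- g * Suc M)"
      "(2 powr (- g / 2 * real (Suc M)))\<^sup>2 = 2 powr (- g * Suc M)"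
    proof -
      have "- g + (- g / 2 * real M + - g / 2 * real M) = - g * Suc M"
        "- g / 2 * real (Suc M) + - g / 2 * real (Suc M) = - g * Suc M" by (simp_all add: algebra_simps)
      thus "\<kappa> * (2 powr (- g / 2 * real M))\<^sup>2 = 2 powr (- g * Suc M)"
        "(2 powr (- g / 2 * real (Suc M)))\<^sup>2 = 2 powr (- g * Suc M)"
        unfolding \<kappa>_def power2_eq_square powr_add[symmetric] by simp_all
    qed
    show "2 powr (- g * Suc M) * (\<Sum>j<2 ^ Suc M. c j)\<^sup>2 = \<kappa> * (y M c + y M (\<lambda>j. c (j + 2 ^ M)))\<^sup>2"
      unfolding y_def split e(1)[symmetric] distrib_left[symmetric] power_mult_distrib by simp
    thus "(y (Suc M) c)\<^sup>2 = \<kappa> * (y M c + y M (\<lambda>j. c (j + 2 ^ M)))\<^sup>2"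
      unfolding y_def power_mult_distrib e(2) by simp
  qed
  \<comment> \<open>The first conjunct is Hoelder's inequality for a sum normalized by |I|^(-g/2):
    since 2 - g = 2p, the right side is the square of the l^(1/p) norm. Carried through the
    induction, it reduces to a power mean inequality for two numbers.\<close>
  have main: "(y M c)\<^sup>2 \<le> X M c powr (2 - g) \<and> 0 \<le> y M c \<and> 0 \<le> X M c \<and>
      dyadic_energy g M c \<le> C * X M c powr (2 - g) - D * (y M c)\<^sup>2" if "\<forall>j. 0 \<le> c j" for M c
    using that
  proof (induction M arbitrary: c)
    case 0
    have "1 / p * (2 - g) = 2" using g by (simp add: p_def field_simps)
    hence "X 0 c powr (2 - g) = (c 0)\<^sup>2"
      using 0 by (simp add: X_def powr_powr)
    moreover have "(1 + D) * (c 0)\<^sup>2 \<le> C * (c 0)\<^sup>2" by (intro mult_right_mono C) simp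
    ultimately show ?case using 0 by (simp add: y_def X_def algebra_simps)
  next
    case (Suc M)
    let ?c = "\<lambda>j. c (j + 2 ^ M)"
    have IH1: "(y M c)\<^sup>2 \<le> X M c powr (2 - g)" "0 \<le> y M c" "0 \<le> X M c"
      "dyadic_energy g M c \<le> C * X M c powr (2 - g) - D * (y M c)\<^sup>2"
      using Suc.IH[of c] Suc.prems by blast+
    have IH2: "(y M ?c)\<^sup>2 \<le> X M ?c powr (2 - g)" "0 \<le> y M ?c" "0 \<le> X M ?c"
      "dyadic_energy g M ?c \<le> C * X M ?c powr (2 - g) - D * (y M ?c)\<^sup>2"
      using Suc.IH[of ?c] Suc.prems by blast+
    have X: "X (Suc M) c = X M c + X M ?c" unfolding X_def by (rule split)
    have ypow: "y M d \<le> X M d powr p" if "(y M d)\<^sup>2 \<le> X M d powr (2 - g)" "0 \<le> y M d" "0 \<le> X M d" for d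
    proof -
      have "X M d powr (2 - g) = (X M d powr p)\<^sup>2"
        using p by (simp add: p_def power2_eq_square flip: powr_add)
      thus ?thesis using that by (metis power2_le_imp_le powr_ge_zero)
    qed
    have "X M c powr p + X M ?c powr p \<le> 2 powr (g / 2) * (X M c + X M ?c) powr p"
    proof -
      let ?a = "X M c powr p" and ?b = "X M ?c powr p"
      have "(?a + ?b) / 2 \<le> (X M c + X M ?c) powr p / 2 powr p"
        using powr_mean_ge[OF IH1(3) IH2(3), of p] p IH1 IH2 by (simp add: powr_divide)
      moreover have "z \<le> 2 * w" if "z / 2 \<le> w" for z w :: real using that by simp
      ultimately have "?a + ?b \<le> 2 * ((X M c + X M ?c) powr p / 2 powr p)" by blast
      also have "2 * ((X M c + X M ?c) powr p / 2 powr p) = 2 powr (g / 2) * (X M c + X M ?c) powr p"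
      proof -
        have "2 powr (g / 2) * 2 powr p = 2" by (simp add: p_def flip: powr_add)
        hence "2 * (z / 2 powr p) = (2 powr (g / 2) * 2 powr p) * (z / 2 powr p)" for z by simp
        thus ?thesis by simp
      qed
      finally show ?thesis .
    qed
    hence "y M c + y M ?c \<le> 2 powr (g / 2) * X (Suc M) c powr p"
      unfolding X by (rule order_trans[OF add_mono[OF ypow[OF IH1(1-3)] ypow[OF IH2(1-3)]]])
    hence "(y M c + y M ?c)\<^sup>2 \<le> (2 powr (g / 2) * X (Suc M) c powr p)\<^sup>2"
      using IH1 IH2 by (intro power_mono) auto
    hence "\<kappa> * (y M c + y M ?c)\<^sup>2 \<le> \<kappa> * (2 powr (g / 2) * X (Suc M) c powr p)\<^sup>2"
      using k by (intro mult_left_mono) auto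
    also have "\<dots> = X (Suc M) c powr (2 - g)"
      by (simp add: \<kappa>_def p_def power2_eq_square mult_ac flip: powr_add)
    finally have Y: "(y (Suc M) c)\<^sup>2 \<le> X (Suc M) c powr (2 - g)" unfolding sq(2) .
    have "dyadic_energy g (Suc M) c \<le> \<kappa> * (y M c + y M ?c)\<^sup>2 + (C * X M c powr (2 - g) - D * (y M c)\<^sup>2)
        + (C * X M ?c powr (2 - g) - D * (y M ?c)\<^sup>2)"
      unfolding dyadic_energy.simps sq(1) by (intro add_mono IH1 IH2 order_refl)
    also have "\<dots> = ((D + 1) * (\<kappa> * (y M c + y M ?c)\<^sup>2) - D * ((y M c)\<^sup>2 + (y M ?c)\<^sup>2)
        + C * (X M c powr (2 - g) + X M ?c powr (2 - g))) - D * (\<kappa> * (y M c + y M ?c)\<^sup>2)"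
      by (simp add: algebra_simps)
    also have "\<dots> \<le> C * (X M c + X M ?c) powr (2 - g) - D * (\<kappa> * (y M c + y M ?c)\<^sup>2)"
      using dyadic_energy_step[OF g IH1(2) IH2(2) IH1(3) IH2(3) IH1(1) IH2(1)]
      unfolding C_def D_def \<kappa>_def by simp
    finally have "dyadic_energy g (Suc M) c \<le> C * X (Suc M) c powr (2 - g) - D * (y (Suc M) c)\<^sup>2"
      unfolding sq(2) X .
    thus ?case using Y Suc.prems by (auto simp: y_def X_def intro!: sum_nonneg mult_nonneg_nonneg)
  qed
  show ?thesis
  proof (intro exI[of _ C] conjI allI impI)
    show "0 \<le> C" using C by linarith
    fix M and c :: "nat \<Rightarrow> real" assume "\<forall>j. 0 \<le> c j"
    from main[OF this, of M]
    show "dyadic_energy g M c \<le> C * (\<Sum>j<2 ^ M. c j powr (1 / (1 - g / 2))) powr (2 - g)"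
      using mult_nonneg_nonneg[OF C(2) zero_le_power2[of "y M c"]] unfolding X_def p_def by linarith
  qed
qed

lemma dyadic_energy_levels:
  "dyadic_energy g M c =
    (\<Sum>m\<le>M. 2 powr (- g * real m) * (\<Sum>i<2 ^ (M - m). (\<Sum>j\<in>{i * 2 ^ m..<i * 2 ^ m + 2 ^ m}. c j)\<^sup>2))"
proof (induction M arbitrary: c)
  case (Suc M)
  let ?L = "\<lambda>M c m. 2 powr (- g * real m) * (\<Sum>i<2 ^ (M - m). (\<Sum>j\<in>{i * 2 ^ m..<i * 2 ^ m + 2 ^ m}. c j)\<^sup>2)"
  have "?L (Suc M) c m = ?L M c m + ?L M (\<lambda>j. c (j + 2 ^ M)) m" if "m \<le> M" for m
  proof -
    have e: "(2::nat) ^ M = 2 ^ (M - m) * 2 ^ m" using that by (simp flip: power_add)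
    let ?h = "\<lambda>i. (\<Sum>j\<in>{i * 2 ^ m..<i * 2 ^ m + 2 ^ m}. c j)\<^sup>2"
    have "2 ^ (Suc M - m) = 2 ^ (M - m) + (2 ^ (M - m) :: nat)"
      using that by (simp add: Suc_diff_le)
    hence "sum ?h {..<2 ^ (Suc M - m)} = sum ?h {..<2 ^ (M - m)} + (\<Sum>i<2 ^ (M - m). ?h (i + 2 ^ (M - m)))"
      by (simp only: sum_lessThan_add)
    also have "(\<lambda>i. ?h (i + 2 ^ (M - m))) = (\<lambda>i. (\<Sum>j\<in>{i * 2 ^ m..<i * 2 ^ m + 2 ^ m}. c (j + 2 ^ M))\<^sup>2)"
      unfolding sum.shift_bounds_nat_ivl[symmetric] e by (simp only: add_mult_distrib add_ac)
    finally show ?thesis by (simp add: algebra_simps)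
  qed
  hence "(\<Sum>m\<le>Suc M. ?L (Suc M) c m) = (\<Sum>m\<le>M. ?L M c m + ?L M (\<lambda>j. c (j + 2 ^ M)) m) + ?L (Suc M) c (Suc M)"
    by simp
  thus ?case
    by (simp add: Suc.IH sum.distrib lessThan_atLeast0)
qed simp

text \<open>Grouping by cells of length 2^m gives a quadratic form in the cell sums with a
  tridiagonal matrix of zeros and ones. The inequality ab \<le> (a^2 + b^2)/2 and at most three ones
  per row produce the factor 3.\<close>

lemma adjacent_cells_sum_le:
  fixes c :: "nat \<Rightarrow> real"
  assumes "m \<le> M"
  shows "(\<Sum>j<(2::nat) ^ M. \<Sum>k<(2::nat) ^ M. if \<bar>int (j div 2 ^ m) - int (k div 2 ^ m)\<bar> \<le> 1 then c j * c k else 0)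
    \<le> 3 * (\<Sum>i<2 ^ (M - m). (\<Sum>j\<in>{i * 2 ^ m..<i * 2 ^ m + 2 ^ m}. c j)\<^sup>2)"
proof -
  define A where "A = (\<lambda>i::nat. \<Sum>j\<in>{i * 2 ^ m..<i * 2 ^ m + 2 ^ m}. c j)"
  let ?n = "2 ^ (M - m) :: nat"
  let ?R = "\<lambda>(i::nat) (i'::nat). \<bar>int i - int i'\<bar> \<le> 1"
  have e: "(2::nat) ^ M = ?n * 2 ^ m" using assms by (simp flip: power_add)
  have group: "(\<Sum>j<(2::nat) ^ M. c j * f (j div 2 ^ m)) = (\<Sum>i<?n. A i * f i)" for f :: "nat \<Rightarrow> real"
    unfolding e sum.nat_group[symmetric] A_def sum_distrib_right
  proof (intro sum.cong refl)
    fix i j :: nat assume "j \<in> {i * 2 ^ m..<i * 2 ^ m + 2 ^ m}"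
    hence "j div 2 ^ m = i" by (intro div_nat_eqI) (auto simp: mult.commute)
    thus "c j * f (j div 2 ^ m) = c j * f i" by simp
  qed
  have "(\<Sum>j<(2::nat) ^ M. \<Sum>k<(2::nat) ^ M. if ?R (j div 2 ^ m) (k div 2 ^ m) then c j * c k else 0)
      = (\<Sum>j<(2::nat) ^ M. c j * (\<Sum>k<(2::nat) ^ M. c k * of_bool (?R (j div 2 ^ m) (k div 2 ^ m))))"
    unfolding sum_distrib_left by (intro sum.cong refl) (simp add: of_bool_def del: of_nat_div zdiv_int)
  also have "\<dots> = (\<Sum>i<?n. A i * (\<Sum>i'<?n. A i' * of_bool (?R i i')))"
    unfolding group[of "\<lambda>k. of_bool (?R i k)" for i]
    by (rule group[of "\<lambda>i. \<Sum>i'<?n. A i' * of_bool (?R i i')"])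
  also have "\<dots> = (\<Sum>i<?n. \<Sum>i'<?n. A i * A i' * of_bool (?R i i'))"
    by (simp only: sum_distrib_left mult.assoc)
  also have "\<dots> \<le> (\<Sum>i<?n. \<Sum>i'<?n. ((A i)\<^sup>2 / 2 + (A i')\<^sup>2 / 2) * of_bool (?R i i'))"
  proof (intro sum_mono mult_right_mono)
    show "A i * A i' \<le> (A i)\<^sup>2 / 2 + (A i')\<^sup>2 / 2" for i i'
      using sum_squares_bound[of "A i" "A i'"] by simp
  qed simp
  also have "\<dots> = (\<Sum>i<?n. \<Sum>i'<?n. (A i)\<^sup>2 / 2 * of_bool (?R i i')) + (\<Sum>i<?n. \<Sum>i'<?n. (A i')\<^sup>2 / 2 * of_bool (?R i i'))"
    by (simp add: distrib_right sum.distrib)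
  also have "(\<Sum>i<?n. \<Sum>i'<?n. (A i')\<^sup>2 / 2 * of_bool (?R i i')) = (\<Sum>i<?n. \<Sum>i'<?n. (A i)\<^sup>2 / 2 * of_bool (?R i i'))"
    by (subst sum.swap) (simp add: abs_minus_commute)
  also have "(\<Sum>i<?n. \<Sum>i'<?n. (A i)\<^sup>2 / 2 * of_bool (?R i i')) \<le> (\<Sum>i<?n. (A i)\<^sup>2 / 2 * 3)"
  proof (rule sum_mono)
    fix i
    have "(\<Sum>i'<?n. of_bool (?R i i') :: real) = card {i'. i' < ?n \<and> ?R i i'}"
      by (simp add: sum.If_cases of_bool_def Int_def)
    also have "card {i'. i' < ?n \<and> ?R i i'} \<le> card {i - 1, i, i + 1}"
      by (rule card_mono) auto
    also have "card {i - 1, i, i + 1} \<le> 3" using card_insert_le_m1[of 3] by (simp add: card_insert_if)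
    finally have "(\<Sum>i'<?n. of_bool (?R i i') :: real) \<le> 3" by simp
    thus "(\<Sum>i'<?n. (A i)\<^sup>2 / 2 * of_bool (?R i i')) \<le> (A i)\<^sup>2 / 2 * 3"
      unfolding sum_distrib_left[symmetric] by (intro mult_left_mono) auto
  qed
  finally show ?thesis unfolding A_def by (simp add: sum_distrib_left sum_divide_distrib[symmetric] sum_distrib_right[symmetric])
qed

text \<open>One scale controls the kernel at distance x: the least power 2^m \<ge> x is at most 2x,
  and indices at distance at most 2^m lie in equal or adjacent cells. Replacing x by 2x costs a
  factor 2 and adjacency a factor 3, so the dyadic bound is multiplied by 6.\<close>

lemma hardy_littlewood_sobolev_nat:
  assumes g: "0 < (g::real)" "g < 1"
  shows "\<exists>C\<ge>0. \<forall>N c. (\<forall>j. 0 \<le> c j) \<longrightarrow>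
    (\<Sum>j<N. \<Sum>k<N. c j * c k * (max 1 \<bar>real j - real k\<bar>) powr (- g))
      \<le> C * (\<Sum>j<N. c j powr (1 / (1 - g / 2))) powr (2 - g)"
proof -
  obtain C0 where C0: "0 \<le> C0" "\<And>M c. (\<forall>j. 0 \<le> c j) \<Longrightarrow>
      dyadic_energy g M c \<le> C0 * (\<Sum>j<2 ^ M. c j powr (1 / (1 - g / 2))) powr (2 - g)"
    using dyadic_energy_bound[OF g] by blast
  have "(\<Sum>j<N. \<Sum>k<N. c j * c k * (max 1 \<bar>real j - real k\<bar>) powr (- g))
      \<le> 6 * C0 * (\<Sum>j<N. c j powr (1 / (1 - g / 2))) powr (2 - g)" if c: "\<forall>j. 0 \<le> c j" for N c
  proof -
    \<comment> \<open>A crude choice: N \<le> 2^N, and \<open>d\<close> pads \<open>c\<close> by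
      zeros to a full dyadic length.\<close>
    define M where "M = N"
    have N: "N \<le> 2 ^ M" unfolding M_def by (simp add: less_imp_le)
    define d where "d = (\<lambda>j. if j < N then c j else 0)"
    have d: "\<forall>j. 0 \<le> d j" using c by (simp add: d_def)
    let ?adj = "\<lambda>m (j::nat) (k::nat). \<bar>int (j div 2 ^ m) - int (k div 2 ^ m)\<bar> \<le> 1"
    have kernel: "(max 1 \<bar>real j - real k\<bar>) powr (- g) \<le> 2 * (\<Sum>m\<le>M. 2 powr (- g * real m) * of_bool (?adj m j k))"
      if jk: "j < N" "k < N" for j k
    proof -
      define x where "x = max 1 (nat \<bar>int j - int k\<bar>)"
      have rx: "max 1 \<bar>real j - real k\<bar> = real x" by (simp add: x_def of_nat_max)
      define m where "m = (LEAST m. x \<le> 2 ^ m)"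
      have xM: "x \<le> 2 ^ M" 
      proof -
        have "nat \<bar>int j - int k\<bar> \<le> N" using jk by linarith
        hence "nat \<bar>int j - int k\<bar> \<le> 2 ^ M" using N by linarith
        thus ?thesis unfolding x_def max.bounded_iff by simp
      qed
      have xm: "x \<le> 2 ^ m" unfolding m_def using xM by (rule LeastI)
      have mM: "m \<le> M" unfolding m_def using xM by (rule Least_le)
      have lt: "2 ^ m \<le> 2 * x"
      proof (cases m)
        case (Suc m')
        hence "\<not> x \<le> 2 ^ m'" using not_less_Least[of m' "\<lambda>m. x \<le> 2 ^ m"] by (simp add: m_def)
        thus ?thesis using Suc by simp
      qed (simp add: x_def)
      have adj: "?adj m j k"
      proof -
        have *: "j div 2 ^ m \<le> k div 2 ^ m + 1" if "j \<le> k + 2 ^ m" for j k :: nat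
          using div_le_mono[OF that, of "2 ^ m"] by simp
        have "nat \<bar>int j - int k\<bar> \<le> x" unfolding x_def by simp
        hence "\<bar>int j - int k\<bar> \<le> int (2 ^ m)" using xm by linarith
        hence "j \<le> k + 2 ^ m" "k \<le> j + 2 ^ m" by linarith+
        from *[OF this(1)] *[OF this(2)] show ?thesis by linarith
      qed
      have "real x powr (- g) = 2 powr g * (2 * real x) powr (- g)"
        by (simp add: powr_mult flip: powr_add mult.assoc) 
      also have "\<dots> \<le> 2 * (2 ^ m) powr (- g)"
      proof (intro mult_mono)
        show "2 powr g \<le> 2" using powr_mono[of g 1 2] g by simp
        show "(2 * real x) powr (- g) \<le> (2 ^ m) powr (- g)"
          using g lt by (intro powr_mono2') (auto simp flip: of_nat_le_iff[where 'a = real])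
      qed auto
      also have "(2 ^ m) powr (- g) = (2 powr (- g * real m) :: real)"
        by (simp add: powr_powr mult.commute flip: powr_realpow)
      also have "2 powr (- g * real m) = 2 powr (- g * real m) * of_bool (?adj m j k)" using adj by simp
      also have "\<dots> \<le> (\<Sum>m\<le>M. 2 powr (- g * real m) * of_bool (?adj m j k))"
        using mM by (intro member_le_sum) auto
      finally show ?thesis unfolding rx by simp
    qed
    have "(\<Sum>j<N. \<Sum>k<N. c j * c k * (max 1 \<bar>real j - real k\<bar>) powr (- g))
        \<le> (\<Sum>j<N. \<Sum>k<N. c j * c k * (2 * (\<Sum>m\<le>M. 2 powr (- g * real m) * of_bool (?adj m j k))))"
      using c by (intro sum_mono mult_left_mono kernel) auto
    also have "\<dots> = (\<Sum>j<N. \<Sum>k<N. d j * d k * (2 * (\<Sum>m\<le>M. 2 powr (- g * real m) * of_bool (?adj m j k))))"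
      by (simp add: d_def)
    also have "\<dots> \<le> (\<Sum>j<2 ^ M. \<Sum>k<2 ^ M. d j * d k * (2 * (\<Sum>m\<le>M. 2 powr (- g * real m) * of_bool (?adj m j k))))"
    proof -
      have "(\<Sum>k<N. f k) \<le> (\<Sum>k<2 ^ M. f k)" if "\<And>k. 0 \<le> f k" for f :: "nat \<Rightarrow> real"
        using N that by (intro sum_mono2) auto
      note ext = this
      have nn: "0 \<le> d j * d k * (2 * (\<Sum>m\<le>M. 2 powr (- g * real m) * of_bool (?adj m j k)))" for j k
        using d by (intro mult_nonneg_nonneg sum_nonneg) auto
      show ?thesis
        by (rule order_trans[OF sum_mono[OF ext[OF nn]] ext[OF sum_nonneg[OF nn]]])
    qed
    also have "\<dots> = (\<Sum>j<2 ^ M. \<Sum>k<2 ^ M. \<Sum>m\<le>M. 2 * 2 powr (- g * real m) * (if ?adj m j k then d j * d k else 0))"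
      unfolding sum_distrib_left by (intro sum.cong refl) (simp add: of_bool_def del: of_nat_div zdiv_int)
    also have "\<dots> = (\<Sum>j<2 ^ M. \<Sum>m\<le>M. \<Sum>k<2 ^ M. 2 * 2 powr (- g * real m) * (if ?adj m j k then d j * d k else 0))"
      by (intro sum.cong refl sum.swap)
    also have "\<dots> = (\<Sum>m\<le>M. \<Sum>j<2 ^ M. \<Sum>k<2 ^ M. 2 * 2 powr (- g * real m) * (if ?adj m j k then d j * d k else 0))"
      by (rule sum.swap)
    also have "\<dots> = (\<Sum>m\<le>M. 2 * 2 powr (- g * real m) * (\<Sum>j<2 ^ M. \<Sum>k<2 ^ M. if ?adj m j k then d j * d k else 0))"
      by (simp add: sum_distrib_left)
    also have "\<dots> \<le> (\<Sum>m\<le>M. 2 * 2 powr (- g * real m) * (3 * (\<Sum>i<2 ^ (M - m). (\<Sum>j\<in>{i * 2 ^ m..<i * 2 ^ m + 2 ^ m}. d j)\<^sup>2)))"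
      by (intro sum_mono mult_left_mono adjacent_cells_sum_le) auto
    also have "\<dots> = 6 * dyadic_energy g M d"
      unfolding dyadic_energy_levels by (simp add: sum_distrib_left mult_ac)
    also have "\<dots> \<le> 6 * (C0 * (\<Sum>j<2 ^ M. d j powr (1 / (1 - g / 2))) powr (2 - g))"
      using C0(2)[OF d] by simp
    also have "(\<Sum>j<2 ^ M. d j powr (1 / (1 - g / 2))) = (\<Sum>j<N. c j powr (1 / (1 - g / 2)))"
      using N by (intro sum.mono_neutral_cong_right) (auto simp: d_def)
    finally show ?thesis by simp
  qed
  thus ?thesis using C0(1) by (intro exI[of _ "6 * C0"]) auto
qed

section \<open>Trigonometric series\<close>

text \<open>The frequency \<nu> cancels in differences of the phase derivative, so the bound is
  uniform in it. The choice d = t^(-1/(m+1)) makes l = t c d^m equal to c/d and thereby balances the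
  two terms of \<open>van_der_corput_gap\<close>. Complex conjugation reduces the decreasing case to
  the increasing one.\<close>

lemma oscillatory_integral_bound:
  fixes w f :: "real \<Rightarrow> real"
  assumes "a \<le> b" "0 < t" "0 < c" "0 < m"
    and w: "\<And>x. x \<in> {a..b} \<Longrightarrow> (w has_real_derivative f x) (at x within {a..b})"
    and growth: "(\<forall>u v. a \<le> u \<longrightarrow> u \<le> v \<longrightarrow> v \<le> b \<longrightarrow> c * (v - u) ^ m \<le> f v - f u) \<or>
      (\<forall>u v. a \<le> u \<longrightarrow> u \<le> v \<longrightarrow> v \<le> b \<longrightarrow> c * (v - u) ^ m \<le> f u - f v)"
  shows "cmod (integral {a..b} (\<lambda>x. cis (t * w x - \<nu> * x))) \<le> (4 + 16 / c) * t powr (- 1 / (real m + 1))"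
proof -
  define d where "d = t powr (- 1 / (real m + 1))"
  have d: "0 < d" using \<open>0 < t\<close> by (simp add: d_def)
  define l where "l = t * c * d ^ m"
  have l: "0 < l" using assms d by (simp add: l_def)
  have "t powr 1 * t powr (- real m / (real m + 1)) = t powr (1 / (real m + 1))"
    unfolding powr_add[symmetric] by (simp add: field_simps)
  moreover have "d ^ m = t powr (- real m / (real m + 1))"
    using \<open>0 < t\<close> d by (simp add: d_def powr_powr flip: powr_realpow)
  ultimately have "l = c * t powr (1 / (real m + 1))" using \<open>0 < t\<close> by (simp add: l_def)
  also have "t powr (1 / (real m + 1)) = 1 / d"
    by (simp add: d_def powr_minus_divide[symmetric])
  finally have "l = c * (1 / d)" .
  hence bound: "4 * d + 16 / l = (4 + 16 / c) * d" by (simp add: algebra_simps)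
  have pow: "c * d ^ m \<le> c * (v - u) ^ m" if "d \<le> v - u" for u v
    using that d \<open>0 < c\<close> by (intro mult_left_mono power_mono) auto
  have increasing: "cmod (integral {a..b} (\<lambda>x. cis (t * w x - \<nu> * x))) \<le> 4 * d + 16 / l"
    if w: "\<And>x. x \<in> {a..b} \<Longrightarrow> (w has_real_derivative f x) (at x within {a..b})"
      and g: "\<forall>u v. a \<le> u \<longrightarrow> u \<le> v \<longrightarrow> v \<le> b \<longrightarrow> c * (v - u) ^ m \<le> f v - f u" for w f \<nu>
  proof (rule van_der_corput_gap[where F = "\<lambda>x. t * f x - \<nu>", OF \<open>a \<le> b\<close> l d])
    show "((\<lambda>x. t * w x - \<nu> * x) has_real_derivative t * f x - \<nu>) (at x within {a..b})" if "x \<in> {a..b}" for x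
      using w[OF that] by (auto intro!: derivative_eq_intros)
    have "f x \<le> f y" if "a \<le> x" "x \<le> y" "y \<le> b" for x y
      using g that \<open>0 < c\<close> by (smt (verit) mult_nonneg_nonneg zero_le_power)
    thus "mono_on {a..b} (\<lambda>x. t * f x - \<nu>)"
      using \<open>0 < t\<close> by (auto intro!: mono_onI)
    fix u v assume uv: "a \<le> u" "v \<le> b" "d \<le> v - u"
    hence "c * d ^ m \<le> f v - f u" using g pow[OF uv(3)] d by (smt (verit))
    from mult_left_mono[OF this, of t] show "l \<le> t * f v - \<nu> - (t * f u - \<nu>)"
      using \<open>0 < t\<close> by (simp add: l_def algebra_simps)
  qed
  have "cmod (integral {a..b} (\<lambda>x. cis (t * w x - \<nu> * x))) \<le> 4 * d + 16 / l"
    using growth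
  proof
    assume "\<forall>u v. a \<le> u \<longrightarrow> u \<le> v \<longrightarrow> v \<le> b \<longrightarrow> c * (v - u) ^ m \<le> f u - f v"
    hence "cmod (integral {a..b} (\<lambda>x. cis (t * - w x - - \<nu> * x))) \<le> 4 * d + 16 / l"
      by (intro increasing[where f = "\<lambda>x. - f x"] DERIV_minus w) auto
    moreover have "cis (t * - w x - - \<nu> * x) = cnj (cis (t * w x - \<nu> * x))" for x
      by (simp add: cis_cnj)
    ultimately show ?thesis by (simp only: integral_cnj[symmetric] complex_mod_cnj)
  qed (rule increasing[OF w])
  thus ?thesis unfolding bound by (simp add: d_def)
qed

lemma has_real_derivative_suminf:
  fixes f f' :: "nat \<Rightarrow> real \<Rightarrow> real"
  assumes f: "\<And>n x. (f n has_real_derivative f' n x) (at x)"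
    and M: "\<And>n x. \<bar>f' n x\<bar> \<le> M n" "summable M" and 0: "summable (\<lambda>n. f n 0)"
  shows "summable (\<lambda>n. f n x)" "((\<lambda>x. \<Sum>n. f n x) has_real_derivative (\<Sum>n. f' n x)) (at x)"
proof -
  have u: "uniformly_convergent_on UNIV (\<lambda>n x. \<Sum>i<n. f' i x)"
    by (rule Weierstrass_m_test'[OF _ M(2)]) (use M(1) in auto)
  show "summable (\<lambda>n. f n x)" "((\<lambda>x. \<Sum>n. f n x) has_real_derivative (\<Sum>n. f' n x)) (at x)"
    using has_field_derivative_series'[where S = UNIV and f = f and f' = f' and ?x0.0 = 0 and x = x] f u 0 by auto
qed

lemma continuous_on_suminf_real:
  fixes f :: "nat \<Rightarrow> real \<Rightarrow> real"
  assumes "\<And>k. continuous_on S (f k)" "\<And>k x. \<bar>f k x\<bar> \<le> M k" "summable M"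
  shows "continuous_on S (\<lambda>x. \<Sum>k. f k x)"
proof (rule uniform_limit_theorem)
  show "uniform_limit S (\<lambda>n x. \<Sum>k<n. f k x) (\<lambda>x. \<Sum>k. f k x) sequentially"
    by (rule Weierstrass_m_test[OF _ assms(3)]) (simp add: assms(2))
qed (auto intro!: always_eventually continuous_intros assms(1))

lemma abs_mult_sin_le: "0 \<le> c \<Longrightarrow> \<bar>c * sin x\<bar> \<le> c" for c x :: real
  using mult_left_mono[OF abs_sin_le_one[of x], of c] by (simp add: abs_mult)

lemma abs_mult_cos_le: "0 \<le> c \<Longrightarrow> \<bar>c * (2 * (1 - cos x))\<bar> \<le> 4 * c" for c x :: real
proof -
  have "\<bar>2 * (1 - y)\<bar> \<le> 4" if "y \<le> 1" "-1 \<le> y" for y :: real using that by (simp add: abs_le_iff)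
  hence "\<bar>2 * (1 - cos x)\<bar> \<le> 4" using cos_le_one cos_ge_minus_one by blast
  thus "0 \<le> c \<Longrightarrow> ?thesis" using mult_left_mono[of "\<bar>2 * (1 - cos x)\<bar>" 4 c] by (simp add: abs_mult mult.commute)
qed

section \<open>The Poisson kernel and Abel means of trigonometric series\<close>

lemma poisson_denominator_pos:
  fixes r x :: real
  assumes "0 \<le> r" "r < 1"
  shows "0 < 1 - 2 * r * cos x + r\<^sup>2"
proof -
  have "0 < (1 - r)\<^sup>2" using assms by simp
  also have "\<dots> \<le> 1 - 2 * r * cos x + r\<^sup>2"
    using mult_left_mono[OF cos_le_one[of x], of r] assms by (simp add: power2_eq_square algebra_simps)
  finally show ?thesis .
qed

text \<open>With z = r e^(ix) the series is 2 Re(z/(1 - z)), the Poisson kernel without its constant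
  term 1.\<close>

lemma poisson_kernel_sums:
  fixes r x :: real
  assumes r: "0 \<le> r" "r < 1"
  shows "(\<lambda>k. 2 * (r ^ Suc k * cos (real (Suc k) * x))) sums ((1 - r\<^sup>2) / (1 - 2 * r * cos x + r\<^sup>2) - 1)"
proof -
  define z where "z = rcis r x"
  let ?D = "1 - 2 * r * cos x + r\<^sup>2"
  have D: "0 < ?D" by (rule poisson_denominator_pos[OF r])
  have "(\<lambda>k. z * z ^ k) sums (z * (1 / (1 - z)))"
    using r by (intro sums_mult geometric_sums) (simp add: z_def)
  hence "(\<lambda>k. Re (z ^ Suc k)) sums Re (z * (1 / (1 - z)))"
    by (intro bounded_linear.sums[OF bounded_linear_Re]) simp
  moreover have "Re (z ^ Suc k) = r ^ Suc k * cos (real (Suc k) * x)" for k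
    unfolding z_def DeMoivre2 by (simp del: power_Suc)
  ultimately have "(\<lambda>k. 2 * (r ^ Suc k * cos (real (Suc k) * x))) sums (2 * Re (z * (1 / (1 - z))))"
    by (intro sums_mult) (simp only:)
  also have "2 * Re (z * (1 / (1 - z))) = (1 - r\<^sup>2) / ?D - 1"
  proof -
    have "(1 - r * c)\<^sup>2 + (r * s)\<^sup>2 = 1 - 2 * r * c + r\<^sup>2 * (c\<^sup>2 + s\<^sup>2)"
      "r * c * (1 - r * c) - r * s * (r * s) = r * c - r\<^sup>2 * (c\<^sup>2 + s\<^sup>2)" for c s
      by (simp_all add: power2_eq_square algebra_simps)
    from this[of "cos x" "sin x"] have n: "(1 - r * cos x)\<^sup>2 + (r * sin x)\<^sup>2 = ?D"
      "r * cos x * (1 - r * cos x) - r * sin x * (r * sin x) = r * cos x - r\<^sup>2" by simp_all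
    have "Re (z * (1 / (1 - z))) = (r * cos x - r\<^sup>2) / ?D"
      unfolding times_divide_eq_right mult_1_right Re_divide n(1)[symmetric] n(2)[symmetric]
      by (simp add: z_def)
    thus ?thesis using D by (simp add: field_simps)
  qed
  finally show ?thesis .
qed

lemma summable_inverse_squares: "summable (\<lambda>k. 1 / (real (Suc k))\<^sup>2)"
  using inverse_squares_sums by (simp add: sums_iff add.commute)

text \<open>Only odd frequencies n contribute, each 4/n^2. Their sum is 4 times the full sum pi^2/6
  minus the even part, which is again pi^2/6.\<close>

lemma square_cosine_sums_pi: "(\<lambda>k. 2 * (1 - cos (real (Suc k) * pi)) / (real (Suc k))\<^sup>2) sums (pi\<^sup>2 / 2)"
proof -
  let ?g = "\<lambda>k. 1 / (real k + 1)\<^sup>2"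
  have "(\<lambda>n. if even n then 0 else ?g ((n - 1) div 2)) sums (pi\<^sup>2 / 6)"
    using inverse_squares_sums by (intro sums_if') (simp add: add.commute)
  from sums_diff[OF sums_mult[OF inverse_squares_sums, of 4] this]
  have "(\<lambda>k. 4 * ?g k - (if even k then 0 else ?g ((k - 1) div 2))) sums (pi\<^sup>2 / 2)"
    by (simp add: add.commute)
  moreover have "4 * ?g k - (if even k then 0 else ?g ((k - 1) div 2))
      = 2 * (1 - cos (real (Suc k) * pi)) / (real (Suc k))\<^sup>2" for k
  proof (cases "even k")
    case True
    thus ?thesis using cos_npi[of "Suc k"] by (simp add: add.commute del: of_nat_Suc)
  next
    case False
    then obtain j where k: "k = 2 * j + 1" by (auto elim: oddE)
    hence "real k + 1 = 2 * (real j + 1)" by simp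
    hence "4 * ?g k = ?g j" by (simp only: power_mult_distrib) simp
    moreover have "(k - 1) div 2 = j" using k by simp
    ultimately show ?thesis using False cos_npi[of "Suc k"] by (simp del: of_nat_Suc)
  qed
  ultimately show ?thesis by simp
qed

text \<open>Integrating the Poisson kernel twice supplies the denominators n and n^2.
  \<open>A\<close> leads to the closed form in \<open>square_cosine_sums\<close>,
  \<open>\<theta>\<close> to the concavity of the derived symbol for \<alpha> > 1.\<close>

lemma poisson_antiderivatives:
  fixes r :: real
  assumes r: "0 \<le> r" "r < 1"
  defines "A \<equiv> (\<lambda>x. \<Sum>k. 2 * r ^ Suc k * (1 - cos (real (Suc k) * x)) / (real (Suc k))\<^sup>2)"
    and "\<theta> \<equiv> (\<lambda>x. \<Sum>k. 2 * r ^ Suc k * sin (real (Suc k) * x) / real (Suc k))"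
  shows "(A has_real_derivative \<theta> x) (at x)"
    and "(\<theta> has_real_derivative (1 - r\<^sup>2) / (1 - 2 * r * cos x + r\<^sup>2) - 1) (at x)"
    and "summable (\<lambda>k. 2 * r ^ Suc k * sin (real (Suc k) * x) / real (Suc k))"
proof -
  have geo: "summable (\<lambda>k. 2 * r ^ Suc k)"
    using r by (intro summable_mult) (simp add: summable_mult)
  show "(A has_real_derivative \<theta> x) (at x)"
    unfolding A_def \<theta>_def
  proof (rule has_real_derivative_suminf(2)[OF _ _ geo])
    fix k x
    show "((\<lambda>x. 2 * r ^ Suc k * (1 - cos (real (Suc k) * x)) / (real (Suc k))\<^sup>2)
        has_real_derivative 2 * r ^ Suc k * sin (real (Suc k) * x) / real (Suc k)) (at x)"
      by (auto intro!: derivative_eq_intros simp del: of_nat_Suc simp: power2_eq_square)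
    have "\<bar>2 * r ^ Suc k * sin (real (Suc k) * x)\<bar> / real (Suc k) \<le> 2 * r ^ Suc k / 1"
      using r by (intro frac_le abs_mult_sin_le) auto
    thus "\<bar>2 * r ^ Suc k * sin (real (Suc k) * x) / real (Suc k)\<bar> \<le> 2 * r ^ Suc k" by simp
  qed simp
  note * = has_real_derivative_suminf[where f = "\<lambda>k x. 2 * r ^ Suc k * sin (real (Suc k) * x) / real (Suc k)"
      and f' = "\<lambda>k x. 2 * (r ^ Suc k * cos (real (Suc k) * x))", OF _ _ geo, of x]
  have d: "((\<lambda>x. 2 * r ^ Suc k * sin (real (Suc k) * x) / real (Suc k))
        has_real_derivative 2 * (r ^ Suc k * cos (real (Suc k) * x))) (at x)" for k x
    by (auto intro!: derivative_eq_intros simp del: of_nat_Suc)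
  have b: "\<bar>2 * (r ^ Suc k * cos (real (Suc k) * x))\<bar> \<le> 2 * r ^ Suc k" for k x
    using mult_left_mono[OF abs_cos_le_one[of "real (Suc k) * x"], of "2 * r ^ Suc k"] r
    by (simp add: abs_mult del: of_nat_Suc)
  show "(\<theta> has_real_derivative (1 - r\<^sup>2) / (1 - 2 * r * cos x + r\<^sup>2) - 1) (at x)"
    unfolding \<theta>_def using *(2)[OF d b] sums_unique[OF poisson_kernel_sums[OF r, of x]] by simp
  show "summable (\<lambda>k. 2 * r ^ Suc k * sin (real (Suc k) * x) / real (Suc k))"
    using *(1)[OF d b] by simp
qed

text \<open>The Abel means of the difference of both sides are convex, because their second derivative is
  the Poisson kernel; a convex function vanishing at \<open>0\<close>, \<open>\<pi>\<close> and \<open>2\<pi>\<close> vanishes in between.\<close>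
lemma square_cosine_sums:
  assumes x: "0 \<le> x" "x \<le> 2 * pi"
  shows "(\<lambda>k. 2 * (1 - cos (real (Suc k) * x)) / (real (Suc k))\<^sup>2) sums (pi * x - x\<^sup>2 / 2)"
proof -
  define a where "a = (\<lambda>k x. 2 * (1 - cos (real (Suc k) * x)) / (real (Suc k))\<^sup>2)"
  define R where "R = (\<lambda>n. 1 - inverse (real (Suc n)))"
  have R: "0 \<le> R n" "R n < 1" for n by (auto simp: R_def field_simps)
  have a_le: "\<bar>a k x\<bar> \<le> 4 * (1 / (real (Suc k))\<^sup>2)" for k x
    using abs_mult_cos_le[of "1 / (real (Suc k))\<^sup>2" "real (Suc k) * x"] by (simp add: a_def del: of_nat_Suc)
  have sM: "summable (\<lambda>k. 4 * (1 / (real (Suc k))\<^sup>2))"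
    by (intro summable_mult summable_inverse_squares)
  have sa: "summable (\<lambda>k. a k x)" for x
    by (rule summable_comparison_test'[OF sM]) (use a_le in simp)
  define H where "H = (\<lambda>x. (\<Sum>k. a k x) - (pi * x - x\<^sup>2 / 2))"
  \<comment> \<open>Subtracting the parabola adds 1 to the second derivative and cancels the -1 in
    the derivative of \<open>\<theta>\<close>; exactly the Poisson kernel remains.\<close>
  define HR where "HR = (\<lambda>n x. (\<Sum>k. R n ^ Suc k * a k x) - (pi * x - x\<^sup>2 / 2))"
  have lim: "(\<lambda>n. HR n x) \<longlonglongrightarrow> H x" for x
    unfolding HR_def H_def
  proof (intro tendsto_intros)
    have "(\<lambda>n. R n) \<longlonglongrightarrow> 1 - 0"
      unfolding R_def by (intro tendsto_intros LIMSEQ_inverse_real_of_nat)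
    hence R1: "R \<longlonglongrightarrow> 1" by simp
    have "\<forall>\<^sub>F (k, n) in at_top \<times>\<^sub>F sequentially. norm (R n ^ Suc k * a k x) \<le> 4 * (1 / (real (Suc k))\<^sup>2)"
    proof (rule always_eventually, safe)
      fix k n
      have "\<bar>R n ^ Suc k\<bar> * \<bar>a k x\<bar> \<le> 1 * \<bar>a k x\<bar>"
        using R[of n] by (intro mult_right_mono) (simp_all add: power_le_one del: power_Suc)
      thus "norm (R n ^ Suc k * a k x) \<le> 4 * (1 / (real (Suc k))\<^sup>2)"
        using a_le[of k x] by (simp add: abs_mult del: power_Suc)
    qed
    moreover have "(\<lambda>n. R n ^ Suc k * a k x) \<longlonglongrightarrow> 1 ^ Suc k * a k x" for k
      by (intro tendsto_intros R1)
    ultimately show "(\<lambda>n. \<Sum>k. R n ^ Suc k * a k x) \<longlonglongrightarrow> (\<Sum>k. a k x)"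
      using tannerys_theorem[OF _ _ sM, of "\<lambda>k n. R n ^ Suc k * a k x" "\<lambda>k. a k x" sequentially]
      by simp
  qed
  have convR: "convex_on UNIV (HR n)" for n
  proof (rule f''_ge0_imp_convex)
    have e: "(\<Sum>k. R n ^ Suc k * a k x) =
        (\<Sum>k. 2 * R n ^ Suc k * (1 - cos (real (Suc k) * x)) / (real (Suc k))\<^sup>2)" for x
      by (simp add: a_def algebra_simps)
    let ?\<theta> = "\<lambda>x. \<Sum>k. 2 * R n ^ Suc k * sin (real (Suc k) * x) / real (Suc k)"
    show "(HR n has_real_derivative ?\<theta> x - (pi - x)) (at x)" for x
      unfolding HR_def e
    proof (rule DERIV_diff[OF poisson_antiderivatives(1)[OF R]])
      show "((\<lambda>x. pi * x - x\<^sup>2 / 2) has_real_derivative pi - x) (at x)"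
        by (auto intro!: derivative_eq_intros)
    qed
    show "((\<lambda>x. ?\<theta> x - (pi - x)) has_real_derivative
        (1 - (R n)\<^sup>2) / (1 - 2 * R n * cos x + (R n)\<^sup>2)) (at x)" for x
    proof (rule DERIV_cong[OF DERIV_diff[OF poisson_antiderivatives(2)[OF R]]])
      show "((\<lambda>x. pi - x) has_real_derivative - 1) (at x)"
        by (auto intro!: derivative_eq_intros)
    qed simp
    show "0 \<le> (1 - (R n)\<^sup>2) / (1 - 2 * R n * cos x + (R n)\<^sup>2)" for x
      using R[of n] poisson_denominator_pos[OF R, of n x] by (intro divide_nonneg_pos) (auto simp: power_le_one)
  qed simp
  have conv: "H ((1 - t) * x + t * y) \<le> (1 - t) * H x + t * H y" if "0 \<le> t" "t \<le> 1" for t x y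
  proof (rule LIMSEQ_le[OF lim])
    show "(\<lambda>n. (1 - t) * HR n x + t * HR n y) \<longlonglongrightarrow> (1 - t) * H x + t * H y"
      by (intro tendsto_intros lim)
    show "\<exists>N. \<forall>n\<ge>N. HR n ((1 - t) * x + t * y) \<le> (1 - t) * HR n x + t * HR n y"
      using convex_onD[OF convR that] by auto
  qed
  have H0: "H 0 = 0" by (simp add: H_def a_def)
  have Hpi: "H pi = 0"
    using sums_unique[OF square_cosine_sums_pi] by (simp add: H_def a_def power2_eq_square)
  have sym: "H (2 * pi - x) = H x" for x
  proof -
    have "cos (real (Suc k) * (2 * pi - x)) = cos (real (Suc k) * x)" for k
    proof -
      have "real (Suc k) * (2 * pi - x) = 2 * real (Suc k) * pi - real (Suc k) * x"
        by (simp only: right_diff_distrib mult_ac)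
      thus ?thesis by (simp only: cos_diff cos_2npi sin_2npi mult_1 mult_zero_left add_0_right)
    qed
    hence "a k (2 * pi - x) = a k x" for k by (simp add: a_def)
    moreover have "pi * (2 * pi - x) - (2 * pi - x)\<^sup>2 / 2 = pi * x - x\<^sup>2 / 2"
      by (simp add: power2_eq_square field_simps)
    ultimately show ?thesis by (simp add: H_def)
  qed
  have half: "H x = 0" if x: "0 \<le> x" "x < pi" for x
  proof (rule antisym)
    have "H ((1 - x / pi) * 0 + (x / pi) * pi) \<le> (1 - x / pi) * H 0 + (x / pi) * H pi"
      by (rule conv) (use x in auto)
    thus "H x \<le> 0" using H0 Hpi by simp
    \<comment> \<open>For the lower bound pi is written as a convex combination of x and 2 pi. As H
      vanishes at both pi and 2 pi, convexity gives 0 \<le> (1 - t) H(x).\<close>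
    define t where "t = (pi - x) / (2 * pi - x)"
    have t: "0 \<le> t" "t < 1" using x by (auto simp: t_def)
    have t': "(1 - t) * x + t * (2 * pi) = x + t * (2 * pi - x)" by (simp add: algebra_simps)
    have "(1 - t) * x + t * (2 * pi) = pi" unfolding t' using x by (simp add: t_def)
    moreover have "H ((1 - t) * x + t * (2 * pi)) \<le> (1 - t) * H x + t * H (2 * pi)"
      by (rule conv) (use t in auto)
    moreover have "H (2 * pi) = 0" using sym[of 0] H0 by simp
    ultimately have "0 \<le> (1 - t) * H x" using Hpi by simp
    thus "0 \<le> H x" using t by (simp add: zero_le_mult_iff)
  qed
  have "H x = 0"
    using half[of x] half[of "2 * pi - x"] sym[of x] Hpi x by (cases "x < pi"; cases "x = pi") force+
  thus ?thesis using summable_sums[OF sa[of x]] by (simp add: H_def a_def)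
qed

section \<open>The dispersion relation for \<open>\<alpha> \<le> 1\<close>\<close>

text \<open>This is m times the usual Fejer kernel, that is (1 - cos(mx))/(1 - cos x), written as a
  cosine polynomial so that it also makes sense where cos x = 1.\<close>

definition fejer :: "nat \<Rightarrow> real \<Rightarrow> real" where
  "fejer m x = real m + (\<Sum>k<m. 2 * real (m - Suc k) * cos (real (Suc k) * x))"

lemma fejer_times: "fejer m x * (1 - cos x) = 1 - cos (real m * x)"
proof -
  \<comment> \<open>The Dirichlet kernel: its product with 1 - cos x is a difference of neighbouring
    cosines, and it is the increment of \<open>fejer\<close> in m. Hence the product
    telescopes.\<close>
  define D where "D = (\<lambda>m. 1 + (\<Sum>k<m. 2 * cos (real (Suc k) * x)))"
  have D: "D m * (1 - cos x) = cos (real m * x) - cos (real (Suc m) * x)" for m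
  proof (induction m)
    case (Suc m)
    have "2 * cos (real (Suc m) * x) * cos x = cos (real (Suc (Suc m)) * x) + cos (real m * x)"
      unfolding mult.assoc cos_times_cos by (simp add: algebra_simps)
    moreover have "D (Suc m) * (1 - cos x) = D m * (1 - cos x) + (2 * cos (real (Suc m) * x) - 2 * cos (real (Suc m) * x) * cos x)"
      by (simp add: D_def algebra_simps)
    ultimately show ?case using Suc.IH by simp
  qed (simp add: D_def)
  have F: "fejer (Suc m) x = fejer m x + D m" for m
  proof -
    have "(\<Sum>k<m. 2 * real (Suc m - Suc k) * cos (real (Suc k) * x))
        = (\<Sum>k<m. 2 * real (m - Suc k) * cos (real (Suc k) * x) + 2 * cos (real (Suc k) * x))"
    proof (intro sum.cong refl)
      fix k assume "k \<in> {..<m}"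
      hence "2 * real (Suc m - Suc k) = 2 * real (m - Suc k) + 2" by (simp add: of_nat_diff)
      thus "2 * real (Suc m - Suc k) * cos (real (Suc k) * x)
          = 2 * real (m - Suc k) * cos (real (Suc k) * x) + 2 * cos (real (Suc k) * x)"
        by (simp only: distrib_right)
    qed
    thus ?thesis by (simp add: fejer_def D_def sum.distrib)
  qed
  show ?thesis
  proof (induction m)
    case (Suc m)
    have "fejer (Suc m) x * (1 - cos x) = fejer m x * (1 - cos x) + D m * (1 - cos x)"
      unfolding F by (simp add: algebra_simps)
    thus ?case using Suc.IH D[of m] by simp
  qed (simp add: fejer_def)
qed

lemma fejer_nonneg: "0 \<le> fejer m x"
proof (cases "cos x = 1")
  case True
  then obtain n :: int where "x = of_int n * (2 * pi)" by (auto simp: cos_one_2pi_int mult_ac)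
  hence c: "cos (real (Suc k) * x) = 1" for k
    using cos_int_2pin[of "int (Suc k) * n"] by (simp add: mult_ac)
  show ?thesis unfolding fejer_def c by (intro add_nonneg_nonneg sum_nonneg) auto
next
  case False
  hence "0 < 1 - cos x" using cos_le_one[of x] by linarith
  moreover have "0 \<le> fejer m x * (1 - cos x)" unfolding fejer_times by simp
  ultimately show ?thesis by (simp add: zero_le_mult_iff)
qed

text \<open>\<open>\<Phi>\<^sub>m(x) = 2 \<Sum>\<^sub>k min(k, m) k\<^sup>-\<^sup>2 (1 - cos kx)\<close>, in closed form on \<open>[0, 2\<pi>]\<close>. Its second
  derivative is minus the Fejer kernel, and since \<open>k \<mapsto> k\<^sup>1\<^sup>-\<^sup>\<alpha>\<close> is concave, the dispersion relation is
  a positive combination of these functions.\<close>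
definition min_symbol :: "nat \<Rightarrow> real \<Rightarrow> real" where
  "min_symbol m x = real m * (pi * x - x\<^sup>2 / 2)
     - (\<Sum>k<m. 2 * real (m - Suc k) * (1 - cos (real (Suc k) * x)) / (real (Suc k))\<^sup>2)"

definition min_symbol' :: "nat \<Rightarrow> real \<Rightarrow> real" where
  "min_symbol' m x = real m * (pi - x) - (\<Sum>k<m. 2 * real (m - Suc k) * sin (real (Suc k) * x) / real (Suc k))"

lemma min_symbol_deriv: "(min_symbol m has_real_derivative min_symbol' m x) (at x)"
  unfolding min_symbol_def min_symbol'_def
  by (auto intro!: derivative_eq_intros sum.cong simp del: of_nat_Suc simp: power2_eq_square)

lemma min_symbol'_deriv: "(min_symbol' m has_real_derivative - fejer m x) (at x)"
  unfolding min_symbol'_def fejer_def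
  by (auto intro!: derivative_eq_intros sum.cong simp del: of_nat_Suc)

text \<open>Because min(k, m) = m - max(k, m) + k, that is m minus the positive part of m - k, the
  series is m times \<open>square_cosine_sums\<close> minus a finite sum. Truncated subtraction of
  naturals supplies the positive part.\<close>

lemma min_symbol_sums:
  assumes "0 \<le> x" "x \<le> 2 * pi"
  shows "(\<lambda>k. real (min (Suc k) m) * (2 * (1 - cos (real (Suc k) * x)) / (real (Suc k))\<^sup>2)) sums min_symbol m x"
proof -
  let ?a = "\<lambda>k. 2 * (1 - cos (real (Suc k) * x)) / (real (Suc k))\<^sup>2"
  have "(\<lambda>k. real (m - Suc k) * ?a k) sums (\<Sum>k<m. real (m - Suc k) * ?a k)"
    by (rule sums_finite) auto
  from sums_diff[OF sums_mult[OF square_cosine_sums[OF assms], of "real m"] this]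
  moreover have "2 * real (m - Suc k) * (1 - cos (real (Suc k) * x)) / (real (Suc k))\<^sup>2 = real (m - Suc k) * ?a k" for k
    by (simp only: times_divide_eq_right mult_ac)
  ultimately have "(\<lambda>k. real m * ?a k - real (m - Suc k) * ?a k) sums min_symbol m x"
    unfolding min_symbol_def by (simp only:)
  moreover have "real m * z - real (m - Suc k) * z = real (min (Suc k) m) * z" for k z
  proof -
    have "real m - real (m - Suc k) = real (min (Suc k) m)" by (auto simp: of_nat_diff min_def)
    thus ?thesis by (metis left_diff_distrib)
  qed
  ultimately show ?thesis by (simp only:)
qed

definition dispersion :: "real \<Rightarrow> real \<Rightarrow> real" where
  "dispersion \<alpha> x = (\<Sum>k. real (Suc k) powr (- (1 + \<alpha>)) * (2 * (1 - cos (real (Suc k) * x))))"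

lemma powr_diff_le:
  assumes "0 \<le> b" "b \<le> (1::real)" "0 < n"
  shows "real (Suc n) powr b - real n powr b \<le> real n powr (b - 1)"
proof -
  have "real (Suc n) powr b = (real n * (1 + 1 / real n)) powr b"
    using assms by (simp add: distrib_left add.commute)
  also have "\<dots> = real n powr b * (1 + 1 / real n) powr b"
    by (simp add: powr_mult)
  also have "\<dots> \<le> real n powr b * (1 + 1 / real n) powr 1"
    using assms by (intro mult_left_mono powr_mono) auto
  finally show ?thesis using assms by (simp add: powr_diff algebra_simps)
qed

lemma powr_diff_tendsto_0:
  assumes "0 \<le> b" "b < (1::real)"
  shows "(\<lambda>n. real (Suc n) powr b - real n powr b) \<longlonglongrightarrow> 0"
proof (rule tendsto_sandwich[OF _ _ tendsto_const])
  show "(\<lambda>n. real n powr (b - 1)) \<longlonglongrightarrow> 0"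
    using assms by (intro tendsto_neg_powr filterlim_real_sequentially) auto
  show "\<forall>\<^sub>F n in sequentially. real (Suc n) powr b - real n powr b \<le> real n powr (b - 1)"
    using eventually_gt_at_top[of 0] by eventually_elim (use assms in \<open>intro powr_diff_le; simp\<close>)
  show "\<forall>\<^sub>F n in sequentially. 0 \<le> real (Suc n) powr b - real n powr b"
    using assms by (intro always_eventually allI) (simp add: powr_mono2)
qed

text \<open>The negated second difference of n^b. Since \<open>0 powr 0 = 0\<close>, the value at m
  = 1 is 1 for b = 0 and the later values vanish; this is the correct decomposition k^0 = min(k, 1),
  so \<alpha> = 1 is covered.\<close>

definition powr_bend :: "real \<Rightarrow> nat \<Rightarrow> real" where
  "powr_bend b m = 2 * real m powr b - real (m - 1) powr b - real (Suc m) powr b"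

lemma powr_bend_nonneg:
  assumes "0 \<le> b" "b < 1" "1 \<le> m"
  shows "0 \<le> powr_bend b m"
proof (cases "b = 0")
  case False
  have "(real (m - 1) powr b + real (Suc m) powr b) / 2 \<le> ((real (m - 1) + real (Suc m)) / 2) powr b"
    by (rule powr_mean_ge) (use assms False in auto)
  also have "(real (m - 1) + real (Suc m)) / 2 = real m" using assms by (simp add: of_nat_diff)
  finally show ?thesis by (simp add: powr_bend_def)
qed (use assms in \<open>simp add: powr_bend_def\<close>)

lemma powr_bend_1_pos:
  assumes "b < 1"
  shows "0 < powr_bend b 1"
  using powr_less_mono[of b 1 2] assms by (simp add: powr_bend_def)

text \<open>Summation by parts twice. The boundary term vanishes as N grows if b < 1, which exhibits
  k^b as a nonnegative combination of the sequences min(k, m).\<close>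

lemma sum_powr_bend:
  assumes "k \<le> N"
  shows "(\<Sum>m=1..N. powr_bend b m * real (min k m))
    = real k powr b - real k * (real (Suc N) powr b - real N powr b)"
  using assms
proof (induction N rule: dec_induct)
  case base
  have "(\<Sum>m=1..k. powr_bend b m * real m) = real k powr b - real k * (real (Suc k) powr b - real k powr b)"
  proof (induction k)
    case (Suc k)
    thus ?case by (simp add: powr_bend_def algebra_simps)
  qed simp
  moreover have "(\<Sum>m=1..k. powr_bend b m * real (min k m)) = (\<Sum>m=1..k. powr_bend b m * real m)"
    by (intro sum.cong) auto
  ultimately show ?case by simp
next
  case (step N)
  thus ?case by (simp add: powr_bend_def algebra_simps)
qed

definition dispersion_approx :: "real \<Rightarrow> nat \<Rightarrow> real \<Rightarrow> real" where
  "dispersion_approx b N x = (\<Sum>m=1..N. powr_bend b m * min_symbol m x)"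

text \<open>With b = 1 - \<alpha> the weight k^(-1-\<alpha>) is k^b/k^2. The approximating
  coefficients stay between 0 and k^b, so a summable majorant allows the limit under the
  series.\<close>

lemma dispersion_approx_tendsto:
  assumes \<alpha>: "0 < \<alpha>" "\<alpha> \<le> 1" and x: "0 \<le> x" "x \<le> 2 * pi"
  shows "(\<lambda>N. dispersion_approx (1 - \<alpha>) N x) \<longlonglongrightarrow> dispersion \<alpha> x"
proof -
  define b where "b = 1 - \<alpha>"
  have b: "0 \<le> b" "b < 1" using \<alpha> by (auto simp: b_def)
  define g where "g = (\<lambda>k. 2 * (1 - cos (real (Suc k) * x)) / (real (Suc k))\<^sup>2)"
  define a where "a = (\<lambda>k N. \<Sum>m=1..N. powr_bend b m * real (min (Suc k) m))"
  have ag: "(\<lambda>k. a k N * g k) sums dispersion_approx b N x" for N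
  proof -
    have "(\<lambda>k. \<Sum>m=1..N. powr_bend b m * (real (min (Suc k) m) * g k)) sums dispersion_approx b N x"
      unfolding dispersion_approx_def g_def by (intro sums_sum sums_mult min_symbol_sums x)
    thus ?thesis unfolding a_def by (simp add: sum_distrib_right mult.assoc)
  qed
  have g: "0 \<le> g k" "g k \<le> 4 / (real (Suc k))\<^sup>2" for k
    using abs_mult_cos_le[of "1 / (real (Suc k))\<^sup>2" "real (Suc k) * x"] by (simp_all add: g_def del: of_nat_Suc)
  have bend: "0 \<le> powr_bend b m * real (min (Suc k) m)" if "1 \<le> m" for k m
    using powr_bend_nonneg[OF b that] by simp
  have a_le: "0 \<le> a k N \<and> a k N \<le> real (Suc k) powr b" for k N
  proof
    show "0 \<le> a k N" unfolding a_def by (rule sum_nonneg) (use bend in auto)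
    \<comment> \<open>Lengthening the sum to at least k + 1 terms only adds nonnegative ones and
      makes \<open>sum_powr_bend\<close> applicable for every N.\<close>
    have "a k N \<le> (\<Sum>m=1..max N (Suc k). powr_bend b m * real (min (Suc k) m))"
      unfolding a_def by (rule sum_mono2) (use bend in auto)
    also have "\<dots> = real (Suc k) powr b - real (Suc k) * (real (Suc (max N (Suc k))) powr b - real (max N (Suc k)) powr b)"
      by (rule sum_powr_bend) simp
    also have "\<dots> \<le> real (Suc k) powr b"
    proof -
      have "0 \<le> real (Suc (max N (Suc k))) powr b - real (max N (Suc k)) powr b"
        using b by (simp add: powr_mono2)
      hence "0 \<le> real (Suc k) * (real (Suc (max N (Suc k))) powr b - real (max N (Suc k)) powr b)"
        by (intro mult_nonneg_nonneg) auto
      thus ?thesis by linarith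
    qed
    finally show "a k N \<le> real (Suc k) powr b" .
  qed
  have lim: "(\<lambda>N. a k N) \<longlonglongrightarrow> real (Suc k) powr b" for k
  proof (rule Lim_transform_eventually)
    show "\<forall>\<^sub>F N in sequentially. real (Suc k) powr b - real (Suc k) * (real (Suc N) powr b - real N powr b) = a k N"
      using eventually_ge_at_top[of "Suc k"] unfolding a_def
      by eventually_elim (rule sum_powr_bend[symmetric])
    have "(\<lambda>N. real (Suc k) powr b - real (Suc k) * (real (Suc N) powr b - real N powr b))
        \<longlonglongrightarrow> real (Suc k) powr b - real (Suc k) * 0"
      by (intro tendsto_intros powr_diff_tendsto_0 b)
    thus "(\<lambda>N. real (Suc k) powr b - real (Suc k) * (real (Suc N) powr b - real N powr b))
        \<longlonglongrightarrow> real (Suc k) powr b" by simp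
  qed
  have e: "real (Suc k) powr b / (real (Suc k))\<^sup>2 = real (Suc k) powr (- (1 + \<alpha>))" for k
  proof -
    have "real (Suc k) powr b / (real (Suc k))\<^sup>2 = real (Suc k) powr (b - 2)"
      by (simp add: powr_diff del: of_nat_Suc)
    thus ?thesis by (simp add: b_def)
  qed
  have "summable (\<lambda>k. real (Suc k) powr (- (1 + \<alpha>)))"
    using \<alpha> by (subst summable_Suc_iff) (simp add: summable_real_powr_iff)
  hence sM: "summable (\<lambda>k. 4 * real (Suc k) powr (- (1 + \<alpha>)))" by (rule summable_mult)
  have "\<forall>\<^sub>F (k, N) in at_top \<times>\<^sub>F sequentially. norm (a k N * g k) \<le> 4 * real (Suc k) powr (- (1 + \<alpha>))"
  proof (rule always_eventually, safe)
    fix k N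
    have "a k N * g k \<le> real (Suc k) powr b * (4 / (real (Suc k))\<^sup>2)"
      using a_le[of k N] g[of k] by (intro mult_mono) auto
    also have "\<dots> = 4 * real (Suc k) powr (- (1 + \<alpha>))" unfolding e[symmetric] by simp
    finally show "norm (a k N * g k) \<le> 4 * real (Suc k) powr (- (1 + \<alpha>))"
      using a_le[of k N] g[of k] by (simp add: abs_mult)
  qed
  moreover have "(\<lambda>N. a k N * g k) \<longlonglongrightarrow> real (Suc k) powr b * g k" for k
    by (intro tendsto_mult lim tendsto_const)
  ultimately have "(\<lambda>N. \<Sum>k. a k N * g k) \<longlonglongrightarrow> (\<Sum>k. real (Suc k) powr b * g k)"
    using tannerys_theorem[OF _ _ sM, of "\<lambda>k N. a k N * g k" "\<lambda>k. real (Suc k) powr b * g k" sequentially]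
    by simp
  moreover have "(\<Sum>k. a k N * g k) = dispersion_approx b N x" for N
    using ag[of N] by (simp add: sums_iff)
  moreover have "(\<Sum>k. real (Suc k) powr b * g k) = dispersion \<alpha> x"
    unfolding dispersion_def e[symmetric] by (simp add: g_def)
  ultimately show ?thesis by (simp add: b_def)
qed

text \<open>The term m = 1 alone makes the approximations uniformly concave, because its Fejer
  kernel is the constant 1; all other terms have the same sign. The resulting bound does not depend
  on N, and it is the integral, not the derivative of the phase, that passes to the limit.\<close>

lemma dispersive_integral_alpha_le_1:
  assumes \<alpha>: "0 < \<alpha>" "\<alpha> \<le> 1"
  shows "\<exists>C\<ge>0. \<forall>t>0. \<forall>\<nu>. cmod (integral {0..2 * pi} (\<lambda>x. cis (t * dispersion \<alpha> x - \<nu> * x))) \<le> C * t powr (- 1 / 2)"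
proof -
  define b where "b = 1 - \<alpha>"
  have b: "0 \<le> b" "b < 1" using \<alpha> by (auto simp: b_def)
  define c where "c = powr_bend b 1"
  have c: "0 < c" unfolding c_def by (rule powr_bend_1_pos[OF b(2)])
  have approx: "cmod (integral {0..2 * pi} (\<lambda>x. cis (t * dispersion_approx b (Suc N) x - \<nu> * x))) \<le> (4 + 16 / c) * t powr (- 1 / 2)"
    if t: "0 < t" for t \<nu> N
  proof -
    define f where "f = (\<lambda>x. \<Sum>m=1..Suc N. powr_bend b m * min_symbol' m x)"
    have w: "(dispersion_approx b (Suc N) has_real_derivative f x) (at x)" for x
      unfolding dispersion_approx_def f_def by (intro DERIV_sum DERIV_cmult min_symbol_deriv)
    have f: "(f has_real_derivative (\<Sum>m=1..Suc N. powr_bend b m * - fejer m x)) (at x)" for x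
      unfolding f_def by (intro DERIV_sum DERIV_cmult min_symbol'_deriv)
    have f': "(\<Sum>m=1..Suc N. powr_bend b m * - fejer m x) \<le> - c" for x
    proof -
      have "powr_bend b 1 * fejer 1 x \<le> (\<Sum>m=1..Suc N. powr_bend b m * fejer m x)"
        by (rule member_le_sum) (use fejer_nonneg powr_bend_nonneg[OF b] in auto)
      moreover have "fejer 1 x = 1" by (simp add: fejer_def)
      ultimately show ?thesis by (simp only: c_def mult_minus_right sum_negf mult_1_right neg_le_iff_le)
    qed
    have growth: "c * (v - u) ^ 1 \<le> f u - f v" if "u \<le> v" for u v
    proof -
      have "f v + c * v \<le> f u + c * u"
      proof (rule DERIV_nonpos_imp_nonincreasing[OF that])
        fix x
        have "((\<lambda>x. f x + c * x) has_real_derivative (\<Sum>m=1..Suc N. powr_bend b m * - fejer m x) + c) (at x)"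
          by (auto intro!: derivative_eq_intros f)
        thus "\<exists>y. ((\<lambda>x. f x + c * x) has_real_derivative y) (at x) \<and> y \<le> 0"
          using f'[of x] by (intro exI conjI) auto
      qed
      thus ?thesis by (simp add: algebra_simps)
    qed
    have "cmod (integral {0..2 * pi} (\<lambda>x. cis (t * dispersion_approx b (Suc N) x - \<nu> * x)))
        \<le> (4 + 16 / c) * t powr (- 1 / (real 1 + 1))"
      by (rule oscillatory_integral_bound[OF _ t c, where f = f])
        (use growth w in \<open>auto intro: has_field_derivative_at_within\<close>)
    thus ?thesis by simp
  qed
  have "cmod (integral {0..2 * pi} (\<lambda>x. cis (t * dispersion \<alpha> x - \<nu> * x))) \<le> (4 + 16 / c) * t powr (- 1 / 2)"
    if t: "0 < t" for t \<nu>
  proof (rule LIMSEQ_le_const2)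
    show "(\<lambda>N. cmod (integral {0..2 * pi} (\<lambda>x. cis (t * dispersion_approx b (Suc N) x - \<nu> * x))))
        \<longlonglongrightarrow> cmod (integral {0..2 * pi} (\<lambda>x. cis (t * dispersion \<alpha> x - \<nu> * x)))"
    proof (rule tendsto_norm, rule dominated_convergence(2))
      show "(\<lambda>x. cis (t * dispersion_approx b (Suc N) x - \<nu> * x)) integrable_on {0..2 * pi}" for N
        unfolding dispersion_approx_def min_symbol_def
        by (intro integrable_continuous_interval continuous_on_cis continuous_intros) auto
      show "(\<lambda>N. cis (t * dispersion_approx b (Suc N) x - \<nu> * x)) \<longlonglongrightarrow> cis (t * dispersion \<alpha> x - \<nu> * x)"
        if "x \<in> {0..2 * pi}" for x
        using that unfolding b_def
        by (intro tendsto_cis tendsto_intros LIMSEQ_Suc[OF dispersion_approx_tendsto] \<alpha>) auto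
      show "(\<lambda>_. 1 :: real) integrable_on {0..2 * pi}" by (rule integrable_const_ivl)
    qed simp
    show "\<exists>N. \<forall>n\<ge>N. cmod (integral {0..2 * pi} (\<lambda>x. cis (t * dispersion_approx b (Suc n) x - \<nu> * x)))
        \<le> (4 + 16 / c) * t powr (- 1 / 2)"
      using approx[OF t] by blast
  qed
  thus ?thesis using c by (intro exI[of _ "4 + 16 / c"]) auto
qed

section \<open>The dispersion relation for \<open>\<alpha> > 1\<close>\<close>

lemma Gamma_integral_scaled:
  assumes "0 < s" "0 < a"
  shows "has_bochner_integral lborel (\<lambda>t. indicat_real {0..} t * (t powr (s - 1) * exp (- (a * t)))) (Gamma s * a powr (- s))"
proof -
  let ?g = "\<lambda>t::real. indicat_real {0..} t * (t powr (s - 1) * exp (- t))"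
  have "has_bochner_integral lborel ?g (Gamma s)"
  proof (rule has_bochner_integral_nn_integral)
    show "(\<integral>\<^sup>+ t. ennreal (?g t) \<partial>lborel) = ennreal (Gamma s)"
      using Gamma_conv_nn_integral_real[OF assms(1)] by (simp add: exp_minus field_simps)
    show "0 \<le> Gamma s" using assms by (simp add: Gamma_real_pos less_imp_le)
  qed auto
  hence "has_bochner_integral lborel (\<lambda>t. ?g (0 + a * t)) (Gamma s /\<^sub>R \<bar>a\<bar>)"
    using assms by (subst (asm) lborel_has_bochner_integral_real_affine_iff[of a _ _ 0]) auto
  from has_bochner_integral_mult_right[OF this, of "a powr (1 - s)"]
  have "has_bochner_integral lborel (\<lambda>t. a powr (1 - s) * ?g (a * t)) (a powr (1 - s) * (Gamma s / a))"
    using assms by (simp add: field_simps)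
  moreover have "a powr (1 - s) * ?g (a * t) = indicat_real {0..} t * (t powr (s - 1) * exp (- (a * t)))" for t
  proof (cases "0 \<le> t")
    case True
    thus ?thesis using assms by (simp add: powr_mult flip: powr_add mult.assoc)
  qed (use assms in \<open>simp add: mult_le_0_iff zero_le_mult_iff\<close>)
  moreover have "a powr (1 - s) * (Gamma s / a) = Gamma s * a powr (- s)"
    using assms by (simp add: powr_diff powr_minus field_simps)
  ultimately show ?thesis by simp
qed

text \<open>\<open>n\<^sup>-\<^sup>s\<close> is a positive superposition of the sequences \<open>r\<^sup>n\<close>, \<open>0 < r < 1\<close>.\<close>
lemma suminf_powr_nonneg_if_abel_nonneg:
  fixes e :: "nat \<Rightarrow> real"
  assumes s: "0 < s" and bound: "\<And>k. \<bar>e k\<bar> \<le> B" and sum: "summable (\<lambda>k. real (Suc k) powr (- s) * \<bar>e k\<bar>)"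
    and abel: "\<And>r. 0 < r \<Longrightarrow> r < 1 \<Longrightarrow> 0 \<le> (\<Sum>k. r ^ Suc k * e k)"
  shows "0 \<le> (\<Sum>k. real (Suc k) powr (- s) * e k)"
proof -
  define g where "g = (\<lambda>k t. indicat_real {0..} t * (t powr (s - 1) * exp (- (real (Suc k) * t))) :: real)"
  have g: "has_bochner_integral lborel (g k) (Gamma s * real (Suc k) powr (- s))" for k
    unfolding g_def by (rule Gamma_integral_scaled) (use s in auto)
  have g0: "0 \<le> g k t" for k t by (simp add: g_def)
  have g_eq: "g k t = (indicat_real {0..} t * t powr (s - 1)) * exp (- t) ^ Suc k" for k t
    using exp_of_nat_mult[of "Suc k" "- t"] by (simp add: g_def del: of_nat_Suc power_Suc)
  have g_neg: "g k t = 0" if "t \<le> 0" for k t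
    using that by (cases "t = 0") (auto simp: g_def)
  have int: "integrable lborel (\<lambda>t. g k t * e k)" for k
    using g[of k] by (intro integrable_mult_left) (auto simp: has_bochner_integral_iff)
  have "summable (\<lambda>k. norm (g k t * e k))" for t
  proof (cases "0 < t")
    case True
    have "summable (\<lambda>k. (indicat_real {0..} t * t powr (s - 1)) * (exp (- t) ^ Suc k * B))"
      using True by (intro summable_mult summable_mult2) simp
    thus ?thesis
    proof (rule summable_comparison_test'[where N = 0])
      fix k
      show "norm (norm (g k t * e k)) \<le> (indicat_real {0..} t * t powr (s - 1)) * (exp (- t) ^ Suc k * B)"
        using mult_left_mono[OF bound[of k] g0[of k t]] g0[of k t]
        by (simp add: abs_mult) (simp add: g_eq mult_ac)
    qed
  qed (simp add: g_neg)
  hence AE: "AE t in lborel. summable (\<lambda>k. norm (g k t * e k))" by simp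
  have norm: "(\<integral>t. norm (g k t * e k) \<partial>lborel) = Gamma s * (real (Suc k) powr (- s) * \<bar>e k\<bar>)" for k
    using g[of k] g0[of k] by (simp add: abs_mult has_bochner_integral_iff)
  have "summable (\<lambda>k. \<integral>t. norm (g k t * e k) \<partial>lborel)"
    unfolding norm by (rule summable_mult[OF sum])
  from integral_suminf[OF int AE this]
  have "(\<integral>t. (\<Sum>k. g k t * e k) \<partial>lborel) = (\<Sum>k. Gamma s * (real (Suc k) powr (- s) * e k))"
    using g by (simp add: has_bochner_integral_iff mult.assoc)
  also have "\<dots> = Gamma s * (\<Sum>k. real (Suc k) powr (- s) * e k)"
  proof (rule suminf_mult)
    show "summable (\<lambda>k. real (Suc k) powr (- s) * e k)"
      by (rule summable_norm_cancel) (use sum in \<open>simp add: abs_mult\<close>)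
  qed
  finally have eq: "Gamma s * (\<Sum>k. real (Suc k) powr (- s) * e k) = (\<integral>t. (\<Sum>k. g k t * e k) \<partial>lborel)" ..
  have "0 \<le> (\<integral>t. (\<Sum>k. g k t * e k) \<partial>lborel)"
  proof (rule integral_nonneg_AE, intro AE_I2)
    fix t :: real
    show "0 \<le> (\<Sum>k. g k t * e k)"
    proof (cases "0 < t")
      case True
      have sm: "summable (\<lambda>k. exp (- t) ^ Suc k * e k)"
      proof (rule summable_comparison_test'[where N = 0])
        show "summable (\<lambda>k. exp (- t) ^ Suc k * B)" using True by (intro summable_mult2) simp
        show "norm (exp (- t) ^ Suc k * e k) \<le> exp (- t) ^ Suc k * B" for k
          using mult_left_mono[OF bound[of k], of "exp (- t) ^ Suc k"] by (simp add: abs_mult)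
      qed
      have "(\<Sum>k. g k t * e k) = (indicat_real {0..} t * t powr (s - 1)) * (\<Sum>k. exp (- t) ^ Suc k * e k)"
        unfolding g_eq mult.assoc[of _ _ "e _"] by (rule suminf_mult[OF sm])
      moreover have "0 \<le> (\<Sum>k. exp (- t) ^ Suc k * e k)" by (rule abel) (use True in auto)
      ultimately show ?thesis by simp
    qed (simp add: g_neg)
  qed
  thus ?thesis using eq Gamma_real_pos[OF s] by (metis zero_le_mult_iff not_less)
qed

text \<open>Apart from the correction the second derivative is -2r(1 - r^2) sin x / D^2, where D^2
  \<le> (1 + r)^4 \<le> 8(1 + r); this yields the constant 1/4. The factor r - r^2 is chosen because
  superposing powers of r later turns it into the positive number 1 - 2^(1-\<alpha>).\<close>

lemma abel_sine_series_concave: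
  fixes r :: real
  assumes r: "0 < r" "r < 1"
  shows "concave_on {0..pi} (\<lambda>x. (\<Sum>k. 2 * r ^ Suc k * sin (real (Suc k) * x) / real (Suc k)) - (r - r\<^sup>2) / 4 * sin x)"
proof (rule f''_le0_imp_concave)
  let ?D = "\<lambda>x. 1 - 2 * r * cos x + r\<^sup>2"
  have D: "0 < ?D x" for x by (rule poisson_denominator_pos) (use r in auto)
  show "((\<lambda>x. (\<Sum>k. 2 * r ^ Suc k * sin (real (Suc k) * x) / real (Suc k)) - (r - r\<^sup>2) / 4 * sin x)
      has_real_derivative ((1 - r\<^sup>2) / ?D x - 1) - (r - r\<^sup>2) / 4 * cos x) (at x)" for x
  proof (rule DERIV_diff[OF poisson_antiderivatives(2)])
    show "((\<lambda>x. (r - r\<^sup>2) / 4 * sin x) has_real_derivative (r - r\<^sup>2) / 4 * cos x) (at x)"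
      by (auto intro!: derivative_eq_intros)
  qed (use r in auto)
  show "((\<lambda>x. ((1 - r\<^sup>2) / ?D x - 1) - (r - r\<^sup>2) / 4 * cos x) has_real_derivative
      - ((1 - r\<^sup>2) * (2 * r * sin x)) / (?D x * ?D x) + (r - r\<^sup>2) / 4 * sin x) (at x)" for x
    using D[of x] by (auto intro!: derivative_eq_intros simp: mult_ac)
  show "- ((1 - r\<^sup>2) * (2 * r * sin x)) / (?D x * ?D x) + (r - r\<^sup>2) / 4 * sin x \<le> 0" if "x \<in> {0..pi}" for x
  proof -
    have s: "0 \<le> sin x" using that by (intro sin_ge_zero) auto
    have "- 1 \<le> cos x" by simp
    from mult_left_mono[OF this, of "2 * r"] r have "?D x \<le> (1 + r)\<^sup>2"
      by (simp add: power2_eq_square algebra_simps)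
    hence "?D x * ?D x \<le> (1 + r)\<^sup>2 * (1 + r)\<^sup>2" using D[of x] by (intro mult_mono) auto
    also have "\<dots> = (1 + r) * (1 + r) ^ 3" by (simp add: power2_eq_square power3_eq_cube)
    also have "\<dots> \<le> (1 + r) * 2 ^ 3" using r by (intro mult_left_mono power_mono) auto
    finally have DD: "?D x * ?D x \<le> 8 * (1 + r)" by simp
    have "(r - r\<^sup>2) / 4 * (?D x * ?D x) \<le> (r - r\<^sup>2) / 4 * (8 * (1 + r))"
      using r by (intro mult_left_mono DD) (simp add: power2_eq_square mult_le_one)
    also have "\<dots> = (1 - r\<^sup>2) * (2 * r)" by (simp add: power2_eq_square field_simps)
    finally have "(r - r\<^sup>2) / 4 \<le> (1 - r\<^sup>2) * (2 * r) / (?D x * ?D x)"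
      using D[of x] by (subst pos_le_divide_eq) auto
    from mult_right_mono[OF this s] show ?thesis by (simp add: mult_ac)
  qed
qed simp

definition dispersion' :: "real \<Rightarrow> real \<Rightarrow> real" where
  "dispersion' \<alpha> x = (\<Sum>k. 2 * (real (Suc k) powr (- \<alpha>) * sin (real (Suc k) * x)))"

lemma summable_Suc_powr: "1 < a \<Longrightarrow> summable (\<lambda>k. real (Suc k) powr (- a))"
  by (subst summable_Suc_iff) (simp add: summable_real_powr_iff)

lemma dispersion'_term_le:
  "\<bar>2 * (real (Suc k) powr (- \<alpha>) * sin (real (Suc k) * x))\<bar> \<le> 2 * real (Suc k) powr (- \<alpha>)"
  using abs_mult_sin_le[of "real (Suc k) powr (- \<alpha>)"] by (simp add: abs_mult)

lemma summable_dispersion':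
  assumes "1 < \<alpha>"
  shows "summable (\<lambda>k. 2 * (real (Suc k) powr (- \<alpha>) * sin (real (Suc k) * x)))"
  by (rule summable_comparison_test'[OF summable_mult[OF summable_Suc_powr[OF assms]], where N = 0 and c1 = 2])
    (simp only: real_norm_def dispersion'_term_le)

lemma dispersion_deriv:
  assumes "1 < \<alpha>"
  shows "(dispersion \<alpha> has_real_derivative dispersion' \<alpha> x) (at x)"
proof -
  have "((\<lambda>x. \<Sum>k. real (Suc k) powr (- (1 + \<alpha>)) * (2 * (1 - cos (real (Suc k) * x)))) has_real_derivative
      (\<Sum>k. 2 * (real (Suc k) powr (- \<alpha>) * sin (real (Suc k) * x)))) (at x)"
  proof (rule has_real_derivative_suminf(2))
    show "summable (\<lambda>k. 2 * real (Suc k) powr (- \<alpha>))"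
      by (intro summable_mult summable_Suc_powr assms)
    show "\<bar>2 * (real (Suc k) powr (- \<alpha>) * sin (real (Suc k) * x))\<bar> \<le> 2 * real (Suc k) powr (- \<alpha>)" for k x
      by (rule dispersion'_term_le)
    have e: "real (Suc k) powr (- (1 + \<alpha>)) * (2 * (y * real (Suc k))) = 2 * (real (Suc k) powr (- \<alpha>) * y)" for k y
    proof -
      have "real (Suc k) powr (- (1 + \<alpha>)) * real (Suc k) = real (Suc k) powr (- (1 + \<alpha>)) * real (Suc k) powr 1"
        by (simp del: of_nat_Suc)
      also have "\<dots> = real (Suc k) powr (- \<alpha>)" unfolding powr_add[symmetric] by simp
      finally show ?thesis by (simp add: mult_ac del: of_nat_Suc)
    qed
    show "((\<lambda>x. real (Suc k) powr (- (1 + \<alpha>)) * (2 * (1 - cos (real (Suc k) * x)))) has_real_derivative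
        2 * (real (Suc k) powr (- \<alpha>) * sin (real (Suc k) * x))) (at x)" for k x
      unfolding e[symmetric] by (auto intro!: derivative_eq_intros simp del: of_nat_Suc)
  qed simp
  thus ?thesis by (simp add: dispersion_def[abs_def] dispersion'_def)
qed

text \<open>For fixed points and weights concavity is the nonnegativity of one series, so
  \<open>suminf_powr_nonneg_if_abel_nonneg\<close> transfers it from Abel means. Using the exponent
  s = \<alpha> - 1 instead of \<alpha> leaves a factor 1/(k+1), which matches the series in
  \<open>abel_sine_series_concave\<close>.\<close>

lemma dispersion'_concave:
  assumes \<alpha>: "1 < \<alpha>"
  shows "concave_on {0..pi} (\<lambda>x. dispersion' \<alpha> x - (1 - 2 powr (1 - \<alpha>)) / 4 * sin x)"
proof (rule concave_on_linorderI)
  fix t u v :: real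
  assume t: "0 < t" "t < 1" and u: "u \<in> {0..pi}" and v: "v \<in> {0..pi}"
  define x where "x = (1 - t) * u + t * v"
  define d where "d = (\<lambda>k. sin (real (Suc k) * x) - (1 - t) * sin (real (Suc k) * u) - t * sin (real (Suc k) * v))"
  define s where "s = \<alpha> - 1"
  have s: "0 < s" using \<alpha> by (simp add: s_def)
  \<comment> \<open>The two exceptional terms encode the sine correction: powers of r turn them into
    -(r - r^2) d(0)/4, and the weights n^(-s) into -(1 - 2^(-s)) d(0)/4.\<close>
  define e where "e = (\<lambda>k. 2 * d k / real (Suc k) - (if k = 0 then d 0 / 4 else 0) + (if k = 1 then d 0 / 4 else 0))"
  have d_le: "\<bar>d k\<bar> \<le> 2" for k
  proof -
    have "\<bar>d k\<bar> \<le> \<bar>sin (real (Suc k) * x)\<bar> + \<bar>(1 - t) * sin (real (Suc k) * u)\<bar> + \<bar>t * sin (real (Suc k) * v)\<bar>"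
      unfolding d_def by (smt (verit))
    also have "\<dots> \<le> 1 + (1 - t) * 1 + t * 1"
      using t unfolding abs_mult by (intro add_mono mult_mono abs_sin_le_one) auto
    finally show ?thesis by simp
  qed
  have sd: "summable (\<lambda>k. a k * d k)" if "summable (\<lambda>k. \<bar>a k\<bar>)" for a :: "nat \<Rightarrow> real"
  proof (rule summable_comparison_test'[where N = 0])
    show "summable (\<lambda>k. \<bar>a k\<bar> * 2)" by (rule summable_mult2[OF that])
    show "norm (a k * d k) \<le> \<bar>a k\<bar> * 2" for k
      using mult_left_mono[OF d_le[of k], of "\<bar>a k\<bar>"] by (simp add: abs_mult)
  qed
  have split: "(\<lambda>k. a k * e k) sums ((\<Sum>k. a k * (2 / real (Suc k)) * d k) - (a 0 - a 1) * d 0 / 4)"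
    if "summable (\<lambda>k. \<bar>a k\<bar> / real (Suc k))" for a :: "nat \<Rightarrow> real"
  proof -
    have "summable (\<lambda>k. \<bar>a k * (2 / real (Suc k))\<bar>)"
      using summable_mult[OF that, of 2] by (simp add: abs_mult abs_divide mult_ac del: of_nat_Suc)
    from summable_sums[OF sd[OF this]]
    have 1: "(\<lambda>k. a k * (2 / real (Suc k)) * d k) sums (\<Sum>k. a k * (2 / real (Suc k)) * d k)" .
    have 2: "(\<lambda>k. if k = 0 then a k * d 0 / 4 else 0) sums (a 0 * d 0 / 4)"
      "(\<lambda>k. if k = 1 then a k * d 0 / 4 else 0) sums (a 1 * d 0 / 4)"
      by (rule sums_single)+
    have "(\<lambda>k. a k * (2 / real (Suc k)) * d k - (if k = 0 then a k * d 0 / 4 else 0) + (if k = 1 then a k * d 0 / 4 else 0))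
      sums ((\<Sum>k. a k * (2 / real (Suc k)) * d k) - a 0 * d 0 / 4 + a 1 * d 0 / 4)"
      by (intro sums_add sums_diff 1 2)
    moreover have "a k * (2 / real (Suc k)) * d k - (if k = 0 then a k * d 0 / 4 else 0) + (if k = 1 then a k * d 0 / 4 else 0)
        = a k * e k" for k
      by (simp add: e_def algebra_simps)
    ultimately show ?thesis by (simp add: algebra_simps diff_divide_distrib)
  qed
  have "0 \<le> (\<Sum>k. real (Suc k) powr (- s) * e k)"
  proof (rule suminf_powr_nonneg_if_abel_nonneg[OF s, where B = 5])
    show e_le: "\<bar>e k\<bar> \<le> 5" for k
    proof -
      have "\<bar>2 * d k\<bar> / real (Suc k) \<le> 4 / 1" using d_le[of k] by (intro frac_le) auto
      thus ?thesis using d_le[of 0] unfolding e_def abs_divide[symmetric]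
        by (auto simp: abs_divide split: if_split) 
    qed
    show "summable (\<lambda>k. real (Suc k) powr (- s) * \<bar>e k\<bar>)"
    proof (rule summable_comparison_test'[where N = 2])
      show "summable (\<lambda>k. 4 * real (Suc k) powr (- \<alpha>))" by (intro summable_mult summable_Suc_powr \<alpha>)
      fix k :: nat assume k: "2 \<le> k"
      have "\<bar>e k\<bar> \<le> 4 / real (Suc k)"
        using k d_le[of k] by (simp add: e_def abs_divide divide_right_mono)
      hence "real (Suc k) powr (- s) * \<bar>e k\<bar> \<le> real (Suc k) powr (- s) * (4 / real (Suc k))"
        by (intro mult_left_mono) auto
      also have "real (Suc k) powr (- s) / real (Suc k) = real (Suc k) powr (- \<alpha>)"
        using powr_diff[of "real (Suc k)" "- s" 1] by (simp add: s_def del: of_nat_Suc)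
      hence "real (Suc k) powr (- s) * (4 / real (Suc k)) = 4 * real (Suc k) powr (- \<alpha>)"
        by (simp add: field_simps del: of_nat_Suc)
      finally show "norm (real (Suc k) powr (- s) * \<bar>e k\<bar>) \<le> 4 * real (Suc k) powr (- \<alpha>)" by (simp add: abs_mult)
    qed
    fix r :: real assume r: "0 < r" "r < 1"
    let ?th = "\<lambda>x. \<Sum>k. 2 * r ^ Suc k * sin (real (Suc k) * x) / real (Suc k)"
    have sth: "summable (\<lambda>k. 2 * r ^ Suc k * sin (real (Suc k) * x) / real (Suc k))" for x
      by (rule poisson_antiderivatives(3)) (use r in auto)
    have "summable (\<lambda>k. \<bar>r ^ Suc k\<bar> / real (Suc k))"
    proof (rule summable_comparison_test'[where N = 0])
      show "summable (\<lambda>k. r ^ Suc k)" using r by (simp add: summable_mult)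
      show "norm (\<bar>r ^ Suc k\<bar> / real (Suc k)) \<le> r ^ Suc k" for k
        using frac_le[of "r ^ Suc k" "r ^ Suc k" 1 "real (Suc k)"] r by (simp del: power_Suc)
    qed
    from split[OF this]
    have "(\<Sum>k. r ^ Suc k * e k) = (\<Sum>k. r ^ Suc k * (2 / real (Suc k)) * d k) - (r - r\<^sup>2) * d 0 / 4"
      by (simp add: sums_iff power2_eq_square)
    also have "(\<Sum>k. r ^ Suc k * (2 / real (Suc k)) * d k) = ?th x - (1 - t) * ?th u - t * ?th v"
    proof -
      have "(\<lambda>k. 2 * r ^ Suc k * sin (real (Suc k) * x) / real (Suc k)
          - (1 - t) * (2 * r ^ Suc k * sin (real (Suc k) * u) / real (Suc k))
          - t * (2 * r ^ Suc k * sin (real (Suc k) * v) / real (Suc k))) sums (?th x - (1 - t) * ?th u - t * ?th v)"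
        by (intro sums_diff sums_mult summable_sums sth)
      moreover have "2 * r ^ Suc k * sin (real (Suc k) * x) / real (Suc k)
          - (1 - t) * (2 * r ^ Suc k * sin (real (Suc k) * u) / real (Suc k))
          - t * (2 * r ^ Suc k * sin (real (Suc k) * v) / real (Suc k)) = r ^ Suc k * (2 / real (Suc k)) * d k" for k
        by (simp add: d_def divide_simps del: of_nat_Suc power_Suc) (simp add: algebra_simps del: of_nat_Suc power_Suc)
      ultimately show ?thesis by (simp only: sums_iff)
    qed
    finally have eq: "(\<Sum>k. r ^ Suc k * e k) = ?th x - (1 - t) * ?th u - t * ?th v - (r - r\<^sup>2) * d 0 / 4" .
    have "(1 - t) * (?th u - (r - r\<^sup>2) / 4 * sin u) + t * (?th v - (r - r\<^sup>2) / 4 * sin v) \<le> ?th x - (r - r\<^sup>2) / 4 * sin x"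
      using concave_onD[OF abel_sine_series_concave[OF r], of t u v] t u v by (simp add: x_def)
    moreover have "(r - r\<^sup>2) * d 0 / 4 = (r - r\<^sup>2) / 4 * sin x - (1 - t) * ((r - r\<^sup>2) / 4 * sin u) - t * ((r - r\<^sup>2) / 4 * sin v)"
      by (simp add: d_def field_simps)
    ultimately show "0 \<le> (\<Sum>k. r ^ Suc k * e k)" unfolding eq by (simp only: right_diff_distrib)
  qed
  moreover have "summable (\<lambda>k. \<bar>real (Suc k) powr (- s)\<bar> / real (Suc k))"
  proof -
    have "\<bar>real (Suc k) powr (- s)\<bar> / real (Suc k) = real (Suc k) powr (- \<alpha>)" for k
      using powr_diff[of "real (Suc k)" "- s" 1] by (simp add: s_def del: of_nat_Suc)
    thus ?thesis using summable_Suc_powr[OF \<alpha>] by simp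
  qed
  note sums_unique[OF split[OF this]]
  moreover have "(\<Sum>k. real (Suc k) powr (- s) * (2 / real (Suc k)) * d k)
      = dispersion' \<alpha> x - (1 - t) * dispersion' \<alpha> u - t * dispersion' \<alpha> v"
  proof -
    have "(\<lambda>k. 2 * (real (Suc k) powr (- \<alpha>) * sin (real (Suc k) * x))
        - (1 - t) * (2 * (real (Suc k) powr (- \<alpha>) * sin (real (Suc k) * u)))
        - t * (2 * (real (Suc k) powr (- \<alpha>) * sin (real (Suc k) * v))))
        sums (dispersion' \<alpha> x - (1 - t) * dispersion' \<alpha> u - t * dispersion' \<alpha> v)"
      unfolding dispersion'_def by (intro sums_diff sums_mult summable_sums summable_dispersion' \<alpha>)
    moreover have "2 * (real (Suc k) powr (- \<alpha>) * sin (real (Suc k) * x))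
        - (1 - t) * (2 * (real (Suc k) powr (- \<alpha>) * sin (real (Suc k) * u)))
        - t * (2 * (real (Suc k) powr (- \<alpha>) * sin (real (Suc k) * v)))
        = real (Suc k) powr (- s) * (2 / real (Suc k)) * d k" for k
    proof -
      have "real (Suc k) powr (- s) * (2 / real (Suc k)) = 2 * real (Suc k) powr (- \<alpha>)"
        using powr_diff[of "real (Suc k)" "- s" 1] by (simp add: s_def del: of_nat_Suc)
      thus ?thesis by (simp add: d_def algebra_simps del: of_nat_Suc)
    qed
    ultimately show ?thesis by (simp only: sums_iff)
  qed
  ultimately have "0 \<le> dispersion' \<alpha> x - (1 - t) * dispersion' \<alpha> u - t * dispersion' \<alpha> v - (1 - 2 powr (- s)) * d 0 / 4"
    by simp
  moreover have "(1 - 2 powr (- s)) * d 0 / 4 = (1 - 2 powr (1 - \<alpha>)) / 4 * sin x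
      - (1 - t) * ((1 - 2 powr (1 - \<alpha>)) / 4 * sin u) - t * ((1 - 2 powr (1 - \<alpha>)) / 4 * sin v)"
    by (simp add: d_def s_def field_simps)
  ultimately show "(1 - t) * (dispersion' \<alpha> u - (1 - 2 powr (1 - \<alpha>)) / 4 * sin u) + t * (dispersion' \<alpha> v - (1 - 2 powr (1 - \<alpha>)) / 4 * sin v)
      \<le> dispersion' \<alpha> ((1 - t) *\<^sub>R u + t *\<^sub>R v) - (1 - 2 powr (1 - \<alpha>)) / 4 * sin ((1 - t) *\<^sub>R u + t *\<^sub>R v)"
    by (simp only: right_diff_distrib real_scaleR_def x_def[symmetric])
qed simp

lemma sin_concave: "concave_on {0..pi} sin"
proof (rule f''_le0_imp_concave)
  show "(sin has_real_derivative cos x) (at x)" for x :: real by (rule DERIV_sin)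
  show "(cos has_real_derivative - sin x) (at x)" for x :: real by (rule DERIV_cos)
  show "- sin x \<le> 0" if "x \<in> {0..pi}" for x using that sin_ge_zero[of x] by auto
qed simp

text \<open>Concavity of f lets the interval from u to v slide to the right until it ends at \<xi>,
  where the increment is smallest. There maximality at the midpoint, combined with the surplus
  concavity c sin, bounds the increment from below by a multiple of 1 - cos(e/2), hence of e^2. No
  vanishing derivative at \<xi> is invoked.\<close>

lemma concave_growth_below_max:
  fixes f :: "real \<Rightarrow> real"
  assumes c: "0 < c" and \<xi>: "0 < \<xi>" "\<xi> < pi"
    and conc: "concave_on {0..pi} (\<lambda>x. f x - c * sin x)"
    and max: "\<And>x. x \<in> {0..pi} \<Longrightarrow> f x \<le> f \<xi>"
  shows "\<exists>k>0. \<forall>u v. 0 \<le> u \<longrightarrow> u \<le> v \<longrightarrow> v \<le> \<xi> \<longrightarrow> k * (v - u) ^ 2 \<le> f v - f u"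
proof -
  have "concave_on {0..pi} (\<lambda>x. (f x - c * sin x) + c * sin x)"
    by (intro concave_on_add conc concave_on_cmul sin_concave) (use c in simp)
  hence fconc: "concave_on {0..pi} f" by simp
  \<comment> \<open>A lower bound for the sine on [\<xi>/2, \<xi>], where the midpoint m lies
    because e \<le> \<xi>.\<close>
  define s0 where "s0 = min (sin (\<xi> / 2)) (sin \<xi>)"
  have s0: "0 < s0" using \<xi> by (auto simp: s0_def intro!: sin_gt_zero)
  define k where "k = c * s0 / pi\<^sup>2"
  have "k * (v - u) ^ 2 \<le> f v - f u" if uv: "0 \<le> u" "u \<le> v" "v \<le> \<xi>" for u v
  proof (cases "u = v")
    case False
    define e where "e = v - u"
    have e: "0 < e" "e \<le> \<xi> - u" "u < \<xi>" using uv False by (auto simp: e_def)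
    define t where "t = e / (\<xi> - u)"
    have t: "0 \<le> t" "t \<le> 1" "t * (\<xi> - u) = e" using e by (auto simp: t_def)
    have v: "(1 - t) * u + t * \<xi> = v" and w: "(1 - (1 - t)) * u + (1 - t) * \<xi> = \<xi> - e"
      using t(3) by (auto simp: e_def algebra_simps)
    have "(1 - t) * f u + t * f \<xi> \<le> f v"
      using concave_onD[OF fconc, of t u \<xi>] t(1,2) uv \<xi> e(3) by (simp add: v)
    moreover have "(1 - (1 - t)) * f u + (1 - t) * f \<xi> \<le> f (\<xi> - e)"
      using concave_onD[OF fconc, of "1 - t" u \<xi>, unfolded real_scaleR_def w] t(1,2) uv \<xi> e(3) by auto
    moreover have "(1 - t) * f u + t * f \<xi> + ((1 - (1 - t)) * f u + (1 - t) * f \<xi>) = f u + f \<xi>"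
      by (simp add: algebra_simps)
    ultimately have push: "f \<xi> - f (\<xi> - e) \<le> f v - f u" by linarith
    define m where "m = \<xi> - e / 2"
    have e_le: "e \<le> \<xi>" using e uv by linarith
    have m: "m \<in> {0..pi}" "\<xi> / 2 \<le> m" "m \<le> \<xi>" using e e_le \<xi> by (auto simp: m_def)
    have mid: "(1 - 1 / 2) * (\<xi> - e) + 1 / 2 * \<xi> = m" by (simp add: m_def field_simps)
    have "(1 - 1 / 2) * (f (\<xi> - e) - c * sin (\<xi> - e)) + 1 / 2 * (f \<xi> - c * sin \<xi>) \<le> f m - c * sin m"
      using concave_onD[OF conc, of "1 / 2" "\<xi> - e" \<xi>] e e_le \<xi> by (simp add: mid[simplified])
    moreover have "f m \<le> f \<xi>" by (rule max[OF m(1)])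
    moreover have "sin \<xi> + sin (\<xi> - e) = 2 * sin m * cos (e / 2)"
      unfolding sin_plus_sin m_def by (simp add: field_simps)
    hence "c * sin \<xi> + c * sin (\<xi> - e) = c * (2 * sin m * cos (e / 2))"
      by (simp only: distrib_left[symmetric])
    moreover have "2 * (c * sin m * (1 - cos (e / 2))) = 2 * (c * sin m) - c * (2 * sin m * cos (e / 2))"
      by (simp add: algebra_simps)
    ultimately have step: "2 * (c * sin m * (1 - cos (e / 2))) \<le> f \<xi> - f (\<xi> - e)" by argo
    have "s0 \<le> sin m"
    proof -
      define r where "r = (m - \<xi> / 2) / (\<xi> / 2)"
      have r: "0 \<le> r" "r \<le> 1" using m \<xi> by (auto simp: r_def field_simps)
      have "(1 - r) * (\<xi> / 2) + r * \<xi> = \<xi> / 2 + r * (\<xi> / 2)" by (simp add: field_simps)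
      moreover have "r * (\<xi> / 2) = m - \<xi> / 2" using \<xi> by (simp add: r_def)
      ultimately have rm: "(1 - r) * (\<xi> / 2) + r * \<xi> = m" by linarith
      have "s0 = (1 - r) * s0 + r * s0" by (simp add: algebra_simps)
      also have "\<dots> \<le> (1 - r) * sin (\<xi> / 2) + r * sin \<xi>"
        using r by (intro add_mono mult_left_mono) (auto simp: s0_def)
      also have "\<dots> \<le> sin m"
        using concave_onD[OF sin_concave, of r "\<xi> / 2" \<xi>] r \<xi> rm by simp
      finally show ?thesis .
    qed
    moreover have "e\<^sup>2 / (2 * pi\<^sup>2) \<le> 1 - cos (e / 2)"
    proof -
      have "(1 - e / (2 * pi)) * sin 0 + e / (2 * pi) * sin (pi / 2) \<le> sin ((1 - e / (2 * pi)) * 0 + e / (2 * pi) * (pi / 2))"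
        using concave_onD[OF sin_concave, of "e / (2 * pi)" 0 "pi / 2"] e e_le \<xi> by simp
      hence "e / (2 * pi) \<le> sin (e / 4)" by simp
      hence "(e / (2 * pi))\<^sup>2 \<le> (sin (e / 4))\<^sup>2" using e by (intro power_mono) auto
      moreover have "cos (e / 2) = 1 - 2 * (sin (e / 4))\<^sup>2"
        using cos_double_sin[of "e / 4"] by simp
      ultimately show ?thesis by (simp add: power_divide power_mult_distrib)
    qed
    ultimately have "s0 * (e\<^sup>2 / (2 * pi\<^sup>2)) \<le> sin m * (1 - cos (e / 2))"
      using s0 by (intro mult_mono) auto
    from mult_left_mono[OF this, of "2 * c"] c
    have "k * e ^ 2 \<le> 2 * (c * sin m * (1 - cos (e / 2)))" by (simp add: k_def mult_ac)
    thus ?thesis using step push by (simp add: e_def)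
  qed simp
  moreover have "0 < k" using c s0 by (simp add: k_def)
  ultimately show ?thesis by blast
qed

lemma dispersion'_continuous:
  assumes "1 < \<alpha>"
  shows "continuous_on S (dispersion' \<alpha>)"
  unfolding dispersion'_def[abs_def]
  by (rule continuous_on_suminf_real[OF _ dispersion'_term_le])
    (intro continuous_intros summable_mult summable_Suc_powr assms)+

lemma dispersion'_reflect: "dispersion' \<alpha> (2 * pi - x) = - dispersion' \<alpha> x" if "1 < \<alpha>"
proof -
  have "sin (real (Suc k) * (2 * pi - x)) = - sin (real (Suc k) * x)" for k
  proof -
    have "real (Suc k) * (2 * pi - x) = 2 * real (Suc k) * pi - real (Suc k) * x"
      by (simp only: right_diff_distrib mult_ac)
    thus ?thesis by (simp only: sin_diff cos_2npi sin_2npi mult_1 mult_zero_left diff_0)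
  qed
  thus ?thesis
    unfolding dispersion'_def suminf_minus[OF summable_dispersion'[OF that], symmetric] by simp
qed

text \<open>\<xi> is a maximum point on [0, pi]. It is interior because the function vanishes at
  both ends and is at least c > 0 at pi/2. The decreasing branch follows from the increasing one by
  x -> pi - x, which preserves the sine correction.\<close>

lemma dispersion'_growth:
  assumes \<alpha>: "1 < \<alpha>"
  shows "\<exists>k>0. \<exists>\<xi>. 0 < \<xi> \<and> \<xi> < pi \<and>
    (\<forall>u v. 0 \<le> u \<longrightarrow> u \<le> v \<longrightarrow> v \<le> \<xi> \<longrightarrow> k * (v - u) ^ 2 \<le> dispersion' \<alpha> v - dispersion' \<alpha> u) \<and>
    (\<forall>u v. \<xi> \<le> u \<longrightarrow> u \<le> v \<longrightarrow> v \<le> pi \<longrightarrow> k * (v - u) ^ 2 \<le> dispersion' \<alpha> u - dispersion' \<alpha> v)"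
proof -
  let ?f = "dispersion' \<alpha>"
  define c where "c = (1 - 2 powr (1 - \<alpha>)) / 4"
  have c: "0 < c" using powr_less_mono[of "1 - \<alpha>" 0 2] \<alpha> by (simp add: c_def)
  have conc: "concave_on {0..pi} (\<lambda>x. ?f x - c * sin x)"
    unfolding c_def by (rule dispersion'_concave[OF \<alpha>])
  have f0: "?f 0 = 0" by (simp add: dispersion'_def)
  have fpi: "?f pi = 0" using sin_npi[of "Suc k" for k] by (simp add: dispersion'_def del: of_nat_Suc)
  obtain \<xi> where \<xi>: "\<xi> \<in> {0..pi}" and max: "\<And>x. x \<in> {0..pi} \<Longrightarrow> ?f x \<le> ?f \<xi>"
    using continuous_attains_sup[OF _ _ dispersion'_continuous[OF \<alpha>], of "{0..pi}"] by auto
  have "0 \<le> ?f (pi / 2) - c * sin (pi / 2)"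
    using concave_onD[OF conc, of "1 / 2" 0 pi] f0 fpi by simp
  hence "0 < ?f \<xi>" using max[of "pi / 2"] c by simp
  hence "\<xi> \<noteq> 0" "\<xi> \<noteq> pi" using f0 fpi by auto
  hence \<xi>': "0 < \<xi>" "\<xi> < pi" using \<xi> by auto
  obtain k1 where k1: "0 < k1" "\<And>u v. 0 \<le> u \<Longrightarrow> u \<le> v \<Longrightarrow> v \<le> \<xi> \<Longrightarrow> k1 * (v - u) ^ 2 \<le> ?f v - ?f u"
    using concave_growth_below_max[OF c \<xi>' conc max] by blast
  have "concave_on {0..pi} (\<lambda>x. ?f (pi - x) - c * sin x)"
  proof (rule concave_on_linorderI)
    fix t x y :: real assume *: "0 < t" "t < 1" "x \<in> {0..pi}" "y \<in> {0..pi}"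
    have "pi - ((1 - t) *\<^sub>R x + t *\<^sub>R y) = (1 - t) *\<^sub>R (pi - x) + t *\<^sub>R (pi - y)"
      by (simp add: algebra_simps)
    moreover have "(1 - t) * (?f (pi - x) - c * sin (pi - x)) + t * (?f (pi - y) - c * sin (pi - y))
        \<le> ?f ((1 - t) *\<^sub>R (pi - x) + t *\<^sub>R (pi - y)) - c * sin ((1 - t) *\<^sub>R (pi - x) + t *\<^sub>R (pi - y))"
      by (rule concave_onD[OF conc]) (use * in auto)
    moreover have "sin (pi - z) = sin z" for z :: real by simp
    ultimately show "(1 - t) * (?f (pi - x) - c * sin x) + t * (?f (pi - y) - c * sin y)
        \<le> ?f (pi - ((1 - t) *\<^sub>R x + t *\<^sub>R y)) - c * sin ((1 - t) *\<^sub>R x + t *\<^sub>R y)"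
      by metis
  qed simp
  hence "\<exists>k>0. \<forall>u v. 0 \<le> u \<longrightarrow> u \<le> v \<longrightarrow> v \<le> pi - \<xi> \<longrightarrow> k * (v - u) ^ 2 \<le> ?f (pi - v) - ?f (pi - u)"
    by (rule concave_growth_below_max[OF c, rotated 2]) (use \<xi>' max in auto)
  then obtain k2 where k2: "0 < k2"
    "\<And>u v. 0 \<le> u \<Longrightarrow> u \<le> v \<Longrightarrow> v \<le> pi - \<xi> \<Longrightarrow> k2 * (v - u) ^ 2 \<le> ?f (pi - v) - ?f (pi - u)"
    by blast
  define k where "k = min k1 k2"
  have "0 < k" using k1 k2 by (simp add: k_def)
  moreover have "k * (v - u) ^ 2 \<le> ?f v - ?f u" if "0 \<le> u" "u \<le> v" "v \<le> \<xi>" for u v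
    using mult_right_mono[of k k1 "(v - u)\<^sup>2"] k1(2)[OF that] by (simp add: k_def)
  moreover have "k * (v - u) ^ 2 \<le> ?f u - ?f v" if "\<xi> \<le> u" "u \<le> v" "v \<le> pi" for u v
    using mult_right_mono[of k k2 "(v - u)\<^sup>2"] k2(2)[of "pi - v" "pi - u"] that
    by (simp add: k_def power2_commute)
  ultimately show ?thesis using \<xi>' by blast
qed

text \<open>The circle is cut at \<xi>, pi and 2 pi - \<xi> into four pieces on which the derivative
  of the phase is monotone with quadratic growth. Quadratic growth corresponds to m = 2 in
  \<open>oscillatory_integral_bound\<close>, hence the exponent 1/3.\<close>

lemma dispersive_integral_alpha_gt_1:
  assumes \<alpha>: "1 < \<alpha>"
  shows "\<exists>C\<ge>0. \<forall>t>0. \<forall>\<nu>. cmod (integral {0..2 * pi} (\<lambda>x. cis (t * dispersion \<alpha> x - \<nu> * x))) \<le> C * t powr (- 1 / 3)"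
proof -
  let ?f = "dispersion' \<alpha>"
  obtain k \<xi> where k: "0 < k" and \<xi>: "0 < \<xi>" "\<xi> < pi"
    and inc: "\<And>u v. 0 \<le> u \<Longrightarrow> u \<le> v \<Longrightarrow> v \<le> \<xi> \<Longrightarrow> k * (v - u) ^ 2 \<le> ?f v - ?f u"
    and dec: "\<And>u v. \<xi> \<le> u \<Longrightarrow> u \<le> v \<Longrightarrow> v \<le> pi \<Longrightarrow> k * (v - u) ^ 2 \<le> ?f u - ?f v"
    using dispersion'_growth[OF \<alpha>] by blast
  have inc': "k * (v - u) ^ 2 \<le> ?f v - ?f u" if "2 * pi - \<xi> \<le> u" "u \<le> v" "v \<le> 2 * pi" for u v
    using inc[of "2 * pi - v" "2 * pi - u", unfolded dispersion'_reflect[OF \<alpha>]] that by simp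
  have dec': "k * (v - u) ^ 2 \<le> ?f u - ?f v" if "pi \<le> u" "u \<le> v" "v \<le> 2 * pi - \<xi>" for u v
    using dec[of "2 * pi - v" "2 * pi - u", unfolded dispersion'_reflect[OF \<alpha>]] that by simp
  have w: "(dispersion \<alpha> has_real_derivative ?f x) (at x within S)" for x S
    by (rule has_field_derivative_at_within[OF dispersion_deriv[OF \<alpha>]])
  have cont: "continuous_on S (dispersion \<alpha>)" for S
    using DERIV_continuous_on[OF w] by blast
  define C where "C = 4 + 16 / k"
  have "cmod (integral {0..2 * pi} (\<lambda>x. cis (t * dispersion \<alpha> x - \<nu> * x))) \<le> (4 * C) * t powr (- 1 / 3)"
    if t: "0 < t" for t \<nu>
  proof -
    define I where "I = (\<lambda>a b. integral {a..b} (\<lambda>x. cis (t * dispersion \<alpha> x - \<nu> * x)))"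
    have int: "(\<lambda>x. cis (t * dispersion \<alpha> x - \<nu> * x)) integrable_on {a..b}" for a b
      by (intro integrable_continuous_interval continuous_on_cis continuous_intros cont)
    have piece: "cmod (I a b) \<le> C * t powr (- 1 / 3)"
      if "a \<le> b" "(\<forall>u v. a \<le> u \<longrightarrow> u \<le> v \<longrightarrow> v \<le> b \<longrightarrow> k * (v - u) ^ 2 \<le> ?f v - ?f u) \<or>
        (\<forall>u v. a \<le> u \<longrightarrow> u \<le> v \<longrightarrow> v \<le> b \<longrightarrow> k * (v - u) ^ 2 \<le> ?f u - ?f v)" for a b
      using oscillatory_integral_bound[OF that(1) t k _ w that(2), of \<nu>] by (simp add: I_def C_def)
    have "I 0 (2 * pi) = I 0 \<xi> + I \<xi> pi + I pi (2 * pi - \<xi>) + I (2 * pi - \<xi>) (2 * pi)"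
      using \<xi> unfolding I_def by (simp add: Henstock_Kurzweil_Integration.integral_combine[OF _ _ int])
    moreover have "cmod (I 0 \<xi>) \<le> C * t powr (- 1 / 3)"
      by (rule piece) (use inc \<xi> in auto)
    moreover have "cmod (I \<xi> pi) \<le> C * t powr (- 1 / 3)"
      by (rule piece) (use dec \<xi> in auto)
    moreover have "cmod (I pi (2 * pi - \<xi>)) \<le> C * t powr (- 1 / 3)"
      by (rule piece) (use dec' \<xi> in auto)
    moreover have "cmod (I (2 * pi - \<xi>) (2 * pi)) \<le> C * t powr (- 1 / 3)"
      by (rule piece) (use inc' \<xi> in auto)
    ultimately have "cmod (I 0 (2 * pi)) \<le> 4 * (C * t powr (- 1 / 3))"
      by (smt (verit) norm_triangle_ineq)
    thus ?thesis by (simp add: I_def)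
  qed
  moreover have "0 \<le> 4 * C" using k by (simp add: C_def)
  ultimately show ?thesis by blast
qed

section \<open>The real inner product on square-summable families\<close>

instantiation ell2 :: (type) real_inner
begin

text \<open>The real part of the Hermitian product. This real structure suffices for energy
  identities and duality; the complex structure enters through skewness of multiplication by
  i.\<close>

definition inner_ell2 :: "'a ell2 \<Rightarrow> 'a ell2 \<Rightarrow> real" where
  "inner_ell2 u v = (\<Sum>\<^sub>\<infinity>x. Re (cnj (coord u x) * coord v x))"

lemma ell2_inner_summable: "(\<lambda>x. Re (cnj (coord u x) * coord v x)) summable_on UNIV"
proof -
  have sq: "(\<lambda>x. (cmod (coord w x))\<^sup>2) summable_on UNIV" for w :: "'b ell2"
    using coord[of w] by (simp add: square_summable_def)
  have "(\<lambda>x. (cmod (coord u x))\<^sup>2 + (cmod (coord v x))\<^sup>2) summable_on UNIV"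
    by (intro summable_on_add sq)
  hence "(\<lambda>x. norm (Re (cnj (coord u x) * coord v x))) summable_on UNIV"
  proof (rule Infinite_Sum.abs_summable_on_comparison_test')
    fix x
    have "\<bar>Re (cnj (coord u x) * coord v x)\<bar> \<le> cmod (coord u x) * cmod (coord v x)"
      using abs_Re_le_cmod[of "cnj (coord u x) * coord v x"] by (simp add: norm_mult)
    also have "\<dots> \<le> (cmod (coord u x))\<^sup>2 + (cmod (coord v x))\<^sup>2"
    proof -
      have "0 \<le> cmod (coord u x) * cmod (coord v x)" by simp
      thus ?thesis using sum_squares_bound[of "cmod (coord u x)" "cmod (coord v x)"] by linarith
    qed
    finally show "norm (Re (cnj (coord u x) * coord v x)) \<le> (cmod (coord u x))\<^sup>2 + (cmod (coord v x))\<^sup>2"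
      by simp
  qed
  thus ?thesis by (rule abs_summable_summable)
qed

lemma norm_ell2_inner: "norm (u :: 'a ell2) = sqrt (u \<bullet> u)"
proof -
  have "Re (cnj z * z) = (cmod z)\<^sup>2" for z by (simp add: cmod_power2) (simp add: power2_eq_square)
  thus ?thesis by (simp only: norm_ell2.rep_eq inner_ell2_def)
qed

instance
proof
  fix u v w :: "'a ell2" and r :: real
  show "u \<bullet> v = v \<bullet> u" by (simp add: inner_ell2_def mult_ac)
  show "(u + v) \<bullet> w = u \<bullet> w + v \<bullet> w"
  proof -
    have "Re (cnj (coord (u + v) x) * coord w x)
        = Re (cnj (coord u x) * coord w x) + Re (cnj (coord v x) * coord w x)" for x
      by (simp add: algebra_simps)
    thus ?thesis
      unfolding inner_ell2_def by (simp only: infsum_add[OF ell2_inner_summable ell2_inner_summable])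
  qed
  show "(r *\<^sub>R u) \<bullet> v = r * (u \<bullet> v)"
    unfolding inner_ell2_def by (subst infsum_cmult_right'[symmetric]) (simp add: algebra_simps)
  show "0 \<le> u \<bullet> u"
    unfolding inner_ell2_def by (rule infsum_nonneg) simp
  show *: "norm u = sqrt (u \<bullet> u)" by (rule norm_ell2_inner)
  show "u \<bullet> u = 0 \<longleftrightarrow> u = 0"
    using norm_eq_zero[of u] unfolding * by simp
qed

end

lemma bounded_linear_scaleC: "bounded_linear (\<lambda>u. c *\<^sub>C u)"
proof (rule bounded_linear_intro[where K = "cmod c"])
  show "c *\<^sub>C (u + v) = c *\<^sub>C u + c *\<^sub>C v" "c *\<^sub>C (r *\<^sub>R u) = r *\<^sub>R (c *\<^sub>C u)" for u v :: "'a ell2" and r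
    by (auto intro!: ell2_eqI simp: algebra_simps)
  show "norm (c *\<^sub>C u) \<le> norm u * cmod c" for u :: "'a ell2" by (simp add: norm_scaleC)
qed

lemmas scaleC_diff_right = linear_diff[OF bounded_linear.linear[OF bounded_linear_scaleC]]

lemma scaleC_scaleC: "a *\<^sub>C b *\<^sub>C u = (a * b) *\<^sub>C u"
  by (auto intro!: ell2_eqI)

lemma scaleC_of_real: "of_real r *\<^sub>C u = r *\<^sub>R u"
  by (auto intro!: ell2_eqI simp: scaleR_conv_of_real)

lemma inner_scaleC_ii: "u \<bullet> (\<i> *\<^sub>C v) = - ((\<i> *\<^sub>C u) \<bullet> v)"
  unfolding inner_ell2_def infsum_uminus[symmetric] by (simp add: algebra_simps)

lemma inner_scaleC_ii_self [simp]: "u \<bullet> (\<i> *\<^sub>C u) = 0"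
  using inner_scaleC_ii[of u u] by (simp add: inner_commute)

lemma square_summable_dominated:
  assumes "\<And>x. cmod (f x) \<le> c * cmod (coord v x)" "0 \<le> c"
  shows "square_summable f" "norm (Abs_ell2 f) \<le> c * norm v"
proof -
  have L2: "L2_set (\<lambda>x. cmod (f x)) F \<le> c * norm v" if "finite F" for F
  proof -
    have "L2_set (\<lambda>x. cmod (f x)) F \<le> L2_set (\<lambda>x. c * cmod (coord v x)) F"
      by (intro L2_set_mono assms) auto
    also have "\<dots> = c * L2_set (\<lambda>x. cmod (coord v x)) F" using assms by (simp add: L2_set_right_distrib)
    also have "\<dots> \<le> c * norm v" using assms by (intro mult_left_mono L2_set_coord_le that)
    finally show ?thesis .
  qed
  show s: "square_summable f" by (rule square_summableI(1)[OF L2])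
  show "norm (Abs_ell2 f) \<le> c * norm v"
    using square_summableI(2)[OF L2] s by (simp add: norm_ell2.rep_eq Abs_ell2_inverse)
qed

lemma ell2_norm_le:
  assumes "\<And>x. cmod (coord u x) \<le> c * cmod (coord v x)" "0 \<le> c"
  shows "norm u \<le> c * norm v"
  using square_summable_dominated(2)[OF assms] by (simp add: coord_inverse)

section \<open>Point masses and the supremum norm\<close>

definition single :: "'a \<Rightarrow> complex \<Rightarrow> 'a ell2" where
  "single n z = Abs_ell2 (\<lambda>m. if m = n then z else 0)"

lemma coord_single: "coord (single n z) m = (if m = n then z else 0)"
proof -
  have "square_summable (\<lambda>m. if m = n then z else 0)"
    unfolding square_summable_def
    by (rule finite_nonzero_values_imp_summable_on) (rule finite_subset[of _ "{n}"], auto)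
  thus ?thesis by (simp add: single_def Abs_ell2_inverse)
qed

lemma inner_single: "single n z \<bullet> u = Re (cnj z * coord u n)"
proof -
  have "single n z \<bullet> u = (\<Sum>\<^sub>\<infinity>x\<in>{n}. Re (cnj (coord (single n z) x) * coord u x))"
    unfolding inner_ell2_def by (rule infsum_cong_neutral) (auto simp: coord_single)
  thus ?thesis by (simp add: coord_single)
qed

definition sup_norm :: "'a ell2 \<Rightarrow> real" where
  "sup_norm u = (SUP n. cmod (coord u n))"

lemma sup_norm_bdd: "bdd_above (range (\<lambda>n. cmod (coord u n)))"
  by (rule bdd_aboveI2[where M = "norm u"]) (rule cmod_coord_le)

lemma cmod_coord_le_sup_norm: "cmod (coord u n) \<le> sup_norm u"
  unfolding sup_norm_def by (rule cSUP_upper[OF _ sup_norm_bdd]) simp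

lemma sup_norm_nonneg: "0 \<le> sup_norm u"
  using cmod_coord_le_sup_norm[of u undefined] norm_ge_zero order_trans by blast

lemma sup_norm_le: "(\<And>n. cmod (coord u n) \<le> B) \<Longrightarrow> sup_norm u \<le> B"
  unfolding sup_norm_def by (rule cSUP_least) auto

lemma sup_norm_le_norm: "sup_norm u \<le> norm u"
  by (rule sup_norm_le) (rule cmod_coord_le)

text \<open>Selecting one site that carries half of the supremum lets point masses test this norm;
  the loss is a factor 2 in constants.\<close>

lemma sup_norm_half_attained: "\<exists>n. sup_norm u \<le> 2 * cmod (coord u n)"
proof (rule ccontr)
  assume *: "\<not> ?thesis"
  hence "2 * cmod (coord u n) < sup_norm u" for n by (simp add: not_le)
  hence lt: "cmod (coord u n) < sup_norm u / 2" for n by (simp add: mult.commute)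
  hence "sup_norm u \<le> sup_norm u / 2" by (intro sup_norm_le less_imp_le)
  thus False using lt[of undefined] norm_ge_zero[of "coord u undefined"] by linarith
qed

lemma sup_norm_diff_le: "\<bar>sup_norm u - sup_norm v\<bar> \<le> norm (u - v)"
proof -
  have "sup_norm u \<le> sup_norm v + norm (u - v)" for u v :: "'a ell2"
  proof (rule sup_norm_le)
    fix n
    have "cmod (coord u n) \<le> cmod (coord v n) + cmod (coord (u - v) n)"
      using norm_triangle_ineq[of "coord v n" "coord (u - v) n"] by simp
    thus "cmod (coord u n) \<le> sup_norm v + norm (u - v)"
      using cmod_coord_le_sup_norm[of v n] cmod_coord_le[of "u - v" n] by linarith
  qed
  from this[of u v] this[of v u] show ?thesis by (simp add: norm_minus_commute)
qed

lemma continuous_on_sup_norm: "continuous_on S sup_norm"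
proof (rule continuous_onI)
  fix u :: "'a ell2" and e :: real assume e: "0 < e"
  have "dist (sup_norm v) (sup_norm u) \<le> e" if "dist v u < e" for v
    using sup_norm_diff_le[of v u] that by (simp add: dist_norm)
  thus "\<exists>d>0. \<forall>v\<in>S. dist v u < d \<longrightarrow> dist (sup_norm v) (sup_norm u) \<le> e"
    using e by blast
qed

lemma inner_shift: "u \<bullet> shift (- k) v = shift k u \<bullet> v"
proof -
  have "bij_betw (\<lambda>n. n - k) UNIV UNIV" by (rule bij_betwI[where g = "\<lambda>n. n + k"]) auto
  from infsum_reindex_bij_betw[OF this, of "\<lambda>n. Re (cnj (coord u n) * coord (shift (- k) v) n)"]
  show ?thesis unfolding inner_ell2_def by (simp add: shift.rep_eq)
qed

section \<open>Linearity and symmetry of L for even summable kernels\<close>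

context
  fixes J :: "int \<Rightarrow> real"
  assumes J: "(\<lambda>k. \<bar>J k\<bar>) summable_on UNIV" and even: "\<And>k. J (- k) = J k"
begin

text \<open>Pairing k with -k writes L as a series of second differences. In this form skewness
  holds term by term, and each term has Fourier symbol 2(1 - cos kx).\<close>

lemma lap_sums:
  "(\<lambda>k. J (int (Suc k)) *\<^sub>R (2 *\<^sub>R u - shift (int (Suc k)) u - shift (- int (Suc k)) u)) sums lap J u"
proof -
  define T where "T = (\<lambda>k. J k *\<^sub>R (u - shift k u))"
  have "(\<lambda>k. norm (T k)) summable_on UNIV"
  proof (rule Infinite_Sum.abs_summable_on_comparison_test')
    show "(\<lambda>k. \<bar>J k\<bar> * (2 * norm u)) summable_on UNIV" by (intro summable_on_cmult_left J)
    show "norm (T k) \<le> \<bar>J k\<bar> * (2 * norm u)" for k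
      unfolding T_def norm_scaleR
      by (intro mult_left_mono order_trans[OF norm_triangle_ineq4]) auto
  qed
  hence sT: "T summable_on UNIV" by (rule abs_summable_summable)
  have lap: "infsum T UNIV = lap J u"
  proof (rule ell2_eqI)
    fix n
    have "((\<lambda>k. coord (T k) n) has_sum coord (infsum T UNIV) n) UNIV"
      by (rule has_sum_bounded_linear[OF bounded_linear_coord has_sum_infsum[OF sT]])
    hence "coord (infsum T UNIV) n = (\<Sum>\<^sub>\<infinity>k. coord (T k) n)" by (simp add: infsumI)
    also have "\<dots> = (\<Sum>\<^sub>\<infinity>k\<in>{k. k \<noteq> 0}. coord (T k) n)"
      by (rule infsum_cong_neutral) (auto simp: T_def shift.rep_eq)
    also have "\<dots> = coord (lap J u) n"
      unfolding coord_lap[OF J]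
      by (rule infsum_reindex_bij_witness[where i = "\<lambda>m. n - m" and j = "\<lambda>k. n - k"])
        (auto simp: T_def shift.rep_eq scaleR_conv_of_real)
    finally show "coord (infsum T UNIV) n = coord (lap J u) n" .
  qed
  let ?p = "\<lambda>k. int (Suc k)" and ?n = "\<lambda>k. - int (Suc k)"
  have inj: "inj ?p" "inj ?n" by (auto simp: inj_def)
  have "(T has_sum infsum T (range ?p)) (range ?p)" "(T has_sum infsum T (range ?n)) (range ?n)"
    by (intro has_sum_infsum summable_on_subset_banach[OF sT]; simp)+
  hence "((\<lambda>k. T (?p k)) has_sum infsum T (range ?p)) UNIV" "((\<lambda>k. T (?n k)) has_sum infsum T (range ?n)) UNIV"
    unfolding has_sum_reindex[OF inj(1)] has_sum_reindex[OF inj(2)] by (simp_all add: o_def)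
  hence "(\<lambda>k. T (?p k) + T (?n k)) sums (infsum T (range ?p) + infsum T (range ?n))"
    by (intro sums_add has_sum_imp_sums)
  moreover have "infsum T (range ?p) + infsum T (range ?n) = infsum T UNIV"
  proof -
    have "infsum T (range ?p) + infsum T (range ?n) = infsum T (range ?p \<union> range ?n)"
      by (intro infsum_Un_disjoint[symmetric] summable_on_subset_banach[OF sT]) auto
    also have "\<dots> = infsum T UNIV"
    proof (rule infsum_cong_neutral)
      fix k assume "k \<in> UNIV - (range ?p \<union> range ?n)"
      hence k: "k \<noteq> int (Suc j)" "k \<noteq> - int (Suc j)" for j by blast+
      have "k = 0"
      proof (rule ccontr)
        assume "k \<noteq> 0"
        hence "k = int (Suc (nat k - 1)) \<or> k = - int (Suc (nat (- k) - 1))" by linarith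
        thus False using k by blast
      qed
      thus "T k = 0" by (auto intro!: ell2_eqI simp: T_def shift.rep_eq)
    qed auto
    finally show ?thesis .
  qed
  moreover have "T (?p k) + T (?n k) = J (?p k) *\<^sub>R (2 *\<^sub>R u - shift (?p k) u - shift (?n k) u)" for k
  proof -
    have "u - a + (u - b) = 2 *\<^sub>R u - a - b" for a b by (simp add: scaleR_2)
    thus ?thesis unfolding T_def even[of "?p k"] by (metis scaleR_add_right)
  qed
  ultimately show ?thesis unfolding lap by simp
qed

lemma lap_scaleC: "lap J (c *\<^sub>C u) = c *\<^sub>C lap J u"
proof (rule sums_unique2[OF lap_sums])
  have "c *\<^sub>C (J k *\<^sub>R (2 *\<^sub>R u - shift k u - shift (- k) u))
      = J k *\<^sub>R (2 *\<^sub>R (c *\<^sub>C u) - shift k (c *\<^sub>C u) - shift (- k) (c *\<^sub>C u))" for k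
    by (auto intro!: ell2_eqI simp: shift.rep_eq algebra_simps)
  thus "(\<lambda>k. J (int (Suc k)) *\<^sub>R (2 *\<^sub>R (c *\<^sub>C u) - shift (int (Suc k)) (c *\<^sub>C u) - shift (- int (Suc k)) (c *\<^sub>C u)))
      sums (c *\<^sub>C lap J u)"
    using bounded_linear.sums[OF bounded_linear_scaleC lap_sums, of c u] by (simp only:)
qed

lemma bounded_linear_lap: "bounded_linear (lap J)"
proof (rule bounded_linear_intro)
  show "lap J (u + v) = lap J u + lap J v" for u v
  proof (rule sums_unique2[OF lap_sums])
    have "J k *\<^sub>R (2 *\<^sub>R (u + v) - shift k (u + v) - shift (- k) (u + v))
        = J k *\<^sub>R (2 *\<^sub>R u - shift k u - shift (- k) u) + J k *\<^sub>R (2 *\<^sub>R v - shift k v - shift (- k) v)" for k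
      by (auto intro!: ell2_eqI simp: shift.rep_eq algebra_simps)
    thus "(\<lambda>k. J (int (Suc k)) *\<^sub>R (2 *\<^sub>R (u + v) - shift (int (Suc k)) (u + v) - shift (- int (Suc k)) (u + v)))
        sums (lap J u + lap J v)"
      using sums_add[OF lap_sums lap_sums, of u v] by (simp only:)
  qed
  show "lap J (r *\<^sub>R u) = r *\<^sub>R lap J u" for r u
    using lap_scaleC[of "of_real r" u] by (simp add: scaleC_of_real)
  show "norm (lap J u) \<le> norm u * (2 * (\<Sum>\<^sub>\<infinity>k. \<bar>J k\<bar>))" for u
    using lap_aux(2)[OF J, of u] by (simp add: mult_ac)
qed

text \<open>The shifts by k and -k are adjoint while multiplication by i is skew, so the two shift
  contributions cancel in every term of \<open>lap_sums\<close>.\<close>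

lemma inner_ii_lap: "u \<bullet> (\<i> *\<^sub>C lap J u) = 0"
proof -
  have "bounded_linear (\<lambda>v. u \<bullet> (\<i> *\<^sub>C v))"
    by (rule bounded_linear_compose[OF bounded_linear_inner_right bounded_linear_scaleC])
  from bounded_linear.sums[OF this lap_sums[of u]]
  have "(\<lambda>k. u \<bullet> (\<i> *\<^sub>C (J (int (Suc k)) *\<^sub>R (2 *\<^sub>R u - shift (int (Suc k)) u - shift (- int (Suc k)) u))))
      sums (u \<bullet> (\<i> *\<^sub>C lap J u))" .
  moreover have "u \<bullet> (\<i> *\<^sub>C (r *\<^sub>R (2 *\<^sub>R u - shift k u - shift (- k) u))) = 0" for r k
  proof -
    have "\<i> *\<^sub>C (r *\<^sub>R (2 *\<^sub>R u - shift k u - shift (- k) u))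
        = r *\<^sub>R (2 *\<^sub>R (\<i> *\<^sub>C u) - \<i> *\<^sub>C shift k u - shift (- k) (\<i> *\<^sub>C u))"
      by (auto intro!: ell2_eqI simp: shift.rep_eq algebra_simps)
    moreover have "u \<bullet> shift (- k) (\<i> *\<^sub>C u) = - (u \<bullet> (\<i> *\<^sub>C shift k u))"
      unfolding inner_shift by (simp add: inner_scaleC_ii inner_commute)
    ultimately show ?thesis by (simp add: inner_diff_right)
  qed
  ultimately have "(\<lambda>_. 0) sums (u \<bullet> (\<i> *\<^sub>C lap J u))" by (simp only:)
  thus ?thesis using sums_unique2 sums_zero by blast
qed

end

lemma power_kernel_even: "power_kernel \<alpha> (- k) = power_kernel \<alpha> k"
  by (simp add: power_kernel_def)

lemma power_kernel_Suc: "power_kernel \<alpha> (int (Suc k)) = real (Suc k) powr (- (1 + \<alpha>))"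
  by (simp add: power_kernel_def)

section \<open>The linear flow\<close>

lemma exp_series_has_vector_derivative:
  fixes A :: "'b::banach \<Rightarrow> 'b" and u :: 'b
  assumes A: "bounded_linear A"
  defines "E \<equiv> \<lambda>t. \<Sum>k. (t ^ k / fact k) *\<^sub>R (A ^^ k) u"
  shows "(\<lambda>k. (t ^ k / fact k) *\<^sub>R (A ^^ k) u) sums E t" "(E has_vector_derivative A (E t)) (at t)"
proof -
  interpret A: bounded_linear A by (rule A)
  obtain B where B: "0 \<le> B" "\<And>x. norm (A x) \<le> norm x * B"
    using A.nonneg_bounded by blast
  have pow: "norm ((A ^^ k) u) \<le> B ^ k * norm u" for k
  proof (induction k)
    case (Suc k)
    have "norm ((A ^^ Suc k) u) \<le> norm ((A ^^ k) u) * B" using B(2) by simp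
    also have "\<dots> \<le> (B ^ k * norm u) * B" by (rule mult_right_mono[OF Suc B(1)])
    finally show ?case by (simp add: mult_ac)
  qed simp
  define f where "f = (\<lambda>k t. (t ^ k / fact k) *\<^sub>R (A ^^ k) u)"
  have le: "norm (f k t) \<le> (inverse (fact k) * (r * B) ^ k) * norm u" if "\<bar>t\<bar> \<le> r" for k t r
  proof -
    have "norm (f k t) = \<bar>t\<bar> ^ k / fact k * norm ((A ^^ k) u)" by (simp add: f_def power_abs)
    also have "\<dots> \<le> r ^ k / fact k * (B ^ k * norm u)"
      using that B by (intro mult_mono divide_right_mono power_mono pow) auto
    finally show ?thesis by (simp add: power_mult_distrib field_simps)
  qed
  have sM: "summable (\<lambda>k. (inverse (fact k) * (r * B) ^ k) * norm u)" for r
    by (intro summable_mult2 summable_exp)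
  have sums: "(\<lambda>k. f k t) sums E t" for t
  proof -
    have "summable (\<lambda>k. f k t)"
      by (rule summable_comparison_test'[OF sM[of "\<bar>t\<bar>"], where N = 0]) (use le in auto)
    thus ?thesis unfolding E_def f_def by (rule summable_sums)
  qed
  thus "(\<lambda>k. (t ^ k / fact k) *\<^sub>R (A ^^ k) u) sums E t" by (simp add: f_def)
  \<comment> \<open>Differentiation lowers the index: the first n derivative terms sum to A applied
    to n - 1 terms of the original series, so its uniform convergence on bounded intervals is all
    that is needed.\<close>
  define d where "d = (\<lambda>k t. case k of 0 \<Rightarrow> 0 | Suc j \<Rightarrow> A (f j t))"
  have deriv: "(f k has_derivative (\<lambda>h. h *\<^sub>R d k t)) (at t within S)" for k t S
  proof (cases k)
    case (Suc j)
    have "((\<lambda>t. t ^ Suc j / fact (Suc j)) has_real_derivative t ^ j / fact j) (at t within S)"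
      by (rule DERIV_cong[OF DERIV_cdivide[OF DERIV_subset[OF DERIV_pow subset_UNIV]]]) (simp del: of_nat_Suc)
    hence "((\<lambda>t. (t ^ Suc j / fact (Suc j)) *\<^sub>R (A ^^ Suc j) u) has_vector_derivative (t ^ j / fact j) *\<^sub>R (A ^^ Suc j) u) (at t within S)"
      by (rule has_vector_derivative_scaleR[OF _ has_vector_derivative_const, THEN has_vector_derivative_eq_rhs]) simp
    thus ?thesis by (simp add: Suc f_def d_def has_vector_derivative_def A.scaleR)
  qed (simp add: f_def d_def)
  define r where "r = \<bar>t\<bar> + 1"
  define S where "S = {- r<..<r}"
  have unif: "uniform_limit S (\<lambda>n t. \<Sum>k<n. f k t) E sequentially"
  proof -
    have "uniform_limit S (\<lambda>n t. \<Sum>k<n. f k t) (\<lambda>t. \<Sum>k. f k t) sequentially"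
      by (rule Weierstrass_m_test[OF _ sM[of r]]) (auto simp: S_def intro!: le)
    thus ?thesis by (simp add: E_def[abs_def] f_def)
  qed
  have "\<exists>g. \<forall>x\<in>S. (\<lambda>n. f n x) sums g x \<and> (g has_derivative (\<lambda>h. h *\<^sub>R A (E x))) (at x within S)"
  proof (rule has_derivative_series[OF _ deriv _ _ sums])
    show "convex S" "t \<in> S" by (auto simp: S_def r_def)
    fix e :: real assume "0 < e"
    hence "0 < e / (B + 1)" using B by simp
    from uniform_limitD[OF unif this] obtain N
      where N: "\<And>n x. N \<le> n \<Longrightarrow> x \<in> S \<Longrightarrow> norm ((\<Sum>k<n. f k x) - E x) < e / (B + 1)"
      by (auto simp: eventually_sequentially dist_norm)
    have "norm ((\<Sum>i<n. h *\<^sub>R d i x) - h *\<^sub>R A (E x)) \<le> e * norm h" if n: "Suc N \<le> n" and x: "x \<in> S" for n x h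
    proof -
      obtain j where j: "n = Suc j" "N \<le> j" using n by (cases n) auto
      have "(\<Sum>i<n. h *\<^sub>R d i x) = h *\<^sub>R A (\<Sum>k<j. f k x)"
        unfolding j(1) sum.lessThan_Suc_shift by (simp add: d_def A.sum scaleR_sum_right)
      hence "norm ((\<Sum>i<n. h *\<^sub>R d i x) - h *\<^sub>R A (E x)) = \<bar>h\<bar> * norm (A ((\<Sum>k<j. f k x) - E x))"
        by (simp add: A.diff flip: scaleR_diff_right)
      also have "\<dots> \<le> \<bar>h\<bar> * e"
      proof (rule mult_left_mono)
        have "norm (A ((\<Sum>k<j. f k x) - E x)) \<le> norm ((\<Sum>k<j. f k x) - E x) * B" by (rule B)
        also have "\<dots> \<le> e / (B + 1) * (B + 1)"
          using N[OF j(2) x] B \<open>0 < e\<close> by (intro mult_mono) auto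
        also have "\<dots> = e" using B by simp
        finally show "norm (A ((\<Sum>k<j. f k x) - E x)) \<le> e" .
      qed simp
      finally show ?thesis by (simp add: mult.commute)
    qed
    thus "\<forall>\<^sub>F n in sequentially. \<forall>x\<in>S. \<forall>h. norm ((\<Sum>i<n. h *\<^sub>R d i x) - h *\<^sub>R A (E x)) \<le> e * norm h"
      unfolding eventually_sequentially by blast
  qed
  then obtain g where g: "\<And>x. x \<in> S \<Longrightarrow> (\<lambda>n. f n x) sums g x"
    "\<And>x. x \<in> S \<Longrightarrow> (g has_derivative (\<lambda>h. h *\<^sub>R A (E x))) (at x within S)" by blast
  have S: "open S" "t \<in> S" by (auto simp: S_def r_def)
  have "g x = E x" if "x \<in> S" for x using sums_unique2[OF g(1)[OF that] sums] .
  hence "(E has_derivative (\<lambda>h. h *\<^sub>R A (E t))) (at t within S)"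
    using has_derivative_transform[OF S(2) _ g(2)[OF S(2)]] by metis
  thus "(E has_vector_derivative A (E t)) (at t)"
    using at_within_open[OF S(2,1)] by (simp add: has_vector_derivative_def)
qed

lemma has_vector_derivative_inner_self:
  assumes "(y has_vector_derivative y') (at t)"
  shows "((\<lambda>t. y t \<bullet> y t) has_real_derivative 2 * (y t \<bullet> y')) (at t)"
proof -
  have "((\<lambda>t. y t \<bullet> y t) has_derivative (\<lambda>h. y t \<bullet> (h *\<^sub>R y') + (h *\<^sub>R y') \<bullet> y t)) (at t)"
    using assms unfolding has_vector_derivative_def by (intro has_derivative_inner)
  thus ?thesis unfolding has_field_derivative_def
    by (rule has_derivative_eq_rhs) (simp add: fun_eq_iff inner_commute)
qed

lemma norm_constant_if_orthogonal_derivative: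
  assumes "\<And>t. (y has_vector_derivative y' t) (at t)" "\<And>t. y t \<bullet> y' t = 0"
  shows "norm (y s) = norm (y t)"
proof -
  have "y s \<bullet> y s = y t \<bullet> y t"
    by (rule DERIV_isconst_all) (use has_vector_derivative_inner_self[OF assms(1)] assms(2) in simp)
  thus ?thesis by (simp add: norm_eq_sqrt_inner)
qed

locale power_law =
  fixes \<alpha> :: real
  assumes \<alpha>: "0 < \<alpha>"
begin

abbreviation "L \<equiv> lap (power_kernel \<alpha>)"
abbreviation "U \<equiv> linear_flow (power_kernel \<alpha>)"

lemmas J = power_kernel_abs_summable[OF \<alpha>]
lemmas L_sums = lap_sums[OF J power_kernel_even]
lemmas L_scaleC = lap_scaleC[OF J power_kernel_even]
lemmas L_linear = bounded_linear_lap[OF J power_kernel_even]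
lemmas L_symmetric = inner_ii_lap[OF J power_kernel_even]

lemma U_series: "((- \<i> * of_real t) ^ k / fact k) *\<^sub>C (L ^^ k) u = (t ^ k / fact k) *\<^sub>R ((\<lambda>u. (- \<i>) *\<^sub>C L u) ^^ k) u"
proof -
  have "((\<lambda>u. (- \<i>) *\<^sub>C L u) ^^ k) u = (- \<i>) ^ k *\<^sub>C (L ^^ k) u"
  proof (induction k)
    case 0
    show ?case by (auto intro!: ell2_eqI)
  next
    case (Suc k)
    thus ?case by (simp add: L_scaleC scaleC_scaleC)
  qed
  thus ?thesis
    unfolding power_mult_distrib
    by (simp add: scaleC_scaleC mult_ac flip: scaleC_of_real)
qed

lemma generator_linear: "bounded_linear (\<lambda>u. (- \<i>) *\<^sub>C L u)"
  by (rule bounded_linear_compose[OF bounded_linear_scaleC L_linear])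

lemma U_deriv: "((\<lambda>t. U t u) has_vector_derivative (- \<i>) *\<^sub>C L (U t u)) (at t)"
  using exp_series_has_vector_derivative(2)[OF generator_linear, of u t]
  unfolding linear_flow_def U_series .

lemma U_0 [simp]: "U 0 u = u"
proof -
  have "(\<lambda>k. ((- \<i> * of_real 0) ^ k / fact k) *\<^sub>C (L ^^ k) u) sums U 0 u"
    by (rule linear_flow_sums[OF J])
  moreover have "(\<lambda>k. ((- \<i> * of_real 0) ^ k / fact k) *\<^sub>C (L ^^ k) u)
      = (\<lambda>k. if k = 0 then u else 0)"
    by (auto simp: fun_eq_iff intro!: ell2_eqI)
  ultimately show ?thesis using sums_unique2[OF _ sums_single[of 0 "\<lambda>_. u"]] by metis
qed

lemma generator_skew: "u \<bullet> ((- \<i>) *\<^sub>C L u) = 0"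
proof -
  have "(- \<i>) *\<^sub>C L u = - (\<i> *\<^sub>C L u)" by (auto intro!: ell2_eqI)
  thus ?thesis by (simp add: L_symmetric)
qed

lemma norm_U [simp]: "norm (U t u) = norm u"
proof -
  have "norm (U t u) = norm (U 0 u)"
    by (rule norm_constant_if_orthogonal_derivative[OF U_deriv generator_skew])
  thus ?thesis by simp
qed

text \<open>The difference of two solutions solves the same linear equation, so its norm is
  conserved. The group law and linearity of the flow then follow from uniqueness instead of
  manipulations of the series.\<close>

lemma U_unique:
  assumes "\<And>t. (y has_vector_derivative (- \<i>) *\<^sub>C L (y t)) (at t)"
  shows "y t = U t (y 0)"
proof -
  have d: "((\<lambda>t. y t - U t (y 0)) has_vector_derivative (- \<i>) *\<^sub>C L (y t - U t (y 0))) (at t)" for t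
  proof -
    have "(- \<i>) *\<^sub>C L (y t - U t (y 0)) = (- \<i>) *\<^sub>C L (y t) - (- \<i>) *\<^sub>C L (U t (y 0))"
      by (rule linear_diff[OF bounded_linear.linear[OF generator_linear]])
    thus ?thesis using has_vector_derivative_diff[OF assms[of t] U_deriv] by simp
  qed
  have "norm (y t - U t (y 0)) = norm (y 0 - U 0 (y 0))"
    by (rule norm_constant_if_orthogonal_derivative[OF d generator_skew])
  thus ?thesis by simp
qed

lemma U_add_time: "U (s + t) u = U s (U t u)"
proof -
  have "((\<lambda>s. U (s + t) u) has_vector_derivative (- \<i>) *\<^sub>C L (U (s + t) u)) (at s)" for s
  proof -
    have "((\<lambda>s. s + t) has_vector_derivative 1) (at s)"
      by (auto intro!: derivative_eq_intros simp flip: has_real_derivative_iff_has_vector_derivative)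
    from vector_diff_chain_at[OF this U_deriv]
    have "((\<lambda>s. U s u) \<circ> (\<lambda>s. s + t) has_vector_derivative 1 *\<^sub>R ((- \<i>) *\<^sub>C L (U (s + t) u))) (at s)" .
    thus ?thesis by (simp add: o_def)
  qed
  from U_unique[OF this] have "U (s + t) u = U s (U (0 + t) u)" .
  thus ?thesis by simp
qed

lemma U_cancel [simp]: "U t (U (- t) u) = u" "U (- t) (U t u) = u"
  by (simp_all flip: U_add_time)

lemma U_linear: "bounded_linear (U t)"
proof (rule bounded_linear_intro[where K = 1])
  show "U t (u + v) = U t u + U t v" for u v
  proof -
    have "((\<lambda>t. U t u + U t v) has_vector_derivative (- \<i>) *\<^sub>C L (U t u + U t v)) (at t)" for t
      by (rule has_vector_derivative_eq_rhs[OF has_vector_derivative_add[OF U_deriv U_deriv]])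
        (simp add: linear_add[OF bounded_linear.linear[OF generator_linear]])
    from U_unique[OF this] have "U t u + U t v = U t (U 0 u + U 0 v)" .
    thus ?thesis by simp
  qed
  show "U t (r *\<^sub>R u) = r *\<^sub>R U t u" for r u
  proof -
    have "((\<lambda>t. r *\<^sub>R U t u) has_vector_derivative (- \<i>) *\<^sub>C L (r *\<^sub>R U t u)) (at t)" for t
      by (rule has_vector_derivative_eq_rhs[OF bounded_linear.has_vector_derivative[OF bounded_linear_scaleR_right U_deriv]])
        (simp add: linear_scale[OF bounded_linear.linear[OF generator_linear]])
    from U_unique[OF this] have "r *\<^sub>R U t u = U t (r *\<^sub>R U 0 u)" .
    thus ?thesis by simp
  qed
qed simp

lemmas U_add = linear_add[OF bounded_linear.linear[OF U_linear]]
lemmas U_diff = linear_diff[OF bounded_linear.linear[OF U_linear]]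
lemmas U_scaleR = linear_scale[OF bounded_linear.linear[OF U_linear]]

lemma inner_U: "U t u \<bullet> v = u \<bullet> U (- t) v"
proof -
  have "U t u \<bullet> U t w = u \<bullet> w" for w
    by (simp add: dot_norm flip: U_add)
  from this[of "U (- t) v"] show ?thesis by simp
qed

text \<open>A product rule proved by hand, as the factor is an operator depending on time. The
  isometry U(-t) is pulled out of the difference quotient, which leaves the flow near time
  0.\<close>

lemma U_pullback_deriv:
  assumes y: "(y has_vector_derivative y') (at t)"
  shows "((\<lambda>t. U (- t) (y t)) has_vector_derivative U (- t) (y' + \<i> *\<^sub>C L (y t))) (at t)"
proof -
  have lim: "(\<lambda>h. norm (g (t + h) - g t - h *\<^sub>R D) / norm h) \<midarrow>0\<rightarrow> 0"
    if "(g has_vector_derivative D) (at t)" for g :: "real \<Rightarrow> int ell2" and D t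
    using that unfolding has_vector_derivative_def has_derivative_at by blast
  have flow: "((\<lambda>h. U (- h) v) has_vector_derivative \<i> *\<^sub>C L v) (at 0)" for v
  proof -
    have "(uminus has_vector_derivative (-1)) (at (0 :: real))"
      by (auto intro!: derivative_eq_intros simp flip: has_real_derivative_iff_has_vector_derivative)
    from vector_diff_chain_at[OF this U_deriv]
    have "((\<lambda>h. U h v) \<circ> uminus has_vector_derivative (-1) *\<^sub>R ((- \<i>) *\<^sub>C L (U (- 0) v))) (at 0)" .
    moreover have "(-1) *\<^sub>R ((- \<i>) *\<^sub>C L (U (- 0) v)) = \<i> *\<^sub>C L v" by (auto intro!: ell2_eqI)
    ultimately show ?thesis by (simp add: o_def)
  qed
  have cont: "(\<lambda>h. U (- h) v) \<midarrow>0\<rightarrow> v" for v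
    using has_vector_derivative_continuous[OF flow[of v]] by (simp add: continuous_at)
  let ?R = "\<lambda>h. norm (y (t + h) - y t - h *\<^sub>R y') / norm h + norm (U (- h) y' - y')
      + norm (U (- (0 + h)) (y t) - U (- 0) (y t) - h *\<^sub>R (\<i> *\<^sub>C L (y t))) / norm h"
  have "?R \<midarrow>0\<rightarrow> 0 + norm (y' - y') + 0"
    by (intro tendsto_intros lim y flow cont)
  hence R: "?R \<midarrow>0\<rightarrow> 0" by simp
  have "(\<lambda>h. norm (U (- (t + h)) (y (t + h)) - U (- t) (y t) - h *\<^sub>R U (- t) (y' + \<i> *\<^sub>C L (y t))) / norm h) \<midarrow>0\<rightarrow> 0"
  proof (rule Lim_null_comparison[OF _ R], rule always_eventually, rule allI)
    fix h :: real
    show "norm (norm (U (- (t + h)) (y (t + h)) - U (- t) (y t) - h *\<^sub>R U (- t) (y' + \<i> *\<^sub>C L (y t))) / norm h) \<le> ?R h"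
    proof -
      let ?X = "U (- h) (y (t + h) - y t - h *\<^sub>R y') + h *\<^sub>R (U (- h) y' - y')
        + (U (- (0 + h)) (y t) - U (- 0) (y t) - h *\<^sub>R (\<i> *\<^sub>C L (y t)))"
      have "?X = U (- h) (y (t + h)) - y t - h *\<^sub>R (y' + \<i> *\<^sub>C L (y t))"
        by (simp add: U_add U_diff U_scaleR algebra_simps)
      hence "U (- t) ?X = U (- t) (U (- h) (y (t + h))) - U (- t) (y t) - h *\<^sub>R U (- t) (y' + \<i> *\<^sub>C L (y t))"
        by (simp only: U_diff U_scaleR)
      moreover have "U (- t) (U (- h) (y (t + h))) = U (- (t + h)) (y (t + h))"
        by (simp flip: U_add_time)
      ultimately have "norm (U (- (t + h)) (y (t + h)) - U (- t) (y t) - h *\<^sub>R U (- t) (y' + \<i> *\<^sub>C L (y t))) = norm ?X"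
        by (metis norm_U)
      also have "\<dots> \<le> norm (y (t + h) - y t - h *\<^sub>R y') + \<bar>h\<bar> * norm (U (- h) y' - y')
          + norm (U (- (0 + h)) (y t) - U (- 0) (y t) - h *\<^sub>R (\<i> *\<^sub>C L (y t)))"
        by (intro norm_triangle_mono order_refl) simp_all
      finally have "norm (U (- (t + h)) (y (t + h)) - U (- t) (y t) - h *\<^sub>R U (- t) (y' + \<i> *\<^sub>C L (y t))) / norm h
        \<le> (norm (y (t + h) - y t - h *\<^sub>R y') + \<bar>h\<bar> * norm (U (- h) y' - y')
          + norm (U (- (0 + h)) (y t) - U (- 0) (y t) - h *\<^sub>R (\<i> *\<^sub>C L (y t)))) / norm h"
        by (rule divide_right_mono) simp
      also have "\<dots> \<le> ?R h" by (cases "h = 0") (simp_all add: add_divide_distrib)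
      finally show ?thesis by simp
    qed
  qed
  thus ?thesis
    unfolding has_vector_derivative_def has_derivative_at
    by (auto intro: bounded_linear_scaleR_left)
qed

end

section \<open>Dispersive and Strichartz estimates\<close>

lemma integral_sums:
  fixes f :: "nat \<Rightarrow> real \<Rightarrow> complex"
  assumes f: "\<And>k. continuous_on {a..b} (f k)" and M: "\<And>k x. x \<in> {a..b} \<Longrightarrow> cmod (f k x) \<le> M k" "summable M"
  shows "(\<lambda>k. integral {a..b} (f k)) sums integral {a..b} (\<lambda>x. \<Sum>k. f k x)"
proof -
  have int: "f k integrable_on {a..b}" for k
    by (rule integrable_continuous_interval[OF f])
  have "(\<lambda>n. integral {a..b} (\<lambda>x. \<Sum>k<n. f k x)) \<longlonglongrightarrow> integral {a..b} (\<lambda>x. \<Sum>k. f k x)"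
  proof (rule dominated_convergence(2))
    show "(\<lambda>x. \<Sum>k<n. f k x) integrable_on {a..b}" for n
      by (intro integrable_sum int) auto
    show "(\<lambda>_. \<Sum>k. M k) integrable_on {a..b}" by (rule integrable_const_ivl)
    fix x assume x: "x \<in> {a..b}"
    have M0: "0 \<le> M k" for k using norm_ge_zero M(1)[OF x] order_trans by blast
    show "norm (\<Sum>k<n. f k x) \<le> (\<Sum>k. M k)" for n
    proof -
      have "norm (\<Sum>k<n. f k x) \<le> (\<Sum>k<n. M k)" by (intro sum_norm_le M x)
      also have "\<dots> \<le> (\<Sum>k. M k)" by (intro sum_le_suminf M) (auto simp: M0)
      finally show ?thesis .
    qed
    have "summable (\<lambda>k. f k x)"
      by (rule summable_comparison_test'[OF M(2), where N = 0]) (use M(1)[OF x] in auto)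
    thus "(\<lambda>n. \<Sum>k<n. f k x) \<longlonglongrightarrow> (\<Sum>k. f k x)" by (rule summable_LIMSEQ)
  qed
  moreover have "integral {a..b} (\<lambda>x. \<Sum>k<n. f k x) = (\<Sum>k<n. integral {a..b} (f k))" for n
    by (intro integral_sum int) auto
  ultimately show ?thesis by (simp add: sums_def)
qed

lemma integral_cis_int:
  "integral {0..2 * pi} (\<lambda>x. cis (real_of_int j * x)) = (if j = 0 then of_real (2 * pi) else 0)"
proof (cases "j = 0")
  case False
  have "((\<lambda>x. cis (real_of_int j * x)) has_integral
      (- \<i> / of_int j * cis (real_of_int j * (2 * pi)) - - \<i> / of_int j * cis (real_of_int j * 0))) {0..2 * pi}"
  proof (rule fundamental_theorem_of_calculus)
    fix x assume "x \<in> {0..2 * pi}"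
    have "((\<lambda>x. cis (real_of_int j * x)) has_vector_derivative of_int j * \<i> * cis (real_of_int j * x)) (at x within {0..2 * pi})"
      unfolding cis_conv_exp
      by (auto intro!: derivative_eq_intros has_vector_derivative_real_field[THEN has_vector_derivative_eq_rhs])
    from has_vector_derivative_mult_right[OF this, of "- \<i> / of_int j"]
    show "((\<lambda>x. - \<i> / of_int j * cis (real_of_int j * x)) has_vector_derivative cis (real_of_int j * x)) (at x within {0..2 * pi})"
      using False by simp
  qed simp
  moreover have "cis (real_of_int j * (2 * pi)) = 1"
    using cis_multiple_2pi[of "real_of_int j"] by (simp add: mult_ac)
  ultimately show ?thesis using False by (simp add: integral_unique)
qed (simp add: scaleR_conv_of_real)

section \<open>Fourier representation of the flow on point masses\<close>

context power_law
begin

lemma summable_symbol: "summable (\<lambda>k. real (Suc k) powr (- (1 + \<alpha>)))"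
  by (rule summable_Suc_powr) (use \<alpha> in simp)

lemma symbol_term_le: "\<bar>real (Suc k) powr (- (1 + \<alpha>)) * (2 * (1 - cos (real (Suc k) * x)))\<bar> \<le> 4 * real (Suc k) powr (- (1 + \<alpha>))"
  by (rule abs_mult_cos_le) simp

lemma dispersion_sums: "(\<lambda>k. real (Suc k) powr (- (1 + \<alpha>)) * (2 * (1 - cos (real (Suc k) * x)))) sums dispersion \<alpha> x"
  unfolding dispersion_def
proof (rule summable_sums, rule summable_comparison_test'[where N = 0])
  show "summable (\<lambda>k. 4 * real (Suc k) powr (- (1 + \<alpha>)))" by (rule summable_mult[OF summable_symbol])
  show "norm (real (Suc k) powr (- (1 + \<alpha>)) * (2 * (1 - cos (real (Suc k) * x)))) \<le> 4 * real (Suc k) powr (- (1 + \<alpha>))" for k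
    unfolding real_norm_def by (rule symbol_term_le)
qed

lemma dispersion_continuous: "continuous_on S (dispersion \<alpha>)"
  unfolding dispersion_def[abs_def]
  by (rule continuous_on_suminf_real[OF _ symbol_term_le])
    (intro continuous_intros summable_mult summable_symbol)+

definition "symbol_bound = (\<Sum>k. 4 * real (Suc k) powr (- (1 + \<alpha>)))"

lemma dispersion_le: "\<bar>dispersion \<alpha> x\<bar> \<le> symbol_bound"
  unfolding symbol_bound_def real_norm_def[symmetric]
  by (rule norm_sums_le[OF dispersion_sums summable_sums[OF summable_mult[OF summable_symbol]]])
    (simp only: real_norm_def symbol_term_le)

text \<open>Shifting by k multiplies the integrand by a character, so each second difference
  contributes 2(1 - cos kx). Boundedness of \<psi> allows summation under the integral; iteration
  from a point mass needs only continuous densities.\<close>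

lemma coord_lap_fourier:
  assumes \<psi>: "continuous_on {0..2 * pi} \<psi>"
    and v: "\<And>n. coord v n = integral {0..2 * pi} (\<lambda>x. \<psi> x * cis (real_of_int (n - m) * x))"
  shows "coord (L v) n = integral {0..2 * pi} (\<lambda>x. of_real (dispersion \<alpha> x) * \<psi> x * cis (real_of_int (n - m) * x))"
proof -
  let ?a = "\<lambda>k. real (Suc k) powr (- (1 + \<alpha>))"
  let ?e = "\<lambda>n x. cis (real_of_int n * x)"
  let ?g = "\<lambda>k x. of_real (?a k * (2 * (1 - cos (real (Suc k) * x)))) * \<psi> x * ?e (n - m) x"
  have cont: "continuous_on {0..2 * pi} (\<lambda>x. \<psi> x * ?e j x)" for j
    by (intro continuous_intros \<psi> continuous_on_cis)
  have int: "(\<lambda>x. \<psi> x * ?e j x) integrable_on {0..2 * pi}" for j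
    by (rule integrable_continuous_interval[OF cont])
  have "(\<lambda>k. coord (power_kernel \<alpha> (int (Suc k)) *\<^sub>R (2 *\<^sub>R v - shift (int (Suc k)) v - shift (- int (Suc k)) v)) n)
      sums coord (L v) n"
    by (rule bounded_linear.sums[OF bounded_linear_coord L_sums])
  moreover have "coord (power_kernel \<alpha> (int (Suc k)) *\<^sub>R (2 *\<^sub>R v - shift (int (Suc k)) v - shift (- int (Suc k)) v)) n
      = integral {0..2 * pi} (?g k)" for k
  proof -
    let ?K = "int (Suc k)"
    have e: "2 * ?e (n - m) x - ?e (n - ?K - m) x - ?e (n + ?K - m) x
        = of_real (2 * (1 - cos (real (Suc k) * x))) * ?e (n - m) x" for x
    proof -
      have "real_of_int (n - ?K - m) * x = real_of_int (n - m) * x + - (real (Suc k) * x)"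
        "real_of_int (n + ?K - m) * x = real_of_int (n - m) * x + real (Suc k) * x"
        by (simp_all add: algebra_simps)
      hence "?e (n - ?K - m) x + ?e (n + ?K - m) x = ?e (n - m) x * (cis (- (real (Suc k) * x)) + cis (real (Suc k) * x))"
        by (simp only: cis_mult[symmetric] distrib_left)
      also have "cis (- (real (Suc k) * x)) + cis (real (Suc k) * x) = of_real (2 * cos (real (Suc k) * x))"
        by (simp add: complex_eq_iff)
      finally show ?thesis by (simp add: algebra_simps)
    qed
    have "coord (power_kernel \<alpha> ?K *\<^sub>R (2 *\<^sub>R v - shift ?K v - shift (- ?K) v)) n
        = of_real (?a k) * (2 * coord v n - coord v (n - ?K) - coord v (n + ?K))"
      unfolding power_kernel_Suc by (simp add: shift.rep_eq scaleR_conv_of_real del: of_nat_Suc)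
    also have "\<dots> = integral {0..2 * pi} (\<lambda>x. of_real (?a k) *
        (2 * (\<psi> x * ?e (n - m) x) - \<psi> x * ?e (n - ?K - m) x - \<psi> x * ?e (n + ?K - m) x))"
      unfolding v using int by (simp add: integral_diff integrable_diff del: of_nat_Suc of_int_add of_int_diff)
    also have "\<dots> = integral {0..2 * pi} (?g k)"
    proof (rule integral_cong)
      fix x
      have "2 * (\<psi> x * ?e (n - m) x) - \<psi> x * ?e (n - ?K - m) x - \<psi> x * ?e (n + ?K - m) x
          = \<psi> x * (2 * ?e (n - m) x - ?e (n - ?K - m) x - ?e (n + ?K - m) x)" by (simp add: algebra_simps)
      thus "of_real (?a k) * (2 * (\<psi> x * ?e (n - m) x) - \<psi> x * ?e (n - ?K - m) x - \<psi> x * ?e (n + ?K - m) x) = ?g k x"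
        unfolding e by (simp add: mult_ac)
    qed
    finally show ?thesis .
  qed
  ultimately have 1: "(\<lambda>k. integral {0..2 * pi} (?g k)) sums coord (L v) n" by simp
  obtain B where "\<forall>y\<in>\<psi> ` {0..2 * pi}. cmod y \<le> B"
    using compact_imp_bounded[OF compact_continuous_image[OF \<psi> compact_Icc]] unfolding bounded_iff by blast
  hence B: "cmod (\<psi> x) \<le> B" if "x \<in> {0..2 * pi}" for x using that by blast
  have "(\<lambda>k. integral {0..2 * pi} (?g k)) sums integral {0..2 * pi} (\<lambda>x. \<Sum>k. ?g k x)"
  proof (rule integral_sums)
    show "continuous_on {0..2 * pi} (?g k)" for k
      by (intro continuous_intros \<psi> continuous_on_cis)
    show "summable (\<lambda>k. 4 * ?a k * B)" by (intro summable_mult summable_mult2 summable_symbol)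
    fix k x assume x: "x \<in> {0..2 * pi}"
    have "cmod (?g k x) = \<bar>?a k * (2 * (1 - cos (real (Suc k) * x)))\<bar> * cmod (\<psi> x)"
      by (simp only: norm_mult norm_of_real norm_cis mult_1_right)
    also have "\<dots> \<le> 4 * ?a k * B" by (intro mult_mono symbol_term_le B x) auto
    finally show "cmod (?g k x) \<le> 4 * ?a k * B" .
  qed
  moreover have "(\<Sum>k. ?g k x) = of_real (dispersion \<alpha> x) * \<psi> x * ?e (n - m) x" for x
    using sums_mult2[OF sums_mult2[OF sums_of_real[OF dispersion_sums[of x], where 'a = complex], of "\<psi> x"], of "?e (n - m) x"]
    by (rule sums_unique[symmetric])
  ultimately show ?thesis using 1 sums_unique2 by fastforce
qed

lemma coord_lap_pow_single:
  "coord ((L ^^ k) (single m z)) n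
    = integral {0..2 * pi} (\<lambda>x. of_real (dispersion \<alpha> x) ^ k * (z / of_real (2 * pi)) * cis (real_of_int (n - m) * x))"
proof (induction k arbitrary: n)
  case 0
  have "integral {0..2 * pi} (\<lambda>x. of_real (dispersion \<alpha> x) ^ 0 * (z / of_real (2 * pi)) * cis (real_of_int (n - m) * x))
      = z / of_real (2 * pi) * (if n - m = 0 then of_real (2 * pi) else 0)"
    by (simp only: power_0 mult_1 integral_mult_right integral_cis_int)
  thus ?case by (auto simp: coord_single scaleR_conv_of_real)
next
  case (Suc k)
  show ?case
    using coord_lap_fourier[of "\<lambda>x. of_real (dispersion \<alpha> x) ^ k * (z / of_real (2 * pi))", OF _ Suc.IH, of n]
    by (simp add: continuous_intros dispersion_continuous mult.assoc del: of_int_diff)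
qed

lemma coord_U_single:
  "coord (U t (single m z)) n = z / of_real (2 * pi) *
    integral {0..2 * pi} (\<lambda>x. cis (- (t * dispersion \<alpha> x)) * cis (real_of_int (n - m) * x))"
proof -
  let ?e = "\<lambda>x. cis (real_of_int (n - m) * x)"
  let ?w = "\<lambda>x. complex_of_real (dispersion \<alpha> x)"
  let ?g = "\<lambda>k x. (- \<i> * of_real t * ?w x) ^ k / fact k * ?e x"
  have B: "0 \<le> symbol_bound" using dispersion_le[of 0] by linarith
  have "(\<lambda>k. integral {0..2 * pi} (?g k)) sums integral {0..2 * pi} (\<lambda>x. \<Sum>k. ?g k x)"
  proof (rule integral_sums)
    show "continuous_on {0..2 * pi} (?g k)" for k
      by (intro continuous_intros dispersion_continuous continuous_on_cis) auto
    show "summable (\<lambda>k. inverse (fact k) * (\<bar>t\<bar> * symbol_bound) ^ k)" by (rule summable_exp)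
    fix k x
    have "cmod (?g k x) = (\<bar>t\<bar> * \<bar>dispersion \<alpha> x\<bar>) ^ k / fact k"
      by (simp add: norm_mult norm_divide norm_power)
    also have "\<dots> \<le> (\<bar>t\<bar> * symbol_bound) ^ k / fact k"
      by (intro divide_right_mono power_mono mult_left_mono dispersion_le) auto
    finally show "cmod (?g k x) \<le> inverse (fact k) * (\<bar>t\<bar> * symbol_bound) ^ k" by (simp add: field_simps)
  qed
  moreover have "(\<Sum>k. ?g k x) = cis (- (t * dispersion \<alpha> x)) * ?e x" for x
  proof -
    have "(\<lambda>k. (- \<i> * of_real t * ?w x) ^ k /\<^sub>R fact k) sums exp (- \<i> * of_real t * ?w x)" by (rule exp_converges)
    moreover have "exp (- \<i> * of_real t * ?w x) = cis (- (t * dispersion \<alpha> x))" by (simp add: cis_conv_exp mult.assoc)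
    moreover have "y /\<^sub>R fact k = y / fact k" for y :: complex and k
      by (simp add: scaleR_conv_of_real divide_inverse mult.commute)
    ultimately have "(\<lambda>k. (- \<i> * of_real t * ?w x) ^ k / fact k) sums cis (- (t * dispersion \<alpha> x))" by (simp only:)
    from sums_mult2[OF this, of "?e x"] show ?thesis by (rule sums_unique[symmetric])
  qed
  ultimately have "(\<lambda>k. integral {0..2 * pi} (?g k)) sums
      integral {0..2 * pi} (\<lambda>x. cis (- (t * dispersion \<alpha> x)) * ?e x)" by simp
  from sums_mult[OF this, of "z / of_real (2 * pi)"]
  have 1: "(\<lambda>k. z / of_real (2 * pi) * integral {0..2 * pi} (?g k)) sums
      (z / of_real (2 * pi) * integral {0..2 * pi} (\<lambda>x. cis (- (t * dispersion \<alpha> x)) * ?e x))" .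
  have "(\<lambda>k. coord (((- \<i> * of_real t) ^ k / fact k) *\<^sub>C (L ^^ k) (single m z)) n) sums coord (U t (single m z)) n"
    by (rule bounded_linear.sums[OF bounded_linear_coord linear_flow_sums[OF J]])
  moreover have "coord (((- \<i> * of_real t) ^ k / fact k) *\<^sub>C (L ^^ k) (single m z)) n
      = z / of_real (2 * pi) * integral {0..2 * pi} (?g k)" for k
  proof -
    have "z / of_real (2 * pi) * integral {0..2 * pi} (?g k) = integral {0..2 * pi} (\<lambda>x. z / of_real (2 * pi) * ?g k x)"
      by simp
    also have "\<dots> = integral {0..2 * pi} (\<lambda>x. (- \<i> * of_real t) ^ k / fact k *
        (?w x ^ k * (z / of_real (2 * pi)) * ?e x))"
      unfolding power_mult_distrib[of "- \<i> * of_real t"]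
      by (intro integral_cong) (simp add: mult_ac del: of_int_diff)
    finally show ?thesis by (simp add: coord_lap_pow_single)
  qed
  ultimately show ?thesis using 1 sums_unique2 by fastforce
qed

definition decay_rate :: real where
  "decay_rate = (if \<alpha> \<le> 1 then 1 / 2 else 1 / 3)"

lemma dispersive_estimate:
  "\<exists>C\<ge>0. \<forall>t m z n. t \<noteq> 0 \<longrightarrow> cmod (coord (U t (single m z)) n) \<le> C * cmod z * \<bar>t\<bar> powr (- decay_rate)"
proof -
  have "\<exists>C\<ge>0. \<forall>t>0. \<forall>\<nu>. cmod (integral {0..2 * pi} (\<lambda>x. cis (t * dispersion \<alpha> x - \<nu> * x))) \<le> C * t powr (- decay_rate)"
    using dispersive_integral_alpha_le_1[OF \<alpha>] dispersive_integral_alpha_gt_1[of \<alpha>]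
    by (cases "\<alpha> \<le> 1") (simp_all add: decay_rate_def)
  then obtain C where C: "0 \<le> C"
    "\<And>t \<nu>. 0 < t \<Longrightarrow> cmod (integral {0..2 * pi} (\<lambda>x. cis (t * dispersion \<alpha> x - \<nu> * x))) \<le> C * t powr (- decay_rate)"
    by blast
  have "cmod (coord (U t (single m z)) n) \<le> (C / (2 * pi)) * cmod z * \<bar>t\<bar> powr (- decay_rate)" if t: "t \<noteq> 0" for t m z n
  proof -
    let ?I = "integral {0..2 * pi} (\<lambda>x. cis (- (t * dispersion \<alpha> x)) * cis (real_of_int (n - m) * x))"
    have "cmod ?I \<le> C * \<bar>t\<bar> powr (- decay_rate)"
    \<comment> \<open>The integral bounds assume positive time. The flow carries the phase -t times
      the symbol, so positive t is treated by conjugation and negative t directly.\<close>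
    proof (cases "0 < t")
      case True
      have "?I = integral {0..2 * pi} (\<lambda>x. cnj (cis (t * dispersion \<alpha> x - real_of_int (n - m) * x)))"
        by (intro integral_cong) (simp add: cis_cnj cis_mult algebra_simps)
      also have "\<dots> = cnj (integral {0..2 * pi} (\<lambda>x. cis (t * dispersion \<alpha> x - real_of_int (n - m) * x)))"
        by (rule integral_cnj[symmetric])
      finally show ?thesis using C(2)[OF True] True by simp
    next
      case False
      have "?I = integral {0..2 * pi} (\<lambda>x. cis ((- t) * dispersion \<alpha> x - (- real_of_int (n - m)) * x))"
        by (intro integral_cong) (simp add: cis_mult algebra_simps)
      thus ?thesis using C(2)[of "- t" "- real_of_int (n - m)"] False t by (simp only:) simp
    qed
    from mult_left_mono[OF this, of "cmod z / (2 * pi)"] show ?thesis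
      unfolding coord_U_single norm_mult norm_divide by (simp add: mult_ac)
  qed
  thus ?thesis using C(1) by (intro exI[of _ "C / (2 * pi)"]) simp
qed

end

section \<open>Duality and the Strichartz estimate at discrete times\<close>

lemma norm_single: "norm (single n z) = cmod z"
proof -
  have "Re (cnj z * z) = (cmod z)\<^sup>2" by (simp add: cmod_power2) (simp add: power2_eq_square)
  thus ?thesis by (simp only: norm_eq_sqrt_inner inner_single coord_single if_True) simp
qed

lemma unimodular_phase: "\<exists>z. cmod z = 1 \<and> Re (cnj z * c) = cmod c"
proof (cases "c = 0")
  case False
  have "cnj c * c = of_real (cmod c) * of_real (cmod c)"
    using complex_norm_square[of c] by (simp add: power2_eq_square mult.commute)
  moreover have "cnj (sgn c) * c = cnj c * c / of_real (cmod c)"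
    unfolding sgn_eq complex_cnj_divide complex_cnj_complex_of_real by (rule times_divide_eq_left)
  ultimately have "cnj (sgn c) * c = of_real (cmod c)" using False by simp
  thus ?thesis using False by (metis Re_complex_of_real norm_sgn)
qed (simp add: exI[of _ 1])

text \<open>Summation by parts: w(k) is w(0) plus the increments before k, so each increment is
  paired with a tail sum of g. Assuming the bound for all index sets makes it available for
  tails.\<close>

lemma inner_sum_le_variation:
  fixes w g :: "nat \<Rightarrow> 'a::real_inner"
  assumes D: "\<And>S. S \<subseteq> {..<N} \<Longrightarrow> norm (sum g S) \<le> D"
  shows "(\<Sum>k<N. w k \<bullet> g k) \<le> (norm (w 0) + (\<Sum>i<N - 1. norm (w (Suc i) - w i))) * D"
proof -
  let ?d = "\<lambda>i. w (Suc i) - w i"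
  have w: "w k = w 0 + (\<Sum>i<N - 1. of_bool (i < k) *\<^sub>R ?d i)" if "k < N" for k
  proof -
    have "(\<Sum>i<N - 1. of_bool (i < k) *\<^sub>R ?d i) = (\<Sum>i<k. ?d i)"
      using that by (intro sum.mono_neutral_cong_right) auto
    thus ?thesis by (simp add: sum_lessThan_telescope)
  qed
  have "(\<Sum>k<N. w k \<bullet> g k) = (\<Sum>k<N. w 0 \<bullet> g k + (\<Sum>i<N - 1. ?d i \<bullet> (of_bool (i < k) *\<^sub>R g k)))"
  proof (intro sum.cong refl)
    fix k assume "k \<in> {..<N}"
    hence "w k \<bullet> g k = (w 0 + (\<Sum>i<N - 1. of_bool (i < k) *\<^sub>R ?d i)) \<bullet> g k"
      by (intro arg_cong[where f = "\<lambda>v. v \<bullet> g k"] w) simp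
    thus "w k \<bullet> g k = w 0 \<bullet> g k + (\<Sum>i<N - 1. ?d i \<bullet> (of_bool (i < k) *\<^sub>R g k))"
      by (simp add: inner_add_left inner_sum_left)
  qed
  also have "\<dots> = w 0 \<bullet> (\<Sum>k<N. g k) + (\<Sum>i<N - 1. ?d i \<bullet> (\<Sum>k<N. of_bool (i < k) *\<^sub>R g k))"
    unfolding sum.distrib inner_sum_right[symmetric] by (subst sum.swap) (simp only: inner_sum_right)
  also have "\<dots> \<le> norm (w 0) * D + (\<Sum>i<N - 1. norm (?d i) * D)"
  proof (intro add_mono sum_mono)
    have "w 0 \<bullet> (\<Sum>k<N. g k) \<le> norm (w 0) * norm (\<Sum>k<N. g k)" by (rule norm_cauchy_schwarz)
    also have "\<dots> \<le> norm (w 0) * D" by (intro mult_left_mono D) auto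
    finally show "w 0 \<bullet> (\<Sum>k<N. g k) \<le> norm (w 0) * D" .
    fix i
    have "(\<Sum>k<N. of_bool (i < k) *\<^sub>R g k) = sum g {k\<in>{..<N}. i < k}"
      by (rule sum.mono_neutral_cong_right) auto
    moreover have "norm (sum g {k\<in>{..<N}. i < k}) \<le> D" by (rule D) auto
    ultimately have "norm (?d i) * norm (\<Sum>k<N. of_bool (i < k) *\<^sub>R g k) \<le> norm (?d i) * D"
      by (intro mult_left_mono) auto
    thus "?d i \<bullet> (\<Sum>k<N. of_bool (i < k) *\<^sub>R g k) \<le> norm (?d i) * D"
      using norm_cauchy_schwarz order_trans by blast
  qed
  finally show ?thesis by (simp add: distrib_right sum_distrib_right)
qed

context power_law
begin

definition admissible_exponent :: nat where
  "admissible_exponent = (if \<alpha> \<le> 1 then 4 else 6)"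

lemma decay_rate_eq: "decay_rate = 2 / real admissible_exponent" and admissible_exponent_ge: "4 \<le> admissible_exponent"
  by (simp_all add: decay_rate_def admissible_exponent_def)

text \<open>The \<open>\<ell>\<^sup>\<infinity>\<close> norm is tested at arbitrary sites; duality then involves point masses only, for which
  the dispersive estimate controls the kernel of the bilinear form without any interpolation.\<close>
lemma strichartz_sites:
  "\<exists>C\<ge>0. \<forall>N w \<tau> s n. \<bar>s\<bar> = 1 \<longrightarrow>
    (\<Sum>k<N. cmod (coord (U (s * (real k + \<tau>)) (w k)) (n k)) ^ admissible_exponent)
      \<le> (C * (norm (w 0) + (\<Sum>i<N - 1. norm (w (Suc i) - w i)))) ^ admissible_exponent"
proof -
  define q where "q = admissible_exponent"
  have q: "4 \<le> q" using admissible_exponent_ge by (simp add: q_def)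
  define g where "g = decay_rate"
  have g: "0 < g" "g < 1" "g = 2 / real q" by (auto simp: g_def q_def decay_rate_eq admissible_exponent_def)
  obtain C0 where C0: "0 \<le> C0" "\<And>t m z n. t \<noteq> 0 \<Longrightarrow> cmod (coord (U t (single m z)) n) \<le> C0 * cmod z * \<bar>t\<bar> powr (- g)"
    using dispersive_estimate unfolding g_def by blast
  obtain H where H: "0 \<le> H" "\<And>N c. (\<forall>j. 0 \<le> c j) \<Longrightarrow>
      (\<Sum>j<N. \<Sum>k<N. c j * c k * (max 1 \<bar>real j - real k\<bar>) powr (- g)) \<le> H * (\<Sum>j<N. c j powr (1 / (1 - g / 2))) powr (2 - g)"
    using hardy_littlewood_sobolev_nat[OF g(1,2)] by blast
  define C1 where "C1 = max 1 C0"
  define C where "C = sqrt (C1 * H)"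
  have "(\<Sum>k<N. cmod (coord (U (s * (real k + \<tau>)) (w k)) (n k)) ^ q)
      \<le> (C * (norm (w 0) + (\<Sum>i<N - 1. norm (w (Suc i) - w i)))) ^ q"
    if s: "\<bar>s\<bar> = 1" for N w \<tau> s n
  proof -
    define t where "t = (\<lambda>k. s * (real k + \<tau>))"
    define x where "x = (\<lambda>k. cmod (coord (U (t k) (w k)) (n k)))"
    have x0: "0 \<le> x k" for k by (simp add: x_def)
    define X where "X = (\<Sum>k<N. x k ^ q)"
    define V where "V = norm (w 0) + (\<Sum>i<N - 1. norm (w (Suc i) - w i))"
    have V: "0 \<le> V" by (simp add: V_def sum_nonneg)
    have X: "0 \<le> X" by (simp add: X_def sum_nonneg x0)
    have "\<forall>k. \<exists>z. cmod z = 1 \<and> Re (cnj z * coord (U (t k) (w k)) (n k)) = x k"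
      unfolding x_def by (intro allI unimodular_phase)
    from choice[OF this] obtain z where z: "\<And>k. cmod (z k) = 1"
      "\<And>k. Re (cnj (z k) * coord (U (t k) (w k)) (n k)) = x k" by blast
    define e where "e = (\<lambda>k. single (n k) (z k))"
    \<comment> \<open>The dual weight: tested against \<open>G\<close>, the data reproduce the sum
      of x(k)^q. The phases \<open>z\<close> make every pairing real and nonnegative.\<close>
    define c where "c = (\<lambda>k. x k ^ (q - 1))"
    have c: "0 \<le> c k" for k by (simp add: c_def x0)
    define G where "G = (\<lambda>k. c k *\<^sub>R U (- t k) (e k))"
    have wG: "w k \<bullet> G k = x k ^ q" for k
    proof -
      have "w k \<bullet> U (- t k) (e k) = e k \<bullet> U (t k) (w k)"
        by (metis inner_U inner_commute)
      also have "\<dots> = x k" unfolding e_def inner_single by (rule z(2))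
      finally have "w k \<bullet> G k = x k ^ (q - 1) * x k" by (simp add: G_def c_def)
      also have "\<dots> = x k ^ q" using q by (cases q) simp_all
      finally show ?thesis .
    qed
    \<comment> \<open>Differences of sample times are s(j - k), so \<tau> drops out. Off the
      diagonal the dispersive estimate applies, on it unitarity gives the bound 1; hence the maximum
      in \<open>C1\<close>.\<close>
    have kernel: "U (- t j) (e j) \<bullet> U (- t k) (e k) \<le> C1 * (max 1 \<bar>real j - real k\<bar>) powr (- g)" for j k
    proof -
      have "U (- t j) (e j) \<bullet> U (- t k) (e k) = e j \<bullet> U (t j - t k) (e k)"
        by (simp add: inner_U flip: U_add_time)
      also have "\<dots> \<le> cmod (cnj (z j) * coord (U (t j - t k) (e k)) (n j))"
        unfolding e_def[of] inner_single by (rule complex_Re_le_cmod)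
      also have "\<dots> = cmod (coord (U (t j - t k) (e k)) (n j))" by (simp add: norm_mult z)
      also have "\<dots> \<le> C1 * (max 1 \<bar>real j - real k\<bar>) powr (- g)"
      proof (cases "j = k")
        case True
        have "cmod (coord (U (t j - t k) (e k)) (n j)) \<le> norm (e k)"
          using cmod_coord_le[of "U (t j - t k) (e k)" "n j"] by simp
        also have "\<dots> = 1" by (simp add: e_def norm_single z)
        finally show ?thesis using True by (simp add: C1_def)
      next
        case False
        have tt: "t j - t k = s * (real j - real k)" by (simp add: t_def algebra_simps)
        have "t j - t k \<noteq> 0" using False s unfolding tt by auto
        from C0(2)[OF this, of "n k" "z k" "n j"]
        have "cmod (coord (U (t j - t k) (e k)) (n j)) \<le> C0 * \<bar>real j - real k\<bar> powr (- g)"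
          by (simp add: e_def z tt abs_mult s)
        also have "\<bar>real j - real k\<bar> = max 1 \<bar>real j - real k\<bar>" using False by linarith
        also have "C0 * (max 1 \<bar>real j - real k\<bar>) powr (- g) \<le> C1 * (max 1 \<bar>real j - real k\<bar>) powr (- g)"
          by (intro mult_right_mono) (auto simp: C1_def)
        finally show ?thesis .
      qed
      finally show ?thesis .
    qed
    have "norm (sum G S) \<le> C * X powr (1 - 1 / real q)" if S: "S \<subseteq> {..<N}" for S
    proof -
      have "(norm (sum G S))\<^sup>2 = (\<Sum>j\<in>S. \<Sum>k\<in>S. c j * c k * (U (- t j) (e j) \<bullet> U (- t k) (e k)))"
        unfolding power2_norm_eq_inner inner_sum_left unfolding inner_sum_right
        by (simp add: G_def mult_ac)
      also have "\<dots> \<le> (\<Sum>j\<in>S. \<Sum>k\<in>S. c j * c k * (C1 * (max 1 \<bar>real j - real k\<bar>) powr (- g)))"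
        by (intro sum_mono mult_left_mono kernel mult_nonneg_nonneg c)
      also have "\<dots> \<le> (\<Sum>j\<in>S. \<Sum>k<N. c j * c k * (C1 * (max 1 \<bar>real j - real k\<bar>) powr (- g)))"
        using S by (intro sum_mono sum_mono2) (auto simp: c C1_def)
      also have "\<dots> \<le> (\<Sum>j<N. \<Sum>k<N. c j * c k * (C1 * (max 1 \<bar>real j - real k\<bar>) powr (- g)))"
        using S by (intro sum_mono2) (auto simp: c C1_def intro!: sum_nonneg)
      also have "\<dots> = C1 * (\<Sum>j<N. \<Sum>k<N. c j * c k * (max 1 \<bar>real j - real k\<bar>) powr (- g))"
        by (simp add: sum_distrib_left mult_ac)
      also have "\<dots> \<le> C1 * (H * (\<Sum>j<N. c j powr (1 / (1 - g / 2))) powr (2 - g))"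
        by (intro mult_left_mono H) (auto simp: c C1_def)
      \<comment> \<open>With g = 2/q the exponent 1/(1 - g/2) is q/(q - 1), conjugate to q, so the
        right side is a power of the sum X being estimated.\<close>
      also have "c j powr (1 / (1 - g / 2)) = x j ^ q" for j
      proof -
        have "1 / (1 - g / 2) = real q / real (q - 1)" using q by (simp add: g(3) field_simps of_nat_diff)
        moreover have "c j = x j powr real (q - 1)"
          using x0[of j] q by (cases "x j = 0") (auto simp: c_def powr_realpow simp del: of_nat_diff)
        moreover have "x j ^ q = x j powr real q"
          using x0[of j] q by (cases "x j = 0") (auto simp: powr_realpow)
        ultimately show ?thesis using q by (simp add: powr_powr)
      qed
      hence "(\<Sum>j<N. c j powr (1 / (1 - g / 2))) = X" by (simp add: X_def)
      finally have "(norm (sum G S))\<^sup>2 \<le> C1 * (H * X powr (2 - g))" by simp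
      also have "\<dots> = (C * X powr (1 - 1 / real q))\<^sup>2"
      proof -
        have "(X powr (1 - 1 / real q))\<^sup>2 = X powr (2 - g)"
          by (simp add: power2_eq_square g(3) flip: powr_add)
        moreover have "C\<^sup>2 = C1 * H" using H by (simp add: C_def C1_def)
        ultimately show ?thesis by (simp add: power_mult_distrib)
      qed
      finally have sq: "(norm (sum G S))\<^sup>2 \<le> (C * X powr (1 - 1 / real q))\<^sup>2" .
      have "0 \<le> C" using H by (simp add: C_def C1_def)
      thus ?thesis by (intro power2_le_imp_le[OF sq] mult_nonneg_nonneg) simp_all
    qed
    from inner_sum_le_variation[of N G, OF this, of w]
    have le: "X \<le> V * (C * X powr (1 - 1 / real q))" by (simp add: wG X_def V_def)
    \<comment> \<open>X is a finite sum, so the factor X^(1 - 1/q) may be divided out as soon as X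
      is nonzero.\<close>
    have "X \<le> (C * V) ^ q"
    proof (cases "X = 0")
      case False
      hence X': "0 < X" using X by simp
      have "X = X powr (1 / real q) * X powr (1 - 1 / real q)" using X' by (simp flip: powr_add)
      hence "X powr (1 / real q) * X powr (1 - 1 / real q) \<le> (C * V) * X powr (1 - 1 / real q)" using le by (simp add: mult_ac)
      hence "X powr (1 / real q) \<le> C * V" using X' by simp
      hence "(X powr (1 / real q)) ^ q \<le> (C * V) ^ q" by (intro power_mono) auto
      moreover have "(X powr (1 / real q)) ^ q = X" using X' q by (simp add: powr_powr flip: powr_realpow)
      ultimately show ?thesis by simp
    qed (use V H in \<open>simp add: C_def C1_def\<close>)
    thus ?thesis by (simp add: X_def V_def x_def t_def)
  qed
  moreover have "0 \<le> C" using H by (simp add: C_def C1_def)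
  ultimately show ?thesis unfolding q_def by blast
qed

text \<open>\<open>strichartz_sites\<close> is uniform in the sites, so a nearly maximizing site can
  be chosen separately at each time.\<close>

lemma strichartz:
  "\<exists>C\<ge>0. \<forall>N w \<tau> s. \<bar>s\<bar> = 1 \<longrightarrow>
    (\<Sum>k<N. sup_norm (U (s * (real k + \<tau>)) (w k)) ^ admissible_exponent)
      \<le> (C * (norm (w 0) + (\<Sum>i<N - 1. norm (w (Suc i) - w i)))) ^ admissible_exponent"
proof -
  obtain C where C: "0 \<le> C" "\<And>N w \<tau> s n. \<bar>s\<bar> = 1 \<Longrightarrow>
    (\<Sum>k<N. cmod (coord (U (s * (real k + \<tau>)) (w k)) (n k)) ^ admissible_exponent)
      \<le> (C * (norm (w 0) + (\<Sum>i<N - 1. norm (w (Suc i) - w i)))) ^ admissible_exponent"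
    using strichartz_sites by blast
  let ?q = admissible_exponent
  have "(\<Sum>k<N. sup_norm (U (s * (real k + \<tau>)) (w k)) ^ ?q)
      \<le> ((2 * C) * (norm (w 0) + (\<Sum>i<N - 1. norm (w (Suc i) - w i)))) ^ ?q"
    if s: "\<bar>s\<bar> = 1" for N w \<tau> s
  proof -
    have "\<forall>k. \<exists>n. sup_norm (U (s * (real k + \<tau>)) (w k)) \<le> 2 * cmod (coord (U (s * (real k + \<tau>)) (w k)) n)"
      by (intro allI sup_norm_half_attained)
    from choice[OF this] obtain n where
      n: "\<And>k. sup_norm (U (s * (real k + \<tau>)) (w k)) \<le> 2 * cmod (coord (U (s * (real k + \<tau>)) (w k)) (n k))"
      by blast
    have "(\<Sum>k<N. sup_norm (U (s * (real k + \<tau>)) (w k)) ^ ?q)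
        \<le> (\<Sum>k<N. (2 * cmod (coord (U (s * (real k + \<tau>)) (w k)) (n k))) ^ ?q)"
      by (intro sum_mono power_mono n sup_norm_nonneg)
    also have "\<dots> = 2 ^ ?q * (\<Sum>k<N. cmod (coord (U (s * (real k + \<tau>)) (w k)) (n k)) ^ ?q)"
      by (simp add: power_mult_distrib sum_distrib_left)
    also have "\<dots> \<le> 2 ^ ?q * (C * (norm (w 0) + (\<Sum>i<N - 1. norm (w (Suc i) - w i)))) ^ ?q"
      by (intro mult_left_mono C(2) s) simp
    finally show ?thesis by (simp add: power_mult_distrib mult.assoc)
  qed
  thus ?thesis using C(1) by (intro exI[of _ "2 * C"]) auto
qed

end

section \<open>Global solutions\<close>

text \<open>A signed integral based at 0, since the integral over an empty interval would vanish for
  negative t. It gives one integral equation on the whole time axis.\<close>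

definition primitive :: "(real \<Rightarrow> 'a::banach) \<Rightarrow> real \<Rightarrow> 'a" where
  "primitive g t = (if 0 \<le> t then integral {0..t} g else - integral {t..0} g)"

lemma primitive_deriv:
  assumes g: "continuous_on UNIV g"
  shows "(primitive g has_vector_derivative g t) (at t)"
proof -
  define T where "T = \<bar>t\<bar> + 1"
  have int: "g integrable_on {a..b}" for a b
    by (rule integrable_continuous_interval[OF continuous_on_subset[OF g]]) simp
  have eq: "integral {- T..s} g - integral {- T..0} g = primitive g s" if "s \<in> {- T<..<T}" for s
  proof (cases "0 \<le> s")
    case True
    thus ?thesis
      using Henstock_Kurzweil_Integration.integral_combine[OF _ True int, of "- T"] that
      by (simp add: primitive_def algebra_simps)
  next
    case False
    thus ?thesis
      using Henstock_Kurzweil_Integration.integral_combine[of "- T" s 0, OF _ _ int] that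
      by (simp add: primitive_def algebra_simps)
  qed
  have "((\<lambda>s. integral {- T..s} g) has_vector_derivative g t) (at t within {- T..T})"
    by (rule integral_has_vector_derivative[OF continuous_on_subset[OF g]]) (auto simp: T_def)
  hence "((\<lambda>s. integral {- T..s} g) has_vector_derivative g t) (at t)"
    by (subst (asm) at_within_interior) (auto simp: T_def)
  from has_vector_derivative_diff[OF this has_vector_derivative_const[of "integral {- T..0} g"]]
  have "((\<lambda>s. integral {- T..s} g - integral {- T..0} g) has_vector_derivative g t) (at t)" by simp
  thus ?thesis
    by (rule has_vector_derivative_transform_within_open[OF _ open_greaterThanLessThan _ eq]) (auto simp: T_def)
qed

text \<open>Integration gains 1/M in the exponentially weighted norm; this is the source of the
  contraction factor in the Picard iteration.\<close>

lemma norm_primitive_le: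
  assumes g: "continuous_on UNIV g" and M: "0 < M" and le: "\<And>s. norm (g s) \<le> c * exp (M * \<bar>s\<bar>)"
  shows "norm (primitive g t) \<le> c / M * exp (M * \<bar>t\<bar>)"
proof -
  have c: "0 \<le> c" using le[of 0] norm_ge_zero[of "g 0"] by (simp del: norm_ge_zero)
  have int: "g integrable_on {a..b}" for a b
    by (rule integrable_continuous_interval[OF continuous_on_subset[OF g]]) simp
  show ?thesis
  proof (cases "0 \<le> t")
    case True
    have hi: "((\<lambda>s. c * exp (M * s)) has_integral (c / M * exp (M * t) - c / M * exp (M * 0))) {0..t}"
      using M by (intro fundamental_theorem_of_calculus[OF True])
        (auto intro!: derivative_eq_intros simp flip: has_real_derivative_iff_has_vector_derivative)
    have "norm (integral {0..t} g) \<le> integral {0..t} (\<lambda>s. c * exp (M * s))"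
    proof (rule integral_norm_bound_integral[OF int has_integral_integrable[OF hi]])
      show "norm (g s) \<le> c * exp (M * s)" if "s \<in> {0..t}" for s
        using le[of s] that by simp
    qed
    hence "norm (integral {0..t} g) \<le> c / M * exp (M * t) - c / M"
      unfolding integral_unique[OF hi] by simp
    moreover have "0 \<le> c / M" using c M by simp
    ultimately show ?thesis using True by (simp add: primitive_def)
  next
    case False
    have hi: "((\<lambda>s. c * exp (- (M * s))) has_integral (- (c / M * exp (- (M * 0))) - - (c / M * exp (- (M * t))))) {t..0}"
      using M False by (intro fundamental_theorem_of_calculus)
        (auto intro!: derivative_eq_intros simp flip: has_real_derivative_iff_has_vector_derivative)
    have "norm (integral {t..0} g) \<le> integral {t..0} (\<lambda>s. c * exp (- (M * s)))"
    proof (rule integral_norm_bound_integral[OF int has_integral_integrable[OF hi]])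
      show "norm (g s) \<le> c * exp (- (M * s))" if "s \<in> {t..0}" for s
        using le[of s] that by simp
    qed
    hence "norm (integral {t..0} g) \<le> c / M * exp (- (M * t)) - c / M"
      unfolding integral_unique[OF hi] by simp
    moreover have "0 \<le> c / M" using c M by simp
    ultimately show ?thesis using False by (simp add: primitive_def)
  qed
qed

lemma primitive_diff:
  assumes "continuous_on UNIV f" "continuous_on UNIV g"
  shows "primitive (\<lambda>s. f s - g s) t = primitive f t - primitive g t"
proof -
  have "f integrable_on {a..b}" "g integrable_on {a..b}" for a b
    by (intro integrable_continuous_interval continuous_on_subset[OF assms(1)] continuous_on_subset[OF assms(2)]; simp)+
  thus ?thesis by (simp add: primitive_def integral_diff)
qed

text \<open>The Picard map contracts in the norm \<open>sup\<^sub>t exp(- M |t|) \<parallel>u(t)\<parallel>\<close> when \<open>M\<close> is twice the Lipschitz constant.\<close>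
lemma global_solution_exists:
  fixes f :: "'a::banach \<Rightarrow> 'a"
  assumes B: "0 < B" and lip: "\<And>x y. norm (f x - f y) \<le> B * norm (x - y)" and f0: "f 0 = 0"
  shows "\<exists>u. u 0 = \<phi> \<and> (\<forall>t. (u has_vector_derivative f (u t)) (at t))"
proof -
  have fcont: "continuous_on UNIV f"
    by (rule lipschitz_on_continuous_on[of B], rule lipschitz_onI) (use lip B in \<open>auto simp: dist_norm\<close>)
  define M where "M = 2 * B"
  have M: "0 < M" using B by (simp add: M_def)
  \<comment> \<open>The unknown v is the solution divided by exp(M |t|). It ranges over bounded
    continuous functions, a complete space, and \<open>g\<close> is the right-hand side in the
    original variable.\<close>
  define g where "g = (\<lambda>v s. f (exp (M * \<bar>s\<bar>) *\<^sub>R apply_bcontfun v s))"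
  have gcont: "continuous_on UNIV (g v)" for v
    unfolding g_def by (intro continuous_on_compose2[OF fcont] continuous_intros) auto
  have gdiff: "norm (g v s - g w s) \<le> (B * norm (v - w)) * exp (M * \<bar>s\<bar>)" for v w s
  proof -
    have "norm (g v s - g w s) \<le> B * norm (exp (M * \<bar>s\<bar>) *\<^sub>R (apply_bcontfun v s - apply_bcontfun w s))"
      unfolding g_def scaleR_diff_right by (rule lip)
    also have "\<dots> = B * (exp (M * \<bar>s\<bar>) * norm (apply_bcontfun (v - w) s))" by simp
    also have "\<dots> \<le> B * (exp (M * \<bar>s\<bar>) * norm (v - w))"
      using B by (intro mult_left_mono norm_bounded) auto
    finally show ?thesis by (simp add: mult_ac)
  qed
  have g0: "g 0 s = 0" for s by (simp add: g_def f0)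
  have gle: "norm (g v s) \<le> (B * norm v) * exp (M * \<bar>s\<bar>)" for v s
    using gdiff[of v s 0] by (simp add: g0)
  define P where "P = (\<lambda>v t. exp (- (M * \<bar>t\<bar>)) *\<^sub>R (\<phi> + primitive (g v) t))"
  have Pb: "P v \<in> bcontfun" for v
  proof (rule bcontfun_normI)
    have "continuous_on UNIV (primitive (g v))"
      by (intro continuous_at_imp_continuous_on ballI has_vector_derivative_continuous[OF primitive_deriv[OF gcont]])
    thus "continuous_on UNIV (P v)" unfolding P_def by (intro continuous_intros)
    fix t
    have "norm (P v t) \<le> exp (- (M * \<bar>t\<bar>)) * (norm \<phi> + B * norm v / M * exp (M * \<bar>t\<bar>))"
      unfolding P_def norm_scaleR
      by (intro mult_mono norm_triangle_mono norm_primitive_le[OF gcont M gle]) auto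
    also have "\<dots> = exp (- (M * \<bar>t\<bar>)) * norm \<phi> + B * norm v / M"
      by (simp add: distrib_left mult.left_commute exp_minus)
    also have "\<dots> \<le> 1 * norm \<phi> + B * norm v / M"
      using M by (intro add_mono mult_right_mono) auto
    finally show "norm (P v t) \<le> norm \<phi> + B * norm v / M" by simp
  qed
  define F where "F = (\<lambda>v. Bcontfun (P v))"
  have F: "apply_bcontfun (F v) = P v" for v unfolding F_def by (rule Bcontfun_inverse[OF Pb])
  have "dist (F v) (F w) \<le> 1 / 2 * dist v w" for v w
  proof (rule dist_bound)
    fix t
    have "dist (apply_bcontfun (F v) t) (apply_bcontfun (F w) t) = exp (- (M * \<bar>t\<bar>)) * norm (primitive (\<lambda>s. g v s - g w s) t)"
      by (simp add: F P_def dist_norm primitive_diff[OF gcont gcont] flip: scaleR_diff_right)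
    also have "\<dots> \<le> exp (- (M * \<bar>t\<bar>)) * (B * norm (v - w) / M * exp (M * \<bar>t\<bar>))"
      by (intro mult_left_mono norm_primitive_le[OF _ M gdiff] continuous_intros gcont) auto
    also have "\<dots> = B * norm (v - w) / M" by (simp add: mult.left_commute exp_minus)
    also have "\<dots> = 1 / 2 * dist v w" using B by (simp add: M_def dist_norm)
    finally show "dist (apply_bcontfun (F v) t) (apply_bcontfun (F w) t) \<le> 1 / 2 * dist v w" .
  qed
  hence "\<exists>!v. F v = v" by (intro banach_fix_type[of "1 / 2"]) auto
  then obtain v where v: "F v = v" by blast
  define u where "u = (\<lambda>t. exp (M * \<bar>t\<bar>) *\<^sub>R apply_bcontfun v t)"
  have u: "u t = \<phi> + primitive (g v) t" for t
  proof -
    have "u t = exp (M * \<bar>t\<bar>) *\<^sub>R P v t" unfolding u_def by (metis F v)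
    thus ?thesis by (simp add: P_def flip: exp_add)
  qed
  have "(u has_vector_derivative f (u t)) (at t)" for t
  proof -
    have "((\<lambda>t. \<phi> + primitive (g v) t) has_vector_derivative g v t) (at t)"
      by (rule has_vector_derivative_eq_rhs[OF has_vector_derivative_add[OF has_vector_derivative_const primitive_deriv[OF gcont]]]) simp
    moreover have "u = (\<lambda>t. \<phi> + primitive (g v) t)" using u by blast
    moreover have "g v t = f (u t)" by (simp add: g_def u_def)
    ultimately show ?thesis by simp
  qed
  moreover have "u 0 = \<phi>" by (simp add: u primitive_def)
  ultimately show ?thesis by blast
qed

text \<open>The squared norm times exp(-2Bt) decreases on the positive axis, and times exp(2Bt) it
  increases on the negative one; it starts from 0 in both directions.\<close>

lemma gronwall_zero:
  fixes z :: "real \<Rightarrow> 'a::real_inner"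
  assumes z: "\<And>t. (z has_vector_derivative z' t) (at t)" and le: "\<And>t. norm (z' t) \<le> B * norm (z t)" and 0: "z 0 = 0"
  shows "z t = 0"
proof -
  have b: "\<bar>z t \<bullet> z' t\<bar> \<le> B * (z t \<bullet> z t)" for t
  proof -
    have "\<bar>z t \<bullet> z' t\<bar> \<le> norm (z t) * norm (z' t)" by (rule Cauchy_Schwarz_ineq2)
    also have "\<dots> \<le> norm (z t) * (B * norm (z t))" by (intro mult_left_mono le) simp
    also have "\<dots> = B * (z t \<bullet> z t)" by (simp add: power2_norm_eq_inner[symmetric] power2_eq_square)
    finally show ?thesis .
  qed
  have d: "((\<lambda>t. exp (c * t) * (z t \<bullet> z t)) has_real_derivative exp (c * t) * (c * (z t \<bullet> z t) + 2 * (z t \<bullet> z' t))) (at t)" for c t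
    by (rule derivative_eq_intros refl has_vector_derivative_inner_self[OF z] | simp add: algebra_simps)+
  have "exp (c * t) * (z t \<bullet> z t) \<le> exp (c * 0) * (z 0 \<bullet> z 0)" if "c = (if 0 \<le> t then - 2 * B else 2 * B)" for c
  proof (cases "0 \<le> t")
    case True
    show ?thesis
    proof (rule DERIV_nonpos_imp_nonincreasing[where f = "\<lambda>t. exp (c * t) * (z t \<bullet> z t)", OF True])
      fix s
      have "exp (c * s) * (c * (z s \<bullet> z s) + 2 * (z s \<bullet> z' s)) \<le> 0"
        using b[of s] that True by (simp add: mult_le_0_iff)
      thus "\<exists>y. ((\<lambda>t. exp (c * t) * (z t \<bullet> z t)) has_real_derivative y) (at s) \<and> y \<le> 0" using d by blast
    qed
  next
    case False
    show ?thesis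
    proof (rule DERIV_nonneg_imp_nondecreasing[where f = "\<lambda>t. exp (c * t) * (z t \<bullet> z t)" and a = t and b = 0])
      show "t \<le> 0" using False by simp
      fix s
      have "0 \<le> exp (c * s) * (c * (z s \<bullet> z s) + 2 * (z s \<bullet> z' s))"
        using b[of s] that False by (simp add: zero_le_mult_iff)
      thus "\<exists>y. ((\<lambda>t. exp (c * t) * (z t \<bullet> z t)) has_real_derivative y) (at s) \<and> 0 \<le> y" using d by blast
    qed
  qed
  from this[OF refl] have "z t \<bullet> z t \<le> 0" using 0 by (simp add: mult_le_0_iff)
  thus ?thesis by (metis inner_eq_zero_iff inner_ge_zero order_antisym)
qed

section \<open>The truncated power nonlinearity\<close>

lemma powr_minus_one_mult: "0 \<le> x \<Longrightarrow> x powr (r - 1) * x = x powr (r :: real)" for x :: real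
  using powr_add[of x "r - 1" 1] by (cases "x = 0") auto

lemma powr_diff_le_deriv:
  fixes x y r :: real
  assumes "0 \<le> y" "y \<le> x" "1 \<le> r"
  shows "x powr r - y powr r \<le> r * x powr (r - 1) * (x - y)"
proof -
  consider "y = 0" | "y = x" | "0 < y" "y < x" using assms by linarith
  thus ?thesis
  proof cases
    case 1
    have "x powr r \<le> r * x powr r" using mult_right_mono[OF assms(3), of "x powr r"] by simp
    thus ?thesis using 1 assms powr_minus_one_mult[of x r] by (simp add: mult.assoc)
  next
    case 3
    have "\<exists>z>y. z < x \<and> x powr r - y powr r = (x - y) * (r * z powr (r - 1))"
      by (rule MVT2[OF 3(2)]) (use 3 in \<open>auto intro!: derivative_eq_intros\<close>)
    then obtain z where z: "y < z" "z < x" "x powr r - y powr r = (x - y) * (r * z powr (r - 1))" by blast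
    have "z powr (r - 1) \<le> x powr (r - 1)" using z 3 assms by (intro powr_mono2) auto
    hence "(x - y) * (r * z powr (r - 1)) \<le> (x - y) * (r * x powr (r - 1))"
      using 3 assms by (intro mult_left_mono) auto
    thus ?thesis using z by (simp add: mult_ac)
  qed simp
qed

text \<open>Only the modulus inside the power is capped, so the map becomes globally Lipschitz but
  remains a real multiple of z. The truncated flow therefore still conserves the norm.\<close>

definition trunc_power :: "real \<Rightarrow> real \<Rightarrow> complex \<Rightarrow> complex" where
  "trunc_power M p z = of_real (min (cmod z) M powr (p - 1)) * z"

text \<open>Taking |b| \<le> |a|, the difference splits into a change of the vector, with constant
  M^(p-1), and a change of the scalar factor, with constant (p - 1) M^(p-1). The latter vanishes if
  both moduli exceed the cap and follows from the mean value theorem otherwise.\<close>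

lemma trunc_power_lipschitz:
  assumes p: "2 \<le> p" and M: "0 \<le> M"
  shows "cmod (trunc_power M p a - trunc_power M p b) \<le> p * M powr (p - 1) * cmod (a - b)"
proof (induction "cmod b" "cmod a" arbitrary: a b rule: linorder_wlog)
  case le
  let ?x = "min (cmod a) M" and ?y = "min (cmod b) M" and ?r = "p - 1"
  have xy: "0 \<le> ?y" "?y \<le> ?x" "?x \<le> M" using le M by auto
  have "(?x powr ?r - ?y powr ?r) * cmod b \<le> ?r * M powr ?r * cmod (a - b)"
  proof (cases "M \<le> cmod b")
    case True
    hence "?x = ?y" using le by simp
    thus ?thesis using p by simp
  next
    case False
    have "(?x powr ?r - ?y powr ?r) * cmod b \<le> (?r * ?x powr (?r - 1) * (?x - ?y)) * ?x"
      using False le p xy powr_diff_le_deriv[OF xy(1,2), of ?r]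
      by (intro mult_mono mult_nonneg_nonneg) auto
    also have "\<dots> = ?r * (?x powr (?r - 1) * ?x) * (?x - ?y)" by simp
    also have "?x powr (?r - 1) * ?x = ?x powr ?r"
      by (rule powr_minus_one_mult) (use xy in linarith)
    also have "?r * ?x powr ?r * (?x - ?y) \<le> ?r * M powr ?r * cmod (a - b)"
    proof (intro mult_mono)
      show "?x powr ?r \<le> M powr ?r" using xy p by (intro powr_mono2) auto
      show "?x - ?y \<le> cmod (a - b)" using False norm_triangle_ineq2[of a b] by simp
    qed (use p xy in auto)
    finally show ?thesis .
  qed
  moreover have "cmod (trunc_power M p a - trunc_power M p b)
      \<le> ?x powr ?r * cmod (a - b) + (?x powr ?r - ?y powr ?r) * cmod b"
  proof -
    have "trunc_power M p a - trunc_power M p b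
        = of_real (?x powr ?r) * (a - b) + of_real (?x powr ?r - ?y powr ?r) * b"
      by (simp add: trunc_power_def algebra_simps)
    moreover have "0 \<le> ?x powr ?r - ?y powr ?r" using xy p by (simp add: powr_mono2)
    hence "cmod (of_real (?x powr ?r - ?y powr ?r) * b) = (?x powr ?r - ?y powr ?r) * cmod b"
      by (simp only: norm_mult norm_of_real abs_of_nonneg)
    moreover have "cmod (of_real (?x powr ?r) * (a - b)) = ?x powr ?r * cmod (a - b)"
      by (simp add: norm_mult)
    ultimately show ?thesis by (metis norm_triangle_ineq)
  qed
  ultimately have "cmod (trunc_power M p a - trunc_power M p b)
      \<le> ?x powr ?r * cmod (a - b) + ?r * M powr ?r * cmod (a - b)" by linarith
  also have "?x powr ?r * cmod (a - b) \<le> M powr ?r * cmod (a - b)"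
    using xy p by (intro mult_right_mono powr_mono2) auto
  finally show ?case by (simp add: algebra_simps)
next
  case (sym a b)
  thus ?case by (simp add: norm_minus_commute)
qed

definition trunc_nonlin :: "real \<Rightarrow> real \<Rightarrow> 'a ell2 \<Rightarrow> 'a ell2" where
  "trunc_nonlin M p u = Abs_ell2 (\<lambda>x. trunc_power M p (coord u x))"

lemma coord_trunc_nonlin:
  assumes "2 \<le> p" "0 \<le> M"
  shows "coord (trunc_nonlin M p u) x = trunc_power M p (coord u x)"
proof -
  have "square_summable (\<lambda>x. trunc_power M p (coord u x))"
  proof (rule square_summable_dominated(1)[where c = "M powr (p - 1)" and v = u])
    show "cmod (trunc_power M p (coord u x)) \<le> M powr (p - 1) * cmod (coord u x)" for x
      using assms unfolding trunc_power_def norm_mult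
      by (intro mult_right_mono) (auto intro!: powr_mono2)
  qed simp
  thus ?thesis by (simp add: trunc_nonlin_def Abs_ell2_inverse)
qed

lemma trunc_nonlin_lipschitz:
  assumes "2 \<le> p" "0 \<le> M"
  shows "norm (trunc_nonlin M p u - trunc_nonlin M p v) \<le> p * M powr (p - 1) * norm (u - v)"
  by (rule ell2_norm_le) (use assms trunc_power_lipschitz[OF assms] in \<open>auto simp: coord_trunc_nonlin\<close>)

lemma trunc_nonlin_eq:
  assumes "2 \<le> p" "sup_norm u \<le> M"
  shows "trunc_nonlin M p u = nonlin p u"
proof (rule ell2_eqI)
  fix x
  have "cmod (coord u x) \<le> M" using cmod_coord_le_sup_norm[of u x] assms by linarith
  moreover have "0 \<le> M" using sup_norm_nonneg[of u] assms by linarith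
  ultimately show "coord (trunc_nonlin M p u) x = coord (nonlin p u) x"
    using assms by (simp add: coord_trunc_nonlin coord_nonlin trunc_power_def)
qed

lemma trunc_nonlin_0: "2 \<le> p \<Longrightarrow> 0 \<le> M \<Longrightarrow> trunc_nonlin M p 0 = 0"
  by (auto intro!: ell2_eqI simp: coord_trunc_nonlin trunc_power_def)

lemma inner_ii_trunc_nonlin:
  assumes "2 \<le> p" "0 \<le> M"
  shows "u \<bullet> (\<i> *\<^sub>C trunc_nonlin M p u) = 0"
proof -
  have "Re (cnj z * (\<i> * (of_real r * z))) = 0" for z r by simp
  thus ?thesis unfolding inner_ell2_def coord_scaleC coord_trunc_nonlin[OF assms] trunc_power_def by simp
qed

text \<open>Capping at the larger of the two supremum norms changes neither value, so the global
  Lipschitz bound for the truncation becomes a local one.\<close>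

lemma nonlin_lipschitz:
  assumes "2 \<le> p"
  shows "norm (nonlin p u - nonlin p v) \<le> p * (max (sup_norm u) (sup_norm v)) powr (p - 1) * norm (u - v)"
  using trunc_nonlin_lipschitz[OF assms, of "max (sup_norm u) (sup_norm v)" u v] sup_norm_nonneg[of u]
  by (simp add: trunc_nonlin_eq[OF assms] le_max_iff_disj)

lemma norm_nonlin_le:
  assumes "1 \<le> p"
  shows "norm (nonlin p u) \<le> sup_norm u powr (p - 1) * norm u"
proof (rule ell2_norm_le)
  show "cmod (coord (nonlin p u) x) \<le> sup_norm u powr (p - 1) * cmod (coord u x)" for x
    using assms unfolding coord_nonlin[OF assms] norm_mult
    by (intro mult_right_mono) (auto intro!: powr_mono2 cmod_coord_le_sup_norm)
qed simp

locale nls = power_law +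
  fixes p :: real
  assumes p: "2 \<le> p"
begin

abbreviation "N \<equiv> nonlin p"
abbreviation "solution \<equiv> nls_solution (power_kernel \<alpha>) p"

definition trunc_field :: "int ell2 \<Rightarrow> int ell2" where
  "trunc_field u = (- \<i>) *\<^sub>C (L u - trunc_nonlin 1 p u)"

lemma trunc_field_eq: "norm u \<le> 1 \<Longrightarrow> trunc_field u = (- \<i>) *\<^sub>C (L u - N u)"
  using sup_norm_le_norm[of u] by (simp add: trunc_field_def trunc_nonlin_eq[OF p])

lemma trunc_field_lipschitz: "\<exists>B>0. \<forall>u v. norm (trunc_field u - trunc_field v) \<le> B * norm (u - v)"
proof -
  obtain B where B: "0 < B" "\<And>u. norm (L u) \<le> norm u * B"
    using bounded_linear.pos_bounded[OF L_linear] by blast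
  have "norm (trunc_field u - trunc_field v) \<le> (B + p) * norm (u - v)" for u v
  proof -
    have "trunc_field u - trunc_field v = (- \<i>) *\<^sub>C (L (u - v) - (trunc_nonlin 1 p u - trunc_nonlin 1 p v))"
      unfolding linear_diff[OF bounded_linear.linear[OF L_linear]]
      by (auto intro!: ell2_eqI simp: trunc_field_def algebra_simps)
    hence "norm (trunc_field u - trunc_field v) = norm (L (u - v) - (trunc_nonlin 1 p u - trunc_nonlin 1 p v))"
      by (simp add: norm_scaleC)
    also have "\<dots> \<le> norm (u - v) * B + p * 1 powr (p - 1) * norm (u - v)"
      by (rule norm_triangle_le_diff[OF add_mono[OF B(2) trunc_nonlin_lipschitz[OF p]]]) simp
    finally show ?thesis by (simp add: algebra_simps)
  qed
  thus ?thesis using B(1) p by (intro exI[of _ "B + p"]) auto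
qed

lemma trunc_field_skew: "u \<bullet> trunc_field u = 0"
proof -
  have "trunc_field u = (- \<i>) *\<^sub>C L u + \<i> *\<^sub>C trunc_nonlin 1 p u"
    by (auto intro!: ell2_eqI simp: trunc_field_def algebra_simps)
  thus ?thesis using inner_ii_trunc_nonlin[OF p, of 1 u] by (simp add: inner_add_right generator_skew)
qed

lemma solution_iff:
  "solution \<phi> u \<longleftrightarrow> u 0 = \<phi> \<and> (\<forall>t. (u has_vector_derivative (- \<i>) *\<^sub>C (L (u t) - N (u t))) (at t))"
proof -
  have "\<i> *\<^sub>C x = y \<longleftrightarrow> x = (- \<i>) *\<^sub>C y" for x y :: "int ell2"
  proof
    assume "\<i> *\<^sub>C x = y"
    hence "(- \<i>) *\<^sub>C y = (- \<i>) *\<^sub>C \<i> *\<^sub>C x" by simp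
    also have "\<dots> = x" by (auto intro!: ell2_eqI)
    finally show "x = (- \<i>) *\<^sub>C y" ..
  qed (auto intro!: ell2_eqI)
  thus ?thesis unfolding nls_solution_def by auto
qed

lemma norm_solution:
  assumes u: "solution \<phi> u"
  shows "norm (u t) = norm \<phi>"
proof -
  \<comment> \<open>The cap may depend on the vector: at level \<open>sup_norm v\<close> truncation
    is inactive at v, and skewness carries over.\<close>
  have skew: "v \<bullet> ((- \<i>) *\<^sub>C (L v - N v)) = 0" for v
  proof -
    have "(- \<i>) *\<^sub>C (L v - N v) = (- \<i>) *\<^sub>C L v + \<i> *\<^sub>C trunc_nonlin (sup_norm v) p v"
      unfolding trunc_nonlin_eq[OF p order_refl]
      by (auto intro!: ell2_eqI simp: algebra_simps)
    thus ?thesis by (simp add: inner_add_right generator_skew inner_ii_trunc_nonlin[OF p sup_norm_nonneg])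
  qed
  have "norm (u t) = norm (u 0)"
    by (rule norm_constant_if_orthogonal_derivative[OF _ skew]) (use u in \<open>simp add: solution_iff\<close>)
  thus ?thesis using u by (simp add: solution_iff)
qed

text \<open>The truncated flow conserves the norm, so its solution stays in the unit ball, where the
  cap 1 is inactive and the original equation holds.\<close>

lemma solution_exists:
  assumes "norm \<phi> \<le> 1"
  shows "\<exists>u. solution \<phi> u"
proof -
  obtain B where "0 < B" "\<And>u v. norm (trunc_field u - trunc_field v) \<le> B * norm (u - v)"
    using trunc_field_lipschitz by blast
  moreover have "trunc_field 0 = 0"
    using linear_0[OF bounded_linear.linear[OF L_linear]] p
    by (auto intro!: ell2_eqI simp: trunc_field_def trunc_nonlin_0)
  ultimately obtain u where u: "u 0 = \<phi>" "\<And>t. (u has_vector_derivative trunc_field (u t)) (at t)"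
    using global_solution_exists[of B trunc_field \<phi>] by blast
  have "norm (u t) = norm (u 0)" for t
    by (rule norm_constant_if_orthogonal_derivative[OF u(2) trunc_field_skew])
  hence "norm (u t) \<le> 1" for t using u(1) assms by simp
  hence "solution \<phi> u" unfolding solution_iff using u trunc_field_eq by metis
  thus ?thesis by blast
qed

lemma solution_unique:
  assumes "norm \<phi> \<le> 1" and u: "solution \<phi> u" and w: "solution \<phi> w"
  shows "w = u"
proof
  fix t
  obtain B where B: "\<And>u v. norm (trunc_field u - trunc_field v) \<le> B * norm (u - v)"
    using trunc_field_lipschitz by blast
  have d: "(y has_vector_derivative trunc_field (y t)) (at t)" if "solution \<phi> y" for y t
    using that norm_solution[OF that, of t] assms(1) by (simp add: solution_iff trunc_field_eq)
  have "w t - u t = 0"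
    by (rule gronwall_zero[OF has_vector_derivative_diff[OF d[OF w] d[OF u]] B])
      (use u w in \<open>simp add: solution_iff\<close>)
  thus "w t = u t" by simp
qed

end

section \<open>Scattering\<close>

lemma norm_diff_le_integral:
  fixes f :: "real \<Rightarrow> 'a::banach"
  assumes "x \<le> y" and f: "\<And>t. (f has_vector_derivative f' t) (at t)"
    and le: "\<And>t. t \<in> {x..y} \<Longrightarrow> norm (f' t) \<le> g t" and g: "g integrable_on {x..y}"
  shows "norm (f y - f x) \<le> integral {x..y} g"
proof -
  have "(f' has_integral (f y - f x)) {x..y}"
    by (rule fundamental_theorem_of_calculus[OF assms(1)]) (rule has_vector_derivative_at_within[OF f])
  thus ?thesis
    using integral_norm_bound_integral[OF has_integral_integrable g le] by (metis integral_unique)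
qed

lemma sum_unit_integrals:
  fixes a :: "real \<Rightarrow> real"
  assumes "continuous_on UNIV a"
  shows "(\<Sum>i<n. integral {x + real i..x + real (Suc i)} a) = integral {x..x + real n} a"
proof (induction n)
  case (Suc n)
  have "a integrable_on {x..x + real (Suc n)}"
    by (intro integrable_continuous_interval continuous_on_subset[OF assms]) simp
  from Henstock_Kurzweil_Integration.integral_combine[OF _ _ this, of "x + real n"] show ?case
    using Suc.IH by simp
qed simp

text \<open>The map is the identity plus a contraction, hence bi-Lipschitz onto its image. Preimages
  are found in the ball of twice the radius, and preservation of the norm puts them back into the
  original one.\<close>

lemma near_isometry_homeomorphism:
  fixes W :: "'a::banach \<Rightarrow> 'a"
  assumes \<delta>: "0 < \<delta>" and norm: "\<And>\<phi>. norm \<phi> \<le> 2 * \<delta> \<Longrightarrow> norm (W \<phi>) = norm \<phi>"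
    and lip: "\<And>\<phi> \<psi>. norm \<phi> \<le> 2 * \<delta> \<Longrightarrow> norm \<psi> \<le> 2 * \<delta> \<Longrightarrow>
      norm ((W \<phi> - W \<psi>) - (\<phi> - \<psi>)) \<le> 1 / 2 * norm (\<phi> - \<psi>)"
  shows "\<exists>V. homeomorphism (ball 0 \<delta>) (ball 0 \<delta>) W V"
proof -
  have upper: "norm (W \<phi> - W \<psi>) \<le> 3 / 2 * norm (\<phi> - \<psi>)" and lower: "norm (\<phi> - \<psi>) \<le> 2 * norm (W \<phi> - W \<psi>)"
    if "norm \<phi> < \<delta>" "norm \<psi> < \<delta>" for \<phi> \<psi>
  proof -
    have "norm ((W \<phi> - W \<psi>) - (\<phi> - \<psi>)) \<le> 1 / 2 * norm (\<phi> - \<psi>)" by (rule lip) (use that \<delta> in auto)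
    thus "norm (W \<phi> - W \<psi>) \<le> 3 / 2 * norm (\<phi> - \<psi>)" "norm (\<phi> - \<psi>) \<le> 2 * norm (W \<phi> - W \<psi>)"
      using norm_triangle_ineq2[of "W \<phi> - W \<psi>" "\<phi> - \<psi>"] norm_triangle_ineq3[of "W \<phi> - W \<psi>" "\<phi> - \<psi>"]
      by linarith+
  qed
  have inj: "inj_on W (ball 0 \<delta>)"
  proof (rule inj_onI)
    fix \<phi> \<psi> assume "\<phi> \<in> ball 0 \<delta>" "\<psi> \<in> ball 0 \<delta>" "W \<phi> = W \<psi>"
    thus "\<phi> = \<psi>" using lower[of \<phi> \<psi>] by (simp add: dist_norm)
  qed
  have surj: "W ` ball 0 \<delta> = ball 0 \<delta>"
  proof
    show "W ` ball 0 \<delta> \<subseteq> ball 0 \<delta>" using norm \<delta> by (auto simp: dist_norm)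
    show "ball 0 \<delta> \<subseteq> W ` ball 0 \<delta>"
    proof
      fix v :: 'a assume v: "v \<in> ball 0 \<delta>"
      \<comment> \<open>A preimage of v is a fixed point of f. The ball of radius 2 \<delta> is
        mapped into itself because |v| < \<delta> and |W \<phi> - \<phi>| \<le> |\<phi>|/2 \<le>
        \<delta>.\<close>
      define f where "f = (\<lambda>\<phi>. v - (W \<phi> - \<phi>))"
      have W0: "W 0 = 0" using norm[of 0] \<delta> by simp
      have "\<exists>!\<phi>\<in>cball 0 (2 * \<delta>). f \<phi> = \<phi>"
      proof (rule Banach_fix[where c = "1 / 2"])
        show "complete (cball (0 :: 'a) (2 * \<delta>))" by (simp add: complete_eq_closed)
        show "cball (0 :: 'a) (2 * \<delta>) \<noteq> {}" using \<delta> by simp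
        show "f ` cball 0 (2 * \<delta>) \<subseteq> cball 0 (2 * \<delta>)"
        proof safe
          fix \<phi> :: 'a assume "\<phi> \<in> cball 0 (2 * \<delta>)"
          hence \<phi>: "norm \<phi> \<le> 2 * \<delta>" by (simp add: dist_norm)
          have "norm ((W \<phi> - W 0) - (\<phi> - 0)) \<le> 1 / 2 * norm (\<phi> - 0)" by (rule lip) (use \<phi> \<delta> in auto)
          hence "norm (W \<phi> - \<phi>) \<le> \<delta>" using W0 \<phi> by simp
          hence "norm (f \<phi>) \<le> \<delta> + \<delta>"
            unfolding f_def using v norm_triangle_ineq4[of v "W \<phi> - \<phi>"] by (simp add: dist_norm)
          thus "f \<phi> \<in> cball 0 (2 * \<delta>)" by (simp add: dist_norm)
        qed
        fix x y :: 'a assume xy: "x \<in> cball 0 (2 * \<delta>)" "y \<in> cball 0 (2 * \<delta>)"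
          have "f x - f y = - ((W x - W y) - (x - y))" by (simp add: f_def)
          hence "norm (f x - f y) = norm ((W x - W y) - (x - y))" by (simp only: norm_minus_cancel)
          also have "\<dots> \<le> 1 / 2 * norm (x - y)" by (rule lip) (use xy in \<open>auto simp: dist_norm\<close>)
          finally show "dist (f x) (f y) \<le> 1 / 2 * dist x y" by (simp only: dist_norm)
      qed auto
      then obtain \<phi> where \<phi>: "norm \<phi> \<le> 2 * \<delta>" "f \<phi> = \<phi>" by (auto simp: dist_norm)
      hence "W \<phi> = v" by (simp add: f_def algebra_simps)
      moreover from this have "norm \<phi> < \<delta>" using norm[OF \<phi>(1)] v by (simp add: dist_norm)
      ultimately show "v \<in> W ` ball 0 \<delta>" by (auto simp: dist_norm)
    qed
  qed
  define V where "V = inv_into (ball 0 \<delta>) W"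
  have V: "V v \<in> ball 0 \<delta>" "W (V v) = v" if "v \<in> ball 0 \<delta>" for v
  proof -
    have "v \<in> W ` ball 0 \<delta>" using that surj by simp
    thus "V v \<in> ball 0 \<delta>" "W (V v) = v"
      unfolding V_def by (rule inv_into_into, rule f_inv_into_f)
  qed
  have "homeomorphism (ball 0 \<delta>) (ball 0 \<delta>) W V"
  proof (rule homeomorphismI)
    show "continuous_on (ball 0 \<delta>) W"
      by (rule lipschitz_on_continuous_on[of "3 / 2"], rule lipschitz_onI)
        (use upper in \<open>auto simp: dist_norm\<close>)
    show "continuous_on (ball 0 \<delta>) V"
    proof (rule lipschitz_on_continuous_on[of 2], rule lipschitz_onI)
      fix x y :: 'a assume xy: "x \<in> ball 0 \<delta>" "y \<in> ball 0 \<delta>"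
      show "dist (V x) (V y) \<le> 2 * dist x y"
        using lower[of "V x" "V y"] V[OF xy(1)] V[OF xy(2)] by (simp add: dist_norm)
    qed simp
    show "W ` ball 0 \<delta> \<subseteq> ball 0 \<delta>" using surj by simp
    show "V ` ball 0 \<delta> \<subseteq> ball 0 \<delta>" using V by blast
    show "V (W x) = x" if "x \<in> ball 0 \<delta>" for x unfolding V_def by (rule inv_into_f_f[OF inj that])
    show "W (V y) = y" if "y \<in> ball 0 \<delta>" for y by (rule V(2)[OF that])
  qed
  thus ?thesis by blast
qed

locale nls_scattering = nls +
  assumes pq: "real admissible_exponent + 1 \<le> p"
begin

definition strichartz_const :: real where
  "strichartz_const = (SOME C. 0 \<le> C \<and> (\<forall>n w \<tau> s. \<bar>s\<bar> = 1 \<longrightarrow>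
    (\<Sum>k<n. sup_norm (U (s * (real k + \<tau>)) (w k)) ^ admissible_exponent)
      \<le> (C * (norm (w 0) + (\<Sum>i<n - 1. norm (w (Suc i) - w i)))) ^ admissible_exponent))"

lemma strichartz_const: "0 \<le> strichartz_const"
  "\<bar>s\<bar> = 1 \<Longrightarrow> (\<Sum>k<n. sup_norm (U (s * (real k + \<tau>)) (w k)) ^ admissible_exponent)
      \<le> (strichartz_const * (norm (w 0) + (\<Sum>i<n - 1. norm (w (Suc i) - w i)))) ^ admissible_exponent"
  using someI_ex[OF strichartz] unfolding strichartz_const_def by blast+

text \<open>The entry 1/2 keeps data below the truncation level and the growth per unit time at most
  1/2. The other makes 2 \<open>strichartz_const\<close> \<open>small\<close> \<le> 1/(6p), where
  the factor 2 comes from the bootstrap hypothesis; adding 1 keeps the denominator positive.\<close>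

definition small :: real where
  "small = min (1 / 2) (1 / (6 * p) / (2 * strichartz_const + 1))"

lemma small: "0 < small" "small \<le> 1 / 2" "2 * strichartz_const * small \<le> 1 / (6 * p)"
proof -
  have p: "0 < p" using p by simp
  show "0 < small" "small \<le> 1 / 2" using p strichartz_const(1) by (auto simp: small_def)
  have "2 * strichartz_const * small \<le> (2 * strichartz_const + 1) * (1 / (6 * p) / (2 * strichartz_const + 1))"
    using strichartz_const(1) p by (intro mult_mono) (auto simp: small_def)
  also have "\<dots> = 1 / (6 * p)" using strichartz_const(1) by simp
  finally show "2 * strichartz_const * small \<le> 1 / (6 * p)" .
qed

text \<open>The sign s selects the direction of time, so scattering at both ends becomes a limit for
  t tending to plus infinity.\<close>

definition profile :: "real \<Rightarrow> (real \<Rightarrow> int ell2) \<Rightarrow> real \<Rightarrow> int ell2" where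
  "profile s u t = U (- (s * t)) (u (s * t))"

definition amplitude :: "real \<Rightarrow> (real \<Rightarrow> int ell2) \<Rightarrow> real \<Rightarrow> real" where
  "amplitude s u t = sup_norm (u (s * t)) ^ admissible_exponent"

lemma amplitude_nonneg: "0 \<le> amplitude s u t"
  by (simp add: amplitude_def sup_norm_nonneg)

lemma solution_profile: "u (s * t) = U (s * t) (profile s u t)"
  by (simp add: profile_def)

lemma norm_profile_diff: "norm (profile s u t - profile s v t) = norm (u (s * t) - v (s * t))"
  by (simp add: profile_def flip: U_diff)

lemma profile_0: "solution \<phi> u \<Longrightarrow> profile s u 0 = \<phi>"
  by (simp add: profile_def solution_iff)

lemma norm_profile: "solution \<phi> u \<Longrightarrow> norm (profile s u t) = norm \<phi>"
  by (simp add: profile_def norm_solution)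

lemma profile_deriv:
  assumes u: "solution \<phi> u"
  shows "(profile s u has_vector_derivative s *\<^sub>R U (- (s * t)) (\<i> *\<^sub>C N (u (s * t)))) (at t)"
proof -
  have "((\<lambda>t. U (- t) (u t)) has_vector_derivative U (- \<tau>) ((- \<i>) *\<^sub>C (L (u \<tau>) - N (u \<tau>)) + \<i> *\<^sub>C L (u \<tau>))) (at \<tau>)" for \<tau>
    by (rule U_pullback_deriv) (use u in \<open>simp add: solution_iff\<close>)
  moreover have "(- \<i>) *\<^sub>C (a - b) + \<i> *\<^sub>C a = \<i> *\<^sub>C b" for a b :: "int ell2"
    by (auto intro!: ell2_eqI simp: algebra_simps)
  ultimately have d: "((\<lambda>t. U (- t) (u t)) has_vector_derivative U (- \<tau>) (\<i> *\<^sub>C N (u \<tau>))) (at \<tau>)" for \<tau>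
    by simp
  have "((\<lambda>t. s * t) has_vector_derivative s) (at t)"
    by (auto intro!: derivative_eq_intros simp flip: has_real_derivative_iff_has_vector_derivative)
  from vector_diff_chain_at[OF this d] show ?thesis by (simp add: o_def profile_def[abs_def])
qed

lemma amplitude_continuous:
  assumes u: "solution \<phi> u"
  shows "continuous_on S (amplitude s u)"
proof -
  have "continuous_on UNIV u"
    by (intro continuous_at_imp_continuous_on ballI has_vector_derivative_continuous)
      (use u in \<open>auto simp: solution_iff\<close>)
  hence "continuous_on S (\<lambda>t. u (s * t))"
    by (rule continuous_on_compose2) (auto intro!: continuous_intros)
  thus ?thesis
    unfolding amplitude_def[abs_def]
    by (intro continuous_on_power continuous_on_compose2[OF continuous_on_sup_norm[of UNIV]]) auto
qed

lemma amplitude_integrable: "solution \<phi> u \<Longrightarrow> amplitude s u integrable_on {x..y}"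
  by (rule integrable_continuous_interval[OF amplitude_continuous])

text \<open>The threshold \<open>pq\<close> enters here: amplitudes are at most 1, so lowering the
  exponent from p - 1 to the Strichartz exponent only increases the power.\<close>

lemma sup_powr_le_amplitude:
  assumes u: "solution \<phi> u" and "norm \<phi> \<le> 1"
  shows "sup_norm (u (s * t)) powr (p - 1) \<le> amplitude s u t"
proof -
  let ?x = "sup_norm (u (s * t))"
  have x: "0 \<le> ?x" "?x \<le> 1"
    using sup_norm_nonneg sup_norm_le_norm[of "u (s * t)"] norm_solution[OF u] assms(2) by auto
  show ?thesis
  proof (cases "?x = 0")
    case False
    hence "?x powr (p - 1) \<le> ?x powr real admissible_exponent"
      using x pq by (intro powr_mono') auto
    thus ?thesis using False x by (simp add: amplitude_def powr_realpow)
  qed (simp add: amplitude_nonneg)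
qed

lemma profile_variation:
  assumes u: "solution \<phi> u" and \<phi>: "norm \<phi> \<le> 1" and s: "\<bar>s\<bar> = 1" and "x \<le> y"
  shows "norm (profile s u y - profile s u x) \<le> norm \<phi> * integral {x..y} (amplitude s u)"
proof -
  have "norm (profile s u y - profile s u x) \<le> integral {x..y} (\<lambda>t. norm \<phi> * amplitude s u t)"
  proof (rule norm_diff_le_integral[OF \<open>x \<le> y\<close> profile_deriv[OF u]])
    fix t
    have "norm (s *\<^sub>R U (- (s * t)) (\<i> *\<^sub>C N (u (s * t)))) = norm (N (u (s * t)))"
      by (simp add: s norm_scaleC)
    also have "\<dots> \<le> sup_norm (u (s * t)) powr (p - 1) * norm (u (s * t))"
      using p by (intro norm_nonlin_le) simp
    also have "\<dots> \<le> amplitude s u t * norm \<phi>"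
      unfolding norm_solution[OF u] by (intro mult_right_mono sup_powr_le_amplitude[OF u \<phi>]) simp
    finally show "norm (s *\<^sub>R U (- (s * t)) (\<i> *\<^sub>C N (u (s * t)))) \<le> norm \<phi> * amplitude s u t"
      by (simp add: mult.commute)
  qed (intro integrable_on_mult_right amplitude_integrable[OF u])
  thus ?thesis by simp
qed

lemma integral_amplitude_mono:
  assumes u: "solution \<phi> u" and "a \<le> x" "y \<le> b"
  shows "integral {x..y} (amplitude s u) \<le> integral {a..b} (amplitude s u)"
  by (rule integral_subset_le) (use assms amplitude_integrable[OF u] amplitude_nonneg in auto)

text \<open>The integral over [0, n] is the average over offsets \<tau> of sums over the times k +
  \<tau>. At these times the solution is the linear flow applied to profiles, so the sampled
  estimate applies, and \<open>profile_variation\<close> brings the same integral back on the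
  right.\<close>

lemma spacetime_bound:
  assumes u: "solution \<phi> u" and \<phi>: "norm \<phi> \<le> 1" and s: "\<bar>s\<bar> = 1"
  shows "integral {0..real n} (amplitude s u)
    \<le> (strichartz_const * (norm \<phi> + norm \<phi> * integral {0..real n} (amplitude s u))) ^ admissible_exponent"
proof (cases n)
  case 0
  thus ?thesis using strichartz_const(1) by simp
next
  case (Suc m)
  let ?a = "amplitude s u" and ?I = "integral {0..real n} (amplitude s u)" and ?q = admissible_exponent
  let ?R = "(strichartz_const * (norm \<phi> + norm \<phi> * ?I)) ^ ?q"
  have cont: "continuous_on S ?a" for S by (rule amplitude_continuous[OF u])
  have pointwise: "(\<Sum>k<n. ?a (real k + \<tau>)) \<le> ?R" if \<tau>: "\<tau> \<in> {0..1}" for \<tau>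
  proof -
    define w where "w = (\<lambda>k. profile s u (real k + \<tau>))"
    have "(\<Sum>k<n. ?a (real k + \<tau>)) = (\<Sum>k<n. sup_norm (U (s * (real k + \<tau>)) (w k)) ^ ?q)"
      unfolding w_def by (simp add: amplitude_def flip: solution_profile)
    also have "\<dots> \<le> (strichartz_const * (norm (w 0) + (\<Sum>i<n - 1. norm (w (Suc i) - w i)))) ^ ?q"
      by (rule strichartz_const(2)[OF s])
    also have "\<dots> \<le> ?R"
    proof (intro power_mono mult_left_mono add_mono)
      show "norm (w 0) \<le> norm \<phi>" by (simp add: w_def norm_profile[OF u])
      have "(\<Sum>i<n - 1. norm (w (Suc i) - w i)) \<le> (\<Sum>i<n - 1. norm \<phi> * integral {\<tau> + real i..\<tau> + real (Suc i)} ?a)"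
        unfolding w_def add.commute[of _ \<tau>]
        by (intro sum_mono profile_variation[OF u \<phi> s]) simp
      \<comment> \<open>There are n - 1 increments and \<tau> \<le> 1, so the interval of
        integration does not go beyond n.\<close>
      also have "\<dots> = norm \<phi> * integral {\<tau>..\<tau> + real (n - 1)} ?a"
        unfolding sum_distrib_left[symmetric] sum_unit_integrals[OF cont] ..
      also have "\<dots> \<le> norm \<phi> * ?I"
        using \<tau> Suc by (intro mult_left_mono integral_amplitude_mono[OF u]) auto
      finally show "(\<Sum>i<n - 1. norm (w (Suc i) - w i)) \<le> norm \<phi> * ?I" .
      show "0 \<le> strichartz_const" by (rule strichartz_const(1))
      show "0 \<le> strichartz_const * (norm (w 0) + (\<Sum>i<n - 1. norm (w (Suc i) - w i)))"
        by (intro mult_nonneg_nonneg add_nonneg_nonneg sum_nonneg strichartz_const(1)) auto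
    qed
    finally show ?thesis .
  qed
  have int: "(\<lambda>\<tau>. ?a (real k + \<tau>)) integrable_on {0..1}" for k
    by (intro integrable_continuous_interval continuous_on_compose2[OF cont[of UNIV]] continuous_intros) auto
  have "?I = (\<Sum>k<n. integral {0 + real k..0 + real (Suc k)} ?a)"
    unfolding sum_unit_integrals[OF cont] by simp
  also have "\<dots> = (\<Sum>k<n. integral {0..1} (\<lambda>\<tau>. ?a (real k + \<tau>)))"
  proof (rule sum.cong[OF refl])
    fix k
    show "integral {0 + real k..0 + real (Suc k)} ?a = integral {0..1} (\<lambda>\<tau>. ?a (real k + \<tau>))"
      using integral_shift_Icc_real[of 0 1 ?a "real k"] by (simp add: o_def add.commute)
  qed
  also have "\<dots> = integral {0..1} (\<lambda>\<tau>. \<Sum>k<n. ?a (real k + \<tau>))"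
    by (rule integral_sum[symmetric]) (auto intro: int)
  also have "\<dots> \<le> integral {0..1} (\<lambda>\<tau> :: real. ?R)"
    by (rule integral_le) (use pointwise int in \<open>auto intro!: integrable_sum\<close>)
  finally show ?thesis by simp
qed

text \<open>Over a unit of time the space-time norm grows by at most \<open>1/2\<close>, so the a priori bound
  propagates from \<open>n\<close> to \<open>n + 1\<close>.\<close>
lemma spacetime_small:
  assumes u: "solution \<phi> u" and \<phi>: "norm \<phi> \<le> small" and s: "\<bar>s\<bar> = 1"
  shows "integral {0..real n} (amplitude s u) \<le> 1 / (6 * p)"
proof -
  have \<phi>1: "norm \<phi> \<le> 1" using \<phi> small(2) by linarith
  have p6: "1 / (6 * p) \<le> 1 / 2" using p by (simp add: field_simps)
  let ?G = "\<lambda>n. integral {0..real n} (amplitude s u)" and ?q = admissible_exponent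
  \<comment> \<open>Under the hypothesis that the integral is at most 1, the Strichartz right side
    sees at most twice the data. The base is then at most 1/(6p) < 1, and raising it to a power only
    helps.\<close>
  have improve: "?G n \<le> 1 / (6 * p)" if "?G n \<le> 1" for n
  proof -
    have G0: "0 \<le> ?G n" by (rule integral_nonneg[OF amplitude_integrable[OF u]]) (rule amplitude_nonneg)
    hence "norm \<phi> + norm \<phi> * ?G n \<le> 2 * small"
      using \<phi> mult_mono[OF \<phi> that] small by simp
    hence "strichartz_const * (norm \<phi> + norm \<phi> * ?G n) \<le> strichartz_const * (2 * small)"
      by (intro mult_left_mono strichartz_const)
    also have "\<dots> \<le> 1 / (6 * p)" using small(3) by simp
    finally have le: "strichartz_const * (norm \<phi> + norm \<phi> * ?G n) \<le> 1 / (6 * p)" .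
    have "0 \<le> strichartz_const * (norm \<phi> + norm \<phi> * ?G n)"
      using strichartz_const(1) G0 by (intro mult_nonneg_nonneg add_nonneg_nonneg) auto
    hence "(strichartz_const * (norm \<phi> + norm \<phi> * ?G n)) ^ ?q \<le> (1 / (6 * p)) ^ ?q"
      by (intro power_mono le)
    also have "\<dots> \<le> (1 / (6 * p)) ^ 1"
      using p p6 admissible_exponent_ge by (intro power_decreasing) auto
    finally show ?thesis using spacetime_bound[OF u \<phi>1 s, of n] by simp
  qed
  show ?thesis
  proof (induction n)
    case (Suc n)
    have "?G (Suc n) = ?G n + integral {real n..real (Suc n)} (amplitude s u)"
      by (subst Henstock_Kurzweil_Integration.integral_combine[OF _ _ amplitude_integrable[OF u]]) auto
    also have "integral {real n..real (Suc n)} (amplitude s u) \<le> integral {real n..real (Suc n)} (\<lambda>_. 1 / 2)"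
    proof (rule integral_le[OF amplitude_integrable[OF u]])
      fix t
      have "sup_norm (u (s * t)) \<le> 1 / 2"
        using sup_norm_le_norm[of "u (s * t)"] norm_solution[OF u] \<phi> small(2) by (metis order_trans)
      hence "sup_norm (u (s * t)) ^ ?q \<le> (1 / 2) ^ ?q" by (intro power_mono sup_norm_nonneg)
      also have "\<dots> \<le> (1 / 2) ^ 1" using admissible_exponent_ge by (intro power_decreasing) auto
      finally show "amplitude s u t \<le> 1 / 2" by (simp add: amplitude_def)
    qed (rule integrable_const_ivl)
    finally have "?G (Suc n) \<le> 1" using Suc.IH p6 by simp
    thus ?case by (rule improve)
  qed (use p in simp)
qed

lemma spacetime_small_real:
  assumes u: "solution \<phi> u" and \<phi>: "norm \<phi> \<le> small" and s: "\<bar>s\<bar> = 1"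
  shows "integral {0..t} (amplitude s u) \<le> 1 / (6 * p)"
proof -
  have "t \<le> real (nat \<lceil>t\<rceil>)" by linarith
  from integral_amplitude_mono[OF u order_refl this] spacetime_small[OF assms] show ?thesis
    using order_trans by blast
qed

text \<open>Absorption at the maximum Z of the difference replaces a Gronwall argument: the
  derivative integrates to at most p Z (1/(6p) + 1/(6p)) = Z/3, hence Z \<le> |z(0)| + Z/3 and Z/3
  \<le> |z(0)|/2. The bound 1/(6p) is chosen for this 1/2.\<close>

lemma profile_diff_lipschitz:
  assumes u: "solution \<phi> u" and \<phi>: "norm \<phi> \<le> small" and v: "solution \<psi> v" and \<psi>: "norm \<psi> \<le> small"
    and s: "\<bar>s\<bar> = 1" and "0 \<le> T"
  shows "norm ((profile s u T - profile s v T) - (\<phi> - \<psi>)) \<le> 1 / 2 * norm (\<phi> - \<psi>)"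
proof -
  have \<phi>1: "norm \<phi> \<le> 1" and \<psi>1: "norm \<psi> \<le> 1" using \<phi> \<psi> small(2) by linarith+
  define z where "z = (\<lambda>t. profile s u t - profile s v t)"
  let ?z' = "\<lambda>t. s *\<^sub>R U (- (s * t)) (\<i> *\<^sub>C N (u (s * t))) - s *\<^sub>R U (- (s * t)) (\<i> *\<^sub>C N (v (s * t)))"
  have z': "(z has_vector_derivative ?z' t) (at t)" for t
    unfolding z_def by (rule has_vector_derivative_diff[OF profile_deriv[OF u] profile_deriv[OF v]])
  have z0: "z 0 = \<phi> - \<psi>" by (simp add: z_def profile_0[OF u] profile_0[OF v])
  have "continuous_on {0..T} z"
    by (intro continuous_at_imp_continuous_on ballI has_vector_derivative_continuous[OF z'])
  hence "continuous_on {0..T} (\<lambda>t. norm (z t))" by (rule continuous_on_norm)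
  then obtain t0 where t0: "t0 \<in> {0..T}" "\<And>t. t \<in> {0..T} \<Longrightarrow> norm (z t) \<le> norm (z t0)"
    using continuous_attains_sup[of "{0..T}" "\<lambda>t. norm (z t)"] \<open>0 \<le> T\<close> by auto
  let ?Z = "norm (z t0)"
  have deriv_le: "norm (?z' t) \<le> p * ?Z * (amplitude s u t + amplitude s v t)" if t: "t \<in> {0..T}" for t
  proof -
    have "?z' t = s *\<^sub>R U (- (s * t)) (\<i> *\<^sub>C (N (u (s * t)) - N (v (s * t))))"
      by (simp add: scaleC_diff_right U_diff scaleR_diff_right)
    hence "norm (?z' t) = norm (N (u (s * t)) - N (v (s * t)))"
      by (simp add: s norm_scaleC)
    also have "\<dots> \<le> p * (max (sup_norm (u (s * t))) (sup_norm (v (s * t)))) powr (p - 1) * norm (u (s * t) - v (s * t))"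
      by (rule nonlin_lipschitz[OF p])
    also have "\<dots> \<le> p * (amplitude s u t + amplitude s v t) * ?Z"
    proof (intro mult_mono)
      show "max (sup_norm (u (s * t))) (sup_norm (v (s * t))) powr (p - 1) \<le> amplitude s u t + amplitude s v t"
        using sup_powr_le_amplitude[OF u \<phi>1, of s t] sup_powr_le_amplitude[OF v \<psi>1, of s t]
          amplitude_nonneg[of s u t] amplitude_nonneg[of s v t]
        by (simp add: max_def)
      show "norm (u (s * t) - v (s * t)) \<le> ?Z"
        using t0(2)[OF t] by (simp add: z_def norm_profile_diff)
    qed (use p amplitude_nonneg in auto)
    finally show ?thesis by (simp add: mult_ac)
  qed
  have third: "norm (z t - z 0) \<le> ?Z / 3" if t: "t \<in> {0..T}" for t
  proof -
    have "norm (z t - z 0) \<le> integral {0..t} (\<lambda>t. p * ?Z * (amplitude s u t + amplitude s v t))"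
      by (rule norm_diff_le_integral[OF _ z' deriv_le])
        (use t in \<open>auto intro!: integrable_on_mult_right integrable_add amplitude_integrable[OF u] amplitude_integrable[OF v]\<close>)
    also have "\<dots> = p * ?Z * (integral {0..t} (amplitude s u) + integral {0..t} (amplitude s v))"
      by (simp add: integral_add[OF amplitude_integrable[OF u] amplitude_integrable[OF v]])
    also have "\<dots> \<le> p * ?Z * (1 / (6 * p) + 1 / (6 * p))"
      using p by (intro mult_left_mono add_mono spacetime_small_real[OF u \<phi> s] spacetime_small_real[OF v \<psi> s]) auto
    also have "\<dots> = ?Z / 3" using p by (simp add: field_simps)
    finally show ?thesis .
  qed
  have "?Z \<le> norm (z 0) + ?Z / 3"
    using third[OF t0(1)] norm_triangle_ineq2[of "z t0" "z 0"] by linarith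
  hence "?Z / 3 \<le> 1 / 2 * norm (z 0)" by linarith
  thus ?thesis using third[of T] \<open>0 \<le> T\<close> z0 by (simp add: z_def)
qed

text \<open>The integrated amplitude is increasing and bounded, and its increments dominate those of
  the profile. Completeness gives a limit along the integers, and the same domination extends it to
  real times.\<close>

lemma profile_convergent:
  assumes u: "solution \<phi> u" and \<phi>: "norm \<phi> \<le> small" and s: "\<bar>s\<bar> = 1"
  shows "\<exists>w. (profile s u \<longlongrightarrow> w) at_top"
proof -
  have \<phi>1: "norm \<phi> \<le> 1" using \<phi> small(2) by linarith
  let ?G = "\<lambda>t. integral {0..t} (amplitude s u)"
  have var: "norm (profile s u y - profile s u x) \<le> ?G y - ?G x" if "0 \<le> x" "x \<le> y" for x y
  proof -
    have i: "0 \<le> integral {x..y} (amplitude s u)"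
      by (rule integral_nonneg[OF amplitude_integrable[OF u]]) (rule amplitude_nonneg)
    have "norm (profile s u y - profile s u x) \<le> 1 * integral {x..y} (amplitude s u)"
      using profile_variation[OF u \<phi>1 s that(2)] mult_right_mono[OF \<phi>1 i] by linarith
    moreover have "?G x + integral {x..y} (amplitude s u) = ?G y"
      by (rule Henstock_Kurzweil_Integration.integral_combine[OF that amplitude_integrable[OF u]])
    ultimately show ?thesis by linarith
  qed
  define l where "l = (SUP n. ?G (real n))"
  have bdd: "bdd_above (range (\<lambda>n. ?G (real n)))"
    by (rule bdd_aboveI2[where M = "1 / (6 * p)"]) (rule spacetime_small[OF assms])
  have inc: "incseq (\<lambda>n. ?G (real n))"
    by (intro incseq_SucI integral_amplitude_mono[OF u]) auto
  have Gn: "(\<lambda>n. ?G (real n)) \<longlonglongrightarrow> l" unfolding l_def by (rule LIMSEQ_incseq_SUP[OF bdd inc])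
  have Gl: "?G t \<le> l" for t
  proof -
    have "t \<le> real (nat \<lceil>t\<rceil>)" by linarith
    hence "?G t \<le> ?G (real (nat \<lceil>t\<rceil>))" by (rule integral_amplitude_mono[OF u order_refl])
    moreover have "?G (real (nat \<lceil>t\<rceil>)) \<le> l" unfolding l_def by (rule cSUP_upper[OF _ bdd]) simp
    ultimately show ?thesis by linarith
  qed
  have "Cauchy (\<lambda>n. profile s u (real n))"
  proof (rule metric_CauchyI)
    fix e :: real assume "0 < e"
    then obtain M where M: "\<And>n. M \<le> n \<Longrightarrow> \<bar>?G (real n) - l\<bar> < e"
      using LIMSEQ_D[OF Gn] by auto
    have "dist (profile s u (real m)) (profile s u (real n)) < e" if "M \<le> m" "M \<le> n" for m n
      using that
    proof (induction m n rule: linorder_wlog)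
      case (le m n)
      have "norm (profile s u (real n) - profile s u (real m)) \<le> l - ?G (real m)"
        using var[of "real m" "real n"] Gl[of "real n"] le by simp
      thus ?case using M[of m] le by (simp add: dist_norm norm_minus_commute)
    next
      case (sym m n)
      thus ?case by (simp add: dist_commute)
    qed
    thus "\<exists>M. \<forall>m\<ge>M. \<forall>n\<ge>M. dist (profile s u (real m)) (profile s u (real n)) < e" by blast
  qed
  then obtain w where w: "(\<lambda>n. profile s u (real n)) \<longlonglongrightarrow> w"
    using Cauchy_convergent convergent_def by blast
  have "(profile s u \<longlongrightarrow> w) at_top"
  proof (rule tendstoI)
    fix e :: real assume e: "0 < e"
    have "\<forall>\<^sub>F n in sequentially. dist (?G (real n)) l < e / 2 \<and> dist (profile s u (real n)) w < e / 2"
      using e by (intro eventually_conj tendstoD[OF Gn] tendstoD[OF w]) auto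
    then obtain n where n: "dist (?G (real n)) l < e / 2" "dist (profile s u (real n)) w < e / 2"
      using eventually_happens'[OF sequentially_bot] by blast
    have "dist (profile s u t) w < e" if "real n \<le> t" for t
    proof -
      have "dist (profile s u t) (profile s u (real n)) < e / 2"
        using var[OF of_nat_0_le_iff that] Gl[of t] n(1) unfolding dist_norm real_norm_def by linarith
      thus ?thesis using n(2) dist_triangle[of "profile s u t" w "profile s u (real n)"] by linarith
    qed
    thus "\<forall>\<^sub>F t in at_top. dist (profile s u t) w < e"
      using eventually_ge_at_top[of "real n"] by (rule eventually_mono[rotated])
  qed
  thus ?thesis ..
qed

definition wave_map :: "real \<Rightarrow> int ell2 \<Rightarrow> int ell2" where
  "wave_map s \<phi> = Lim at_top (profile s (SOME u. solution \<phi> u))"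

lemma profile_tendsto_wave_map:
  assumes u: "solution \<phi> u" and \<phi>: "norm \<phi> \<le> small" and s: "\<bar>s\<bar> = 1"
  shows "(profile s u \<longlongrightarrow> wave_map s \<phi>) at_top"
proof -
  have "(SOME u. solution \<phi> u) = u"
    using solution_unique[OF _ u] someI[of "solution \<phi>", OF u] \<phi> small(2) by auto
  thus ?thesis
    using profile_convergent[OF assms] tendsto_Lim[OF trivial_limit_at_top_linorder]
    unfolding wave_map_def by metis
qed

lemma norm_wave_map:
  assumes \<phi>: "norm \<phi> \<le> small" and s: "\<bar>s\<bar> = 1"
  shows "norm (wave_map s \<phi>) = norm \<phi>"
proof -
  obtain u where u: "solution \<phi> u" using solution_exists[of \<phi>] \<phi> small(2) by auto
  from tendsto_norm[OF profile_tendsto_wave_map[OF u assms]]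
  have "((\<lambda>_. norm \<phi>) \<longlongrightarrow> norm (wave_map s \<phi>)) (at_top :: real filter)" by (simp add: norm_profile[OF u])
  thus ?thesis by (simp add: tendsto_const_iff)
qed

lemma wave_map_lipschitz:
  assumes \<phi>: "norm \<phi> \<le> small" and \<psi>: "norm \<psi> \<le> small" and s: "\<bar>s\<bar> = 1"
  shows "norm ((wave_map s \<phi> - wave_map s \<psi>) - (\<phi> - \<psi>)) \<le> 1 / 2 * norm (\<phi> - \<psi>)"
proof -
  obtain u where u: "solution \<phi> u" using solution_exists[of \<phi>] \<phi> small(2) by auto
  obtain v where v: "solution \<psi> v" using solution_exists[of \<psi>] \<psi> small(2) by auto
  show ?thesis
  proof (rule tendsto_upperbound)
    show "((\<lambda>t. norm ((profile s u t - profile s v t) - (\<phi> - \<psi>))) \<longlongrightarrow>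
        norm ((wave_map s \<phi> - wave_map s \<psi>) - (\<phi> - \<psi>))) at_top"
      by (intro tendsto_intros profile_tendsto_wave_map[OF u \<phi> s] profile_tendsto_wave_map[OF v \<psi> s])
    show "\<forall>\<^sub>F t in at_top. norm ((profile s u t - profile s v t) - (\<phi> - \<psi>)) \<le> 1 / 2 * norm (\<phi> - \<psi>)"
      using eventually_ge_at_top[of 0]
      by eventually_elim (rule profile_diff_lipschitz[OF u \<phi> v \<psi> s])
  qed simp
qed

text \<open>Applying the inverse isometric flow turns the scattering condition into convergence of
  the profile to v, so uniqueness of limits decides it.\<close>

lemma asymptotic_state_iff:
  assumes u: "solution \<phi> u" and \<phi>: "norm \<phi> \<le> small" and s: "\<bar>s\<bar> = 1"
  shows "norm v = norm \<phi> \<and> ((\<lambda>t. u (s * t) - U (s * t) v) \<longlongrightarrow> 0) at_top \<longleftrightarrow> v = wave_map s \<phi>"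
proof -
  have "norm (u (s * t) - U (s * t) v) = norm (profile s u t - v)" for t
    by (subst solution_profile) (simp flip: U_diff)
  hence "((\<lambda>t. u (s * t) - U (s * t) v) \<longlongrightarrow> 0) at_top \<longleftrightarrow> ((\<lambda>t. profile s u t - v) \<longlongrightarrow> 0) at_top"
    using tendsto_norm_zero_iff[of "\<lambda>t. u (s * t) - U (s * t) v" at_top]
      tendsto_norm_zero_iff[of "\<lambda>t. profile s u t - v" at_top] by simp
  also have "\<dots> \<longleftrightarrow> (profile s u \<longlongrightarrow> v) at_top" by (rule Lim_null[symmetric])
  also have "\<dots> \<longleftrightarrow> v = wave_map s \<phi>"
    using profile_tendsto_wave_map[OF assms] tendsto_unique[OF trivial_limit_at_top_linorder] by blast
  finally show ?thesis using norm_wave_map[OF \<phi> s] by auto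
qed

text \<open>The radius is halved because \<open>near_isometry_homeomorphism\<close> needs its
  estimates on the ball of twice the radius.\<close>

lemma wave_map_homeomorphism:
  assumes "\<bar>s\<bar> = 1"
  shows "\<exists>V. homeomorphism (ball 0 (small / 2)) (ball 0 (small / 2)) (wave_map s) V"
  by (rule near_isometry_homeomorphism)
    (use small(1) norm_wave_map[OF _ assms] wave_map_lipschitz[OF _ _ assms] in auto)

end

theorem proposition4p3:
  fixes \<alpha> p :: real
  assumes "0 < \<alpha>"
    and "\<alpha> \<le> 1 \<Longrightarrow> 5 \<le> p"
    and "1 < \<alpha> \<Longrightarrow> 7 \<le> p"
  shows "\<exists>\<delta>>0. \<exists>W_plus W_minus :: int ell2 \<Rightarrow> int ell2.
    (\<forall>\<phi>. norm \<phi> < \<delta> \<longrightarrow>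
      (\<exists>u. nls_solution (power_kernel \<alpha>) p \<phi> u \<and>
           (\<forall>w. nls_solution (power_kernel \<alpha>) p \<phi> w \<longrightarrow> w = u) \<and>
           (\<forall>v. norm v = norm \<phi> \<and> ((\<lambda>t. u t - linear_flow (power_kernel \<alpha>) t v) \<longlongrightarrow> 0) at_top
                \<longleftrightarrow> v = W_plus \<phi>) \<and>
           (\<forall>v. norm v = norm \<phi> \<and> ((\<lambda>t. u t - linear_flow (power_kernel \<alpha>) t v) \<longlongrightarrow> 0) at_bot
                \<longleftrightarrow> v = W_minus \<phi>))) \<and>
    (\<exists>V. homeomorphism (ball 0 \<delta>) (ball 0 \<delta>) W_plus V) \<and>
    (\<exists>V. homeomorphism (ball 0 \<delta>) (ball 0 \<delta>) W_minus V)"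
proof -
  interpret power_law \<alpha> by unfold_locales (rule assms(1))
  have "5 \<le> p" using assms(2,3) by (cases "\<alpha> \<le> 1") auto
  moreover have "real admissible_exponent + 1 \<le> p"
    using assms(2,3) by (auto simp: admissible_exponent_def)
  ultimately interpret nls_scattering \<alpha> p by unfold_locales auto
  have s: "\<bar>1 :: real\<bar> = 1" "\<bar>- 1 :: real\<bar> = 1" by simp_all
  have main: "\<exists>u. solution \<phi> u \<and> (\<forall>w. solution \<phi> w \<longrightarrow> w = u) \<and>
      (\<forall>v. norm v = norm \<phi> \<and> ((\<lambda>t. u t - U t v) \<longlongrightarrow> 0) at_top \<longleftrightarrow> v = wave_map 1 \<phi>) \<and>
      (\<forall>v. norm v = norm \<phi> \<and> ((\<lambda>t. u t - U t v) \<longlongrightarrow> 0) at_bot \<longleftrightarrow> v = wave_map (- 1) \<phi>)"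
    if "norm \<phi> < small / 2" for \<phi>
  proof -
    have \<phi>: "norm \<phi> \<le> small" "norm \<phi> \<le> 1" using that small(1,2) by linarith+
    obtain u where u: "solution \<phi> u" using solution_exists[OF \<phi>(2)] by blast
    moreover have "\<forall>w. solution \<phi> w \<longrightarrow> w = u" using solution_unique[OF \<phi>(2) u] by blast
    moreover have "norm v = norm \<phi> \<and> ((\<lambda>t. u t - U t v) \<longlongrightarrow> 0) at_top \<longleftrightarrow> v = wave_map 1 \<phi>" for v
      using asymptotic_state_iff[OF u \<phi>(1) s(1), of v] by simp
    \<comment> \<open>Reflecting time turns the limit at minus infinity into the case s = -1 of the
      limit at plus infinity.\<close>
    moreover have "norm v = norm \<phi> \<and> ((\<lambda>t. u t - U t v) \<longlongrightarrow> 0) at_bot \<longleftrightarrow> v = wave_map (- 1) \<phi>" for v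
      using asymptotic_state_iff[OF u \<phi>(1) s(2), of v]
      unfolding filterlim_at_bot_mirror by simp
    ultimately show ?thesis by blast
  qed
  show ?thesis
  proof (rule exI[of _ "small / 2"], rule conjI, goal_cases)
    case 2
    show ?case
      by (rule exI[of _ "wave_map 1"], rule exI[of _ "wave_map (- 1)"], intro conjI allI impI)
        (rule main wave_map_homeomorphism s | assumption)+
  qed (use small(1) in simp)
qed

end
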